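(* Let $0<\alpha<1$ and let $1\le k\le n$ be integers. For $t>0$ let $$\mathbb{G}_{\alpha}^{(n,k)}(t)=\frac{\alpha^{k}}{t^{n}\,\Gamma(n-k\alpha)\,f_{\alpha}(t)}\int_{0}^{t}f_{\alpha}(t-v)\,v^{n-k\alpha-1}\,dv=\frac{\alpha^{k}t^{-k\alpha}}{\Gamma(n-k\alpha)f_{\alpha}(t)}\int_{0}^{1}f_{\alpha}(tu)(1-u)^{n-k\alpha-1}\,du .$$ Then: (i) For all $t>0$, $$\mathbb{G}^{(n,k)}_{\alpha}(t)=\frac{\alpha^{k-1}\Gamma(k)}{\Gamma(n)}\,\frac{\tilde f_{\alpha,(n,k)}(t)}{f_{\alpha}(t)},$$ where $\tilde f_{\alpha,(n,k)}$ is the density of the random variables $$\frac{S_{\alpha,k\alpha}}{\beta_{k\alpha,\,n-k\alpha}}\overset{d}{=}\frac{S_{\alpha,(k-1)\alpha}}{\beta_{(k-1)\alpha+1,\;n-1-(k-1)\alpha}} ,$$ which are equal in distribution. In particular, for $k=1$, $\;S_{\alpha}/\beta_{1,n-1}\overset{d}{=}S_{\alpha,\alpha}/\beta_{\alpha,n-\alpha}$. (ii) For all $t>0$, $\mathbb{G}^{(n,k)}_{\alpha}(t)$ is a ratio of Fox $H$-functions: $$\mathbb{G}^{(n,k)}_{\alpha}(t)=\alpha^{k}\,\frac{H^{0,1}_{1,1}\left[t\,\middle|\,\begin{matrix}(1-\frac1\alpha-k,\frac1\alpha)\\(-n,1)\end{matrix}\right]}{H^{0,1}_{1,1}\left[t\,\middle|\,\begin{matrix}(1-\frac1\alpha,\frac1\alpha)\\(0,1)\end{matrix}\right]}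 .$$
   Context: For $0<\alpha<1$, $S_\alpha$ is a positive $\alpha$-stable random variable with $\mathbb{E}[e^{-\lambda S_\alpha}]=e^{-\lambda^\alpha}$, $\lambda>0$, and density $f_\alpha$ on $(0,\infty)$. For $\theta>-\alpha$, $S_{\alpha,\theta}$ is a positive random variable with density $\frac{\Gamma(\theta+1)}{\Gamma(\theta/\alpha+1)}t^{-\theta}f_\alpha(t)$, $t>0$ (so $S_{\alpha,0}\overset{d}{=}S_\alpha$). $\beta_{a,b}$ is a beta$(a,b)$ random variable, with the convention $\beta_{a,0}=1$. Random variables appearing in the same product or quotient are independent. Fox $H$-function: for integers $0\le M\le Q$, $0\le N\le P$, complex $a_i,b_j$ and positive $A_i,B_j$, $$H^{M,N}_{P,Q}\left[z\,\middle|\,\begin{matrix}(a_i,A_i)_{1}^{P}\\(b_j,B_j)_{1}^{Q}\end{matrix}\right]=\frac1{2\pi i}\int_{\mathfrak L}\frac{\prod_{j=1}^{M}\Gamma(b_j+B_js)\prod_{i=1}^{N}\Gamma(1-a_i-A_is)}{\prod_{i=N+1}^{P}\Gamma(a_i+A_is)\prod_{j=M+1}^{Q}\Gamma(1-b_j-B_js)}z^{-s}ds,$$ empty products being $1$, where $\mathfrak L$ is an infinite contour leaving all poles of the $\Gamma(b_j+B_js)$, $j\le M$, to its left and all poles of the $\Gamma(1-a_i-A_is)$, $i\le N$, to its right; $\mathfrak L$ is a loop from $-\infty+i\varphi_1$ to $-\infty+i\varphi_2$, or a loop from $+\infty+i\varphi_1$ to $+\infty+i\varphi_2$ ($\varphi_1<\varphi_2$),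 or runs from $\gamma-i\infty$ to $\gamma+i\infty$ ($\gamma$ real), chosen so that the integral converges. *)

theory Defs
  imports "HOL-Probability.Probability" "HOL-Complex_Analysis.Complex_Analysis"
begin

section \<open>Laws of random variables\<close>

text \<open>Non-negativity is required explicitly because \<^const>\<open>ennreal\<close> would truncate negative
  values of \<open>g\<close>.\<close>

definition has_pdf_on :: "'a measure \<Rightarrow> ('a \<Rightarrow> real) \<Rightarrow> real set \<Rightarrow> (real \<Rightarrow> real) \<Rightarrow> bool" where
  "has_pdf_on \<Omega> X A g \<longleftrightarrow>
     prob_space \<Omega> \<and> (\<forall>t\<in>A. 0 \<le> g t) \<and>
     distributed \<Omega> lborel X (\<lambda>t. ennreal (indicator A t * g t))"

text \<open>\<open>X\<close> is a copy of $S_\alpha$ and \<open>f\<close> is its density $f_\alpha$.  A density is only determined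
  almost everywhere, whereas it is evaluated pointwise below; as usual, $f_\alpha$ is the
  version that is continuous on $(0,\infty)$.\<close>

definition stable_rv :: "real \<Rightarrow> (real \<Rightarrow> real) \<Rightarrow> 'a measure \<Rightarrow> ('a \<Rightarrow> real) \<Rightarrow> bool" where
  "stable_rv \<alpha> f \<Omega> X \<longleftrightarrow>
     has_pdf_on \<Omega> X {0<..} f \<and> continuous_on {0<..} f \<and>
     (\<forall>l>0. integral\<^sup>L \<Omega> (\<lambda>\<omega>. exp (- l * X \<omega>)) = exp (- (l powr \<alpha>)))"

definition tilted_stable_rv ::
    "real \<Rightarrow> real \<Rightarrow> (real \<Rightarrow> real) \<Rightarrow> 'a measure \<Rightarrow> ('a \<Rightarrow> real) \<Rightarrow> bool" where
  "tilted_stable_rv \<alpha> \<theta> f \<Omega> X \<longleftrightarrow>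
     has_pdf_on \<Omega> X {0<..} (\<lambda>t. Gamma (\<theta> + 1) / Gamma (\<theta> / \<alpha> + 1) * t powr (- \<theta>) * f t)"

definition beta_rv :: "real \<Rightarrow> real \<Rightarrow> 'a measure \<Rightarrow> ('a \<Rightarrow> real) \<Rightarrow> bool" where
  "beta_rv a b \<Omega> X \<longleftrightarrow>
     (if b = 0 then prob_space \<Omega> \<and> X \<in> borel_measurable \<Omega> \<and> (AE \<omega> in \<Omega>. X \<omega> = 1)
      else has_pdf_on \<Omega> X {0<..<1} (\<lambda>t. t powr (a - 1) * (1 - t) powr (b - 1) / Beta a b))"

definition stable_G :: "real \<Rightarrow> (real \<Rightarrow> real) \<Rightarrow> nat \<Rightarrow> nat \<Rightarrow> real \<Rightarrow> real" where
  "stable_G \<alpha> f n k t =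
     \<alpha> ^ k / (t ^ n * Gamma (real n - real k * \<alpha>) * f t) *
     integral {0..t} (\<lambda>v. f (t - v) * v powr (real n - real k * \<alpha> - 1))"


section \<open>The Fox H-function\<close>

text \<open>An infinite contour consists of a path \<open>g\<close> and two straight rays that
  enter at its start and leave at its end:
  \<^item> \<open>Left_Loop\<close>: from $-\infty + i\varphi_1$ to $-\infty + i\varphi_2$,
  \<^item> \<open>Right_Loop\<close>: from $+\infty + i\varphi_1$ to $+\infty + i\varphi_2$,
  \<^item> \<open>Vertical\<close>: from $\gamma - i\infty$ to $\gamma + i\infty$, possibly indented in between.\<close>

datatype contour_kind = Left_Loop | Right_Loop | Vertical

fun start_dir :: "contour_kind \<Rightarrow> complex" where
  "start_dir Left_Loop = -1"
| "start_dir Right_Loop = 1"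
| "start_dir Vertical = -\<i>"

fun end_dir :: "contour_kind \<Rightarrow> complex" where
  "end_dir Left_Loop = -1"
| "end_dir Right_Loop = 1"
| "end_dir Vertical = \<i>"

definition truncated_contour :: "contour_kind \<Rightarrow> (real \<Rightarrow> complex) \<Rightarrow> real \<Rightarrow> real \<Rightarrow> complex" where
  "truncated_contour \<kappa> g R =
     linepath (pathstart g + of_real R * start_dir \<kappa>) (pathstart g) +++ g +++
     linepath (pathfinish g) (pathfinish g + of_real R * end_dir \<kappa>)"

definition infinite_contour :: "contour_kind \<Rightarrow> (real \<Rightarrow> complex) \<Rightarrow> bool" where
  "infinite_contour \<kappa> g \<longleftrightarrow>
     valid_path g \<and> (\<forall>R>0. arc (truncated_contour \<kappa> g R)) \<and>
     (if \<kappa> = Vertical then Re (pathstart g) = Re (pathfinish g)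
      else Im (pathstart g) < Im (pathfinish g))"

text \<open>The truncated contour is closed by three sides of a rectangle: on its right for a
  \<open>Right_Loop\<close>, which gives a clockwise curve around the points to the right of the contour, and on
  its left otherwise, which gives a counterclockwise curve around the points to the left.  As the
  truncation tends to infinity, the winding number thus tells the two sides of the contour apart.\<close>

definition closed_contour :: "contour_kind \<Rightarrow> (real \<Rightarrow> complex) \<Rightarrow> real \<Rightarrow> real \<Rightarrow> complex" where
  "closed_contour \<kappa> g R =
     (let p = pathstart g + of_real R * start_dir \<kappa>;
          q = pathfinish g + of_real R * end_dir \<kappa>;
          e = (if \<kappa> = Right_Loop then of_real R else - of_real R)
      in truncated_contour \<kappa> g R +++ linepath q (q + e) +++ linepath (q + e) (p + e) +++
         linepath (p + e) p)"

definition left_of_contour :: "contour_kind \<Rightarrow> (real \<Rightarrow> complex) \<Rightarrow> complex \<Rightarrow> bool" where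
  "left_of_contour \<kappa> g s \<longleftrightarrow>
     (\<forall>\<^sub>F R in at_top. s \<notin> path_image (closed_contour \<kappa> g R) \<and>
        winding_number (closed_contour \<kappa> g R) s = (if \<kappa> = Right_Loop then 0 else 1))"

definition right_of_contour :: "contour_kind \<Rightarrow> (real \<Rightarrow> complex) \<Rightarrow> complex \<Rightarrow> bool" where
  "right_of_contour \<kappa> g s \<longleftrightarrow>
     (\<forall>\<^sub>F R in at_top. s \<notin> path_image (closed_contour \<kappa> g R) \<and>
        winding_number (closed_contour \<kappa> g R) s = (if \<kappa> = Right_Loop then -1 else 0))"

text \<open>The integrals along the rays are improper (Henstock--Kurzweil) integrals, so conditional
  convergence is allowed.\<close>

definition has_infinite_contour_integral ::
    "(complex \<Rightarrow> complex) \<Rightarrow> complex \<Rightarrow> contour_kind \<Rightarrow> (real \<Rightarrow> complex) \<Rightarrow> bool" where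
  "has_infinite_contour_integral F I \<kappa> g \<longleftrightarrow>
     (\<exists>I0 I1 I2.
        ((\<lambda>r. F (pathstart g + of_real r * start_dir \<kappa>)) has_integral I0) {0..} \<and>
        (F has_contour_integral I1) g \<and>
        ((\<lambda>r. F (pathfinish g + of_real r * end_dir \<kappa>)) has_integral I2) {0..} \<and>
        I = - start_dir \<kappa> * I0 + I1 + end_dir \<kappa> * I2)"

text \<open>The lists \<open>as\<close> and \<open>bs\<close> hold the pairs $(a_i,A_i)$ and $(b_j,B_j)$, so that \<open>P\<close> and \<open>Q\<close> are
  their lengths; indices are shifted to start at 0.  A factor $1/\Gamma$ vanishes at the poles of
  $\Gamma$, in agreement with the library's convention \<open>Gamma z = 0\<close> there.\<close>

definition fox_integrand ::
    "nat \<Rightarrow> nat \<Rightarrow> (complex \<times> real) list \<Rightarrow> (complex \<times> real) list \<Rightarrow> complex \<Rightarrow> complex \<Rightarrow> complex"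
  where
  "fox_integrand M N as bs z s =
     (\<Prod>j<M. Gamma (fst (bs ! j) + of_real (snd (bs ! j)) * s)) *
     (\<Prod>i<N. Gamma (1 - fst (as ! i) - of_real (snd (as ! i)) * s)) /
     ((\<Prod>i=N..<length as. Gamma (fst (as ! i) + of_real (snd (as ! i)) * s)) *
      (\<Prod>j=M..<length bs. Gamma (1 - fst (bs ! j) - of_real (snd (bs ! j)) * s))) *
     z powr (- s)"

definition fox_contour ::
    "nat \<Rightarrow> nat \<Rightarrow> (complex \<times> real) list \<Rightarrow> (complex \<times> real) list \<Rightarrow>
     contour_kind \<Rightarrow> (real \<Rightarrow> complex) \<Rightarrow> bool" where
  "fox_contour M N as bs \<kappa> g \<longleftrightarrow>
     M \<le> length bs \<and> N \<le> length as \<and> (\<forall>c\<in>set as \<union> set bs. 0 < snd c) \<and>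
     infinite_contour \<kappa> g \<and>
     (\<forall>j<M. \<forall>s. is_pole (\<lambda>s. Gamma (fst (bs ! j) + of_real (snd (bs ! j)) * s)) s \<longrightarrow>
        left_of_contour \<kappa> g s) \<and>
     (\<forall>i<N. \<forall>s. is_pole (\<lambda>s. Gamma (1 - fst (as ! i) - of_real (snd (as ! i)) * s)) s \<longrightarrow>
        right_of_contour \<kappa> g s)"

text \<open>The value common to all admissible contours along which the integral converges.\<close>

definition fox_H ::
    "nat \<Rightarrow> nat \<Rightarrow> (complex \<times> real) list \<Rightarrow> (complex \<times> real) list \<Rightarrow> complex \<Rightarrow> complex" where
  "fox_H M N as bs z =
     (THE h. \<exists>\<kappa> g I. fox_contour M N as bs \<kappa> g \<and>
        has_infinite_contour_integral (fox_integrand M N as bs z) I \<kappa> g \<and>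
        h = 1 / (2 * of_real pi * \<i>) * I)"

end

theory Submission
  imports Defs
begin

text \<open>
  The proof rests on Mellin transforms. Integrating \<open>\<lambda>\<close> to the power \<open>p - 1\<close> against the Laplace transform
  of $S_\alpha$ gives $E[S_\alpha^{-p}] = \Gamma(p/\alpha) / (\alpha \Gamma(p))$ for \<open>Re p > 0\<close>, which is the
  Mellin transform of $f_\alpha$ (\<open>mellin_log_scale\<close>). On a logarithmic scale it is a Fourier transform,
  and it is integrable along vertical lines. Since $f_\alpha$ is continuous, Fourier inversion
  (\<open>Fourier_inversion_nonneg\<close>) recovers its values at every point.

  The density of the quotient of a tilted stable and a beta variable is an average of $f_\alpha$ over
  dilations (\<open>tilted_quotient_density\<close>), and its Mellin transform is that of $f_\alpha$ times a Beta
  value. For the two choices of parameters the Gamma factors cancel to the same expression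
  $\Gamma(k + (1 - s)/\alpha) / \Gamma(n + 1 - s)$, up to constants (\<open>beta_average_0_eq\<close>, \<open>beta_average_1_eq\<close>).
  So the two densities coincide at every point by inversion, and $G_\alpha^{(n,k)}$ is by its definition
  a multiple of the first one divided by $f_\alpha$.

  The inversion integral of this expression is the Mellin--Barnes integral of the Fox function along
  the imaginary axis. It remains to show that every contour in the definition of the Fox function
  leads to the same value. A vertical contour can be moved to the imaginary axis, because the
  integrand decays exponentially in vertical strips and all poles lie on the right
  (\<open>vertical_contour_integral\<close>). A right loop is compared with a large rectangle on the imaginary axis,
  which encloses the same poles, and the other three sides of the rectangle do not matter in the
  limit, because away from the real axis the integrand also decays to the right
  (\<open>right_loop_contour_integral\<close>). Along a left loop the integral diverges: the modulus of the integrand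
  stays away from \<open>0\<close>, while its phase turns with bounded speed
  (\<open>stable_mellin_left_ray_not_integrable\<close>). The estimates behind this
  follow from \<open>\<bar>B(z, w)\<bar> \<le> B(Re z, Re w)\<close>, the reflection formula and the functional equation.
\<close>

section \<open>Gamma and Beta integrals on a logarithmic scale\<close>

text \<open>The change of variables theorem is available for absolute integrability with respect to Lebesgue
  measure. Continuity makes the transformed integrand Borel measurable, so that its side can be
  phrased with \<open>lborel\<close>, where Fubini's theorem applies.\<close>

lemma lborel_substitution:
  fixes F :: "real \<Rightarrow> 'a :: euclidean_space" and g h :: "real \<Rightarrow> real"
  assumes g: "\<And>x. (g has_field_derivative h x) (at x)" and inj: "inj g"
    and h: "continuous_on UNIV h" and F: "continuous_on (range g) F"
  shows "integrable lborel (\<lambda>x. \<bar>h x\<bar> *\<^sub>R F (g x)) \<longleftrightarrow> F absolutely_integrable_on range g"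
    and "integrable lborel (\<lambda>x. \<bar>h x\<bar> *\<^sub>R F (g x)) \<Longrightarrow>
           integral (range g) F = (LINT x|lborel. \<bar>h x\<bar> *\<^sub>R F (g x))"
proof -
  have gc: "continuous_on UNIV g"
    using g DERIV_isCont continuous_at_imp_continuous_on by blast
  have "continuous_on UNIV (F \<circ> g)"
    by (intro continuous_on_compose gc F)
  then have "continuous_on UNIV (\<lambda>x. \<bar>h x\<bar> *\<^sub>R F (g x))"
    unfolding o_def by (intro continuous_intros h)
  then have meas: "(\<lambda>x. \<bar>h x\<bar> *\<^sub>R F (g x)) \<in> borel_measurable lborel"
    by (simp add: borel_measurable_continuous_onI)
  have g': "\<And>x. x \<in> UNIV \<Longrightarrow> (g has_field_derivative h x) (at x within UNIV)"
    using g by simp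
  have eq: "(\<lambda>x. \<bar>h x\<bar> *\<^sub>R F (g x)) absolutely_integrable_on UNIV \<longleftrightarrow>
        integrable lborel (\<lambda>x. \<bar>h x\<bar> *\<^sub>R F (g x))"
    using integrable_completion[OF meas] by (simp add: set_integrable_def)
  show "integrable lborel (\<lambda>x. \<bar>h x\<bar> *\<^sub>R F (g x)) \<longleftrightarrow> F absolutely_integrable_on range g"
    using absolutely_integrable_change_of_variables_real[OF _ g' inj, of F] eq by simp
  show "integral (range g) F = (LINT x|lborel. \<bar>h x\<bar> *\<^sub>R F (g x))"
    if i: "integrable lborel (\<lambda>x. \<bar>h x\<bar> *\<^sub>R F (g x))"
  proof -
    have "integral UNIV (\<lambda>x. \<bar>h x\<bar> *\<^sub>R F (g x)) = (LINT x|lborel. \<bar>h x\<bar> *\<^sub>R F (g x))"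
      using has_integral_integral_lborel[OF i] by (simp add: integral_unique)
    then show ?thesis
      using has_absolute_integral_change_of_variables_real[OF _ g' inj, of F] eq i by auto
  qed
qed

lemma exp_substitution:
  fixes F :: "real \<Rightarrow> 'a :: euclidean_space"
  assumes "continuous_on {0<..} F"
  shows "integrable lborel (\<lambda>x. exp x *\<^sub>R F (exp x)) \<longleftrightarrow> F absolutely_integrable_on {0<..}"
    and "integrable lborel (\<lambda>x. exp x *\<^sub>R F (exp x)) \<Longrightarrow>
           integral {0<..} F = (LINT x|lborel. exp x *\<^sub>R F (exp x))"
proof -
  have r: "range (exp :: real \<Rightarrow> real) = {0<..}"
    by (auto simp: image_iff) (metis exp_ln)
  have "continuous_on UNIV (exp :: real \<Rightarrow> real)"
    by (intro continuous_intros)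
  note * = lborel_substitution[of exp exp F, unfolded r, OF DERIV_exp _ this assms]
  show "integrable lborel (\<lambda>x. exp x *\<^sub>R F (exp x)) \<longleftrightarrow> F absolutely_integrable_on {0<..}"
    using *(1) by (simp add: inj_on_def)
  show "integrable lborel (\<lambda>x. exp x *\<^sub>R F (exp x)) \<Longrightarrow>
           integral {0<..} F = (LINT x|lborel. exp x *\<^sub>R F (exp x))"
    using *(2) by (simp add: inj_on_def)
qed

text \<open>Parametrising the unit interval by the whole line turns beta integrals into integrals of functions
  that are smooth on the plane, for which joint measurability is immediate.\<close>

lemma logistic_substitution:
  fixes F :: "real \<Rightarrow> 'a :: euclidean_space"
  assumes "continuous_on {0<..<1} F"
  shows "integrable lborel (\<lambda>v. (exp v / (1 + exp v)\<^sup>2) *\<^sub>R F (1 / (1 + exp v))) \<longleftrightarrow>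
           F absolutely_integrable_on {0<..<1}"
    and "integrable lborel (\<lambda>v. (exp v / (1 + exp v)\<^sup>2) *\<^sub>R F (1 / (1 + exp v))) \<Longrightarrow>
           integral {0<..<1} F = (LINT v|lborel. (exp v / (1 + exp v)\<^sup>2) *\<^sub>R F (1 / (1 + exp v)))"
proof -
  have r: "range (\<lambda>v::real. 1 / (1 + exp v)) = {0<..<1}"
  proof (intro equalityI subsetI)
    fix u :: real assume u: "u \<in> {0<..<1}"
    then have "1 / (1 + exp (ln ((1 - u) / u))) = u"
      by (simp add: field_simps)
    then show "u \<in> range (\<lambda>v::real. 1 / (1 + exp v))" by (metis rangeI)
  qed (auto simp: add_pos_pos)
  have pos: "1 + exp v \<noteq> 0" for v :: real
    by (smt (verit) exp_gt_zero)
  have d: "((\<lambda>v. 1 / (1 + exp v)) has_field_derivative - (exp x / (1 + exp x)\<^sup>2)) (at x)" for x :: real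
    using pos[of x] by (auto intro!: derivative_eq_intros simp: power2_eq_square)
  have inj: "inj (\<lambda>v::real. 1 / (1 + exp v))"
    using pos by (auto simp: inj_def field_simps)
  have h: "continuous_on UNIV (\<lambda>v::real. - (exp v / (1 + exp v)\<^sup>2))"
    using pos by (auto intro!: continuous_intros)
  note * = lborel_substitution[OF d inj h, of F, unfolded r, OF assms]
  have "\<bar>- (exp v / (1 + exp v)\<^sup>2)\<bar> = exp v / (1 + exp v)\<^sup>2" for v :: real by simp
  then show "integrable lborel (\<lambda>v. (exp v / (1 + exp v)\<^sup>2) *\<^sub>R F (1 / (1 + exp v))) \<longleftrightarrow>
           F absolutely_integrable_on {0<..<1}"
    and "integrable lborel (\<lambda>v. (exp v / (1 + exp v)\<^sup>2) *\<^sub>R F (1 / (1 + exp v))) \<Longrightarrow>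
           integral {0<..<1} F = (LINT v|lborel. (exp v / (1 + exp v)\<^sup>2) *\<^sub>R F (1 / (1 + exp v)))"
    using * by (simp_all only:)
qed

text \<open>On a logarithmic scale powers become exponentials and dilations become translations, so that from
  here on only affine substitutions are needed.\<close>

lemma Gamma_integral_log_scale:
  assumes "0 < Re z"
  shows "has_bochner_integral lborel (\<lambda>x::real. exp (z * of_real x - of_real (exp x))) (Gamma z)"
proof -
  let ?F = "\<lambda>t. complex_of_real t powr (z - 1) / of_real (exp t)"
  have c: "continuous_on {0<..} ?F"
    by (intro continuous_intros) (auto simp: complex_nonpos_Reals_iff)
  have eq: "exp x *\<^sub>R ?F (exp x) = exp (z * of_real x - of_real (exp x))" for x :: real
  proof -
    have "complex_of_real (exp x) powr (z - 1) = exp ((z - 1) * of_real x)"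
      by (simp add: powr_def Ln_of_real)
    then show ?thesis
      by (simp add: scaleR_conv_of_real exp_of_real exp_diff algebra_simps)
  qed
  have i: "integrable lborel (\<lambda>x. exp x *\<^sub>R ?F (exp x))"
    using exp_substitution(1)[OF c] absolutely_integrable_Gamma_integral'[OF assms] by blast
  show ?thesis
    using i exp_substitution(2)[OF c i] Gamma_integral_complex'[OF assms]
    unfolding eq has_bochner_integral_iff by (simp add: integral_unique)
qed

lemma Gamma_integral_log_scale_shift:
  assumes "0 < Re z"
  shows "has_bochner_integral lborel (\<lambda>x::real. exp (z * of_real x - of_real (exp (l + x))))
           (Gamma z * exp (- z * of_real l))"
proof -
  have "has_bochner_integral lborel (\<lambda>x::real. exp (z * of_real (l + x) - of_real (exp (l + x)))) (Gamma z)"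
    using lborel_has_bochner_integral_real_affine_iff[of 1 "\<lambda>x. exp (z * of_real x - of_real (exp x))" "Gamma z" l]
      Gamma_integral_log_scale[OF assms] by simp
  then have "has_bochner_integral lborel
      (\<lambda>x::real. exp (z * of_real (l + x) - of_real (exp (l + x))) * exp (- z * of_real l))
      (Gamma z * exp (- z * of_real l))"
    by (rule has_bochner_integral_mult_left)
  moreover have "exp (z * of_real (l + x) - of_real (exp (l + x))) * exp (- z * of_real l) =
     exp (z * of_real x - of_real (exp (l + x)))" for x :: real
    by (simp add: exp_add[symmetric] algebra_simps)
  ultimately show ?thesis by simp
qed

lemma Gamma_integral_log_scale_real:
  fixes a :: real
  assumes "0 < a"
  shows "has_bochner_integral lborel (\<lambda>x. exp (a * x - exp x)) (Gamma a)"
    and "has_bochner_integral lborel (\<lambda>x. exp (a * x - exp (l + x))) (Gamma a * exp (- a * l))"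
proof -
  have "has_bochner_integral lborel (\<lambda>x. exp (a * x - exp (l + x))) (Gamma a * exp (- a * l))" for l
  proof -
    have "has_bochner_integral lborel (\<lambda>x::real. Re (exp (of_real a * of_real x - of_real (exp (l + x)))))
           (Re (Gamma (of_real a) * exp (- of_real a * of_real l)))"
      by (intro has_bochner_integral_Re Gamma_integral_log_scale_shift) (use assms in simp)
    moreover have "Re (exp (of_real a * of_real x - of_real (exp (l + x)))) = exp (a * x - exp (l + x))" for x
      using Re_complex_of_real[of "exp (a * x - exp (l + x))"] by (simp add: exp_of_real[symmetric])
    moreover have "Re (Gamma (of_real a) * exp (- of_real a * of_real l)) = Gamma a * exp (- a * l)"
      using Re_complex_of_real[of "Gamma a * exp (- a * l)"] by (simp add: exp_of_real[symmetric] Gamma_complex_of_real)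
    ultimately show ?thesis by simp
  qed
  from this[of 0] this[of l] show "has_bochner_integral lborel (\<lambda>x. exp (a * x - exp x)) (Gamma a)"
    and "has_bochner_integral lborel (\<lambda>x. exp (a * x - exp (l + x))) (Gamma a * exp (- a * l))" by simp_all
qed

text \<open>Fubini's theorem for the situation that recurs below: the inner integrals are known in closed form
  in both orders, and absolute integrability is visible from the integral \<open>N\<close> of the norm in one
  of them.\<close>

lemma has_bochner_integral_swap:
  fixes H :: "real \<Rightarrow> real \<Rightarrow> complex"
  assumes meas: "case_prod H \<in> borel_measurable (lborel \<Otimes>\<^sub>M lborel)"
    and A: "\<And>x. has_bochner_integral lborel (H x) (A x)"
    and N: "\<And>x. has_bochner_integral lborel (\<lambda>v. norm (H x v)) (N x)"
    and N': "integrable lborel N"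
    and B: "\<And>v. has_bochner_integral lborel (\<lambda>x. H x v) (B v)"
  shows "integrable lborel A" "integrable lborel B" "integral\<^sup>L lborel A = integral\<^sup>L lborel B"
proof -
  have "integrable (lborel \<Otimes>\<^sub>M lborel) (case_prod H)"
  proof (rule lborel_pair.Fubini_integrable)
    show "integrable lborel (\<lambda>x. LBINT y. norm (case_prod H (x, y)))"
      using N' N by (simp add: has_bochner_integral_iff)
    show "AE x in lborel. integrable lborel (\<lambda>y. case_prod H (x, y))"
      using A by (simp add: has_bochner_integral_iff)
  qed (rule meas)
  note i = this
  have A': "A = (\<lambda>x. LBINT v. H x v)" and B': "B = (\<lambda>v. LBINT x. H x v)"
    using A B by (auto simp: has_bochner_integral_iff)
  show "integrable lborel A" "integrable lborel B" "integral\<^sup>L lborel A = integral\<^sup>L lborel B"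
    unfolding A' B' using lborel_pair.integrable_fst[OF i] lborel_pair.integrable_snd[OF i] lborel_pair.Fubini_integral[OF i]
    by auto
qed

lemma Gamma_neq_zero_if_Re_pos: "0 < Re z \<Longrightarrow> Gamma z \<noteq> 0" for z :: complex
  by (auto simp: Gamma_eq_zero_iff elim!: nonpos_Ints_cases')

text \<open>\<open>\<Gamma>(z) \<Gamma>(w)\<close> is a double integral over \<open>(x, y)\<close>. After \<open>y = x + v\<close> the integral over \<open>x\<close> is a
  Gamma integral with parameter \<open>z + w\<close>, translated by \<open>ln (1 + e\<^sup>v)\<close>.\<close>

lemma Beta_integral_log_scale:
  fixes z w :: complex
  assumes "0 < Re z" "0 < Re w"
  shows "has_bochner_integral lborel
           (\<lambda>v::real. exp (w * of_real v - (z + w) * of_real (ln (1 + exp v)))) (Beta z w)"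
proof -
  define H where "H = (\<lambda>x v::real. exp (z * of_real x - of_real (exp x)) *
     exp (w * of_real (x + v) - of_real (exp (x + v))))"
  have H2: "H x v = exp (w * of_real v) * exp ((z + w) * of_real x - of_real (exp (ln (1 + exp v) + x)))"
    for x v
  proof -
    have "exp (ln (1 + exp v) + x) = exp x + exp (x + v)"
      by (simp add: exp_add add_pos_pos algebra_simps)
    then show ?thesis
      unfolding H_def mult_exp_exp by (simp add: algebra_simps)
  qed
  have shift: "has_bochner_integral lborel (\<lambda>v::real. F (x + v)) I"
    if "has_bochner_integral lborel F I" for F :: "real \<Rightarrow> 'b::{banach,second_countable_topology}" and I x
    using that lborel_has_bochner_integral_real_affine_iff[of 1 F I x] by simp
  have A: "has_bochner_integral lborel (H x) (exp (z * of_real x - of_real (exp x)) * Gamma w)" for x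
    unfolding H_def by (intro has_bochner_integral_mult_right shift Gamma_integral_log_scale assms)
  have norm: "norm (exp (q * of_real x - of_real (exp x))) = exp (Re q * x - exp x)" for q and x :: real
    by (simp add: norm_exp_eq_Re)
  have N: "has_bochner_integral lborel (\<lambda>v. norm (H x v)) (exp (Re z * x - exp x) * Gamma (Re w))" for x
    unfolding H_def norm_mult norm
    by (intro has_bochner_integral_mult_right shift Gamma_integral_log_scale_real assms)
  have N': "integrable lborel (\<lambda>x. exp (Re z * x - exp x) * Gamma (Re w))"
    using Gamma_integral_log_scale_real(1)[OF assms(1)] by (auto simp: has_bochner_integral_iff)
  have B: "has_bochner_integral lborel (\<lambda>x. H x v)
     (exp (w * of_real v) * (Gamma (z + w) * exp (- (z + w) * of_real (ln (1 + exp v)))))" for v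
    unfolding H2 using assms
    by (intro has_bochner_integral_mult_right Gamma_integral_log_scale_shift) simp
  have "case_prod H \<in> borel_measurable (lborel \<Otimes>\<^sub>M lborel)"
    unfolding H_def by measurable
  note * = has_bochner_integral_swap[OF this A N N' B]
  have nz: "Gamma (z + w) \<noteq> 0"
    using assms by (intro Gamma_neq_zero_if_Re_pos) simp
  have eq: "exp (w * of_real v) * (Gamma (z + w) * exp (- (z + w) * of_real (ln (1 + exp v)))) =
     Gamma (z + w) * exp (w * of_real v - (z + w) * of_real (ln (1 + exp v)))" for v :: real
    by (simp only: exp_diff exp_minus mult_minus_left divide_inverse mult_ac)
  have "has_bochner_integral lborel
     (\<lambda>v::real. Gamma (z + w) * exp (w * of_real v - (z + w) * of_real (ln (1 + exp v))))
     (Gamma z * Gamma w)"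
    using *(2,3) Gamma_integral_log_scale[OF assms(1)] unfolding eq
    by (simp add: has_bochner_integral_iff)
  from has_bochner_integral_mult_right[OF this, of "inverse (Gamma (z + w))"]
  show ?thesis using nz by (simp add: Beta_def field_simps)
qed

lemma norm_Beta_le:
  assumes "0 < Re z" "0 < Re w"
  shows "norm (Beta z w) \<le> Beta (Re z) (Re w)"
proof -
  let ?F = "\<lambda>z w (v::real). exp (w * of_real v - (z + w) * complex_of_real (ln (1 + exp v)))"
  have norm: "norm (?F z w v) = Re (?F (of_real (Re z)) (of_real (Re w)) v)" for v
    by (simp add: norm_exp_eq_Re Re_exp)
  have "norm (Beta z w) = norm (LBINT v. ?F z w v)"
    using Beta_integral_log_scale[OF assms] by (simp add: has_bochner_integral_iff)
  also have "\<dots> \<le> (LBINT v. norm (?F z w v))"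
    by (rule integral_norm_bound)
  also have "has_bochner_integral lborel (\<lambda>v. norm (?F z w v)) (Beta (Re z) (Re w))"
    using has_bochner_integral_Re[OF Beta_integral_log_scale[of "of_real (Re z)" "of_real (Re w)"]] assms
    unfolding norm by (simp add: Beta_complex_of_real)
  then have "(LBINT v. norm (?F z w v)) = Beta (Re z) (Re w)"
    by (simp add: has_bochner_integral_iff)
  finally show ?thesis .
qed

section \<open>Growth of the Gamma function along vertical lines\<close>

text \<open>For real \<open>h > 0\<close> the bound \<open>\<bar>B(z, h)\<bar> \<le> B(Re z, h)\<close> says that \<open>\<bar>\<Gamma>(z)\<bar> / \<Gamma>(Re z)\<close> does not decrease when
  \<open>z\<close> moves to the right by \<open>h\<close>. This monotonicity transports the explicit values on the line
  \<open>Re z = 1\<close> to all other vertical lines and so takes the place of Stirling's formula.\<close>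

lemma norm_Gamma_ratio_mono:
  fixes z w :: complex
  assumes "0 < Re z" "Re z \<le> Re w" "Im w = Im z"
  shows "norm (Gamma z) / Gamma (Re z) \<le> norm (Gamma w) / Gamma (Re w)"
proof (cases "Re z = Re w")
  case True
  with assms(3) have "z = w" by (simp add: complex_eq_iff)
  then show ?thesis by simp
next
  case False
  define h where "h = Re w - Re z"
  have h: "0 < h" using False assms by (simp add: h_def)
  have zw: "z + of_real h = w" using assms by (simp add: h_def complex_eq_iff)
  have hw: "Re z + h = Re w" by (simp add: h_def)
  have nz: "Gamma w \<noteq> 0"
    using assms by (intro Gamma_neq_zero_if_Re_pos) simp
  have pos: "0 < Gamma (Re z)" "0 < Gamma (Re w)" "0 < Gamma h"
    using assms h by simp_all
  have "norm (Beta z (of_real h)) \<le> Beta (Re z) h"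
    using norm_Beta_le[of z "of_real h"] assms h by simp
  then have "norm (Gamma z) * Gamma h / norm (Gamma w) \<le> Gamma (Re z) * Gamma h / Gamma (Re w)"
    using pos by (simp add: Beta_def zw hw norm_divide norm_mult Gamma_complex_of_real)
  then show ?thesis using pos nz by (simp add: field_simps)
qed

text \<open>The reflection formula for \<open>\<Gamma>(1 + \<i>y) \<Gamma>(1 - \<i>y)\<close>, whose factors are complex conjugates.\<close>

lemma norm_Gamma_1_imaginary:
  assumes "y \<noteq> 0"
  shows "(norm (Gamma (1 + \<i> * of_real y)))\<^sup>2 = pi * y / sinh (pi * y)"
proof -
  let ?z = "\<i> * complex_of_real y"
  have c: "rGamma (1 - ?z) = cnj (rGamma (1 + ?z))"
    by (simp add: cnj_rGamma)
  have "rGamma ?z * rGamma (- ?z) = - ?z * sin (of_real pi * ?z) / of_real pi"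
    by (rule rGamma_reflection_complex')
  moreover have "rGamma ?z = ?z * rGamma (1 + ?z)" "rGamma (- ?z) = - ?z * rGamma (1 - ?z)"
    using rGamma_plus1[of ?z] rGamma_plus1[of "- ?z"] by (simp_all add: add.commute)
  moreover have "sin (of_real pi * ?z) = \<i> * of_real (sinh (pi * y))"
    using sin_i_times[of "complex_of_real (pi * y)"]
    by (simp add: mult_ac sinh_field_def exp_minus flip: exp_of_real)
  ultimately have "of_real (y\<^sup>2) * (rGamma (1 + ?z) * cnj (rGamma (1 + ?z))) =
      complex_of_real (y * sinh (pi * y) / pi)"
    by (simp add: c power2_eq_square algebra_simps)
  then have "complex_of_real (y\<^sup>2 * (norm (rGamma (1 + ?z)))\<^sup>2) = of_real (y * sinh (pi * y) / pi)"
    by (simp only: complex_norm_square of_real_mult)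
  then have "y\<^sup>2 * (norm (rGamma (1 + ?z)))\<^sup>2 = y * sinh (pi * y) / pi"
    by (simp only: of_real_eq_iff)
  then have "(norm (rGamma (1 + ?z)))\<^sup>2 = sinh (pi * y) / (pi * y)"
    using assms by (simp add: field_simps power2_eq_square)
  then show ?thesis
    by (metis Gamma_def inverse_divide norm_inverse power_inverse)
qed

text \<open>\<open>sinh (\<pi>\<bar>y\<bar>)\<close> is \<open>e\<close> to the power \<open>\<pi>\<bar>y\<bar>\<close> up to the factor \<open>(1 - exp (- 2\<pi>\<bar>y\<bar>)) / 2\<close>, which is bounded
  away from \<open>0\<close> as soon as \<open>y\<close> is.\<close>

lemma norm_Gamma_1_imaginary_bounds:
  assumes "0 < \<phi>"
  obtains c C where "0 < c" "0 < C"
    "\<And>y. \<phi> \<le> \<bar>y\<bar> \<Longrightarrow> c * exp (- pi / 2 * \<bar>y\<bar>) \<le> norm (Gamma (1 + \<i> * of_real y))"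
    "\<And>y. \<phi> \<le> \<bar>y\<bar> \<Longrightarrow> norm (Gamma (1 + \<i> * of_real y)) \<le> C * (1 + \<bar>y\<bar>) * exp (- pi / 2 * \<bar>y\<bar>)"
proof -
  define c where "c = sqrt (2 * pi * \<phi>)"
  define C where "C = sqrt (2 * pi / (1 - exp (- 2 * pi * \<phi>)))"
  have \<phi>1: "exp (- 2 * pi * \<phi>) < 1" using assms by simp
  have sq: "(norm (Gamma (1 + \<i> * of_real y)))\<^sup>2 =
      2 * pi * \<bar>y\<bar> / (1 - exp (- 2 * pi * \<bar>y\<bar>)) * (exp (- pi / 2 * \<bar>y\<bar>))\<^sup>2" if "\<phi> \<le> \<bar>y\<bar>" for y
  proof -
    have y: "y \<noteq> 0" "0 < \<bar>y\<bar>" using that assms by auto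
    have "pi * y / sinh (pi * y) = pi * \<bar>y\<bar> / sinh (pi * \<bar>y\<bar>)"
      by (cases "y < 0") auto
    moreover have "sinh (pi * \<bar>y\<bar>) = (1 - exp (- 2 * pi * \<bar>y\<bar>)) / 2 / exp (- pi * \<bar>y\<bar>)"
    proof -
      define e where "e = exp (- pi * \<bar>y\<bar>)"
      have e: "exp (- 2 * pi * \<bar>y\<bar>) = e * e" "0 < e" "exp (- (pi * \<bar>y\<bar>)) = e"
        by (simp_all add: e_def mult_exp_exp)
      have "exp (pi * \<bar>y\<bar>) * e = 1"
        using exp_minus_inverse[of "pi * \<bar>y\<bar>"] unfolding e(3) .
      then have "exp (pi * \<bar>y\<bar>) = 1 / e"
        using e(2) by (simp add: field_simps)
      then have "sinh (pi * \<bar>y\<bar>) = (1 / e - e) / 2"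
        unfolding sinh_field_def e(3) by simp
      then show ?thesis
        unfolding e(1) e_def[symmetric] using e(2) by (simp add: field_simps)
    qed
    moreover have "(exp (- pi / 2 * \<bar>y\<bar>))\<^sup>2 = exp (- pi * \<bar>y\<bar>)"
      by (simp add: power2_eq_square flip: exp_add)
    moreover have "exp (- 2 * pi * \<bar>y\<bar>) \<noteq> 1" using y by simp
    ultimately show ?thesis
      using norm_Gamma_1_imaginary[OF y(1)] by (simp add: field_simps)
  qed
  show thesis
  proof (rule that)
    show "0 < c" "0 < C" using assms \<phi>1 by (auto simp: c_def C_def)
    fix y :: real assume y: "\<phi> \<le> \<bar>y\<bar>"
    then have y0: "0 < \<bar>y\<bar>" using assms by simp
    have le: "exp (- 2 * pi * \<bar>y\<bar>) \<le> exp (- 2 * pi * \<phi>)" using y by simp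
    have 1: "2 * pi * \<phi> \<le> 2 * pi * \<bar>y\<bar> / (1 - exp (- 2 * pi * \<bar>y\<bar>))"
    proof -
      have "2 * pi * \<phi> * (1 - exp (- 2 * pi * \<bar>y\<bar>)) \<le> 2 * pi * \<bar>y\<bar> * 1"
        using y assms by (intro mult_mono) auto
      then show ?thesis using y0 by (simp add: pos_le_divide_eq)
    qed
    have 2: "2 * pi * \<bar>y\<bar> / (1 - exp (- 2 * pi * \<bar>y\<bar>)) \<le> 2 * pi / (1 - exp (- 2 * pi * \<phi>)) * (1 + \<bar>y\<bar>)\<^sup>2"
    proof -
      have "2 * pi * \<bar>y\<bar> / (1 - exp (- 2 * pi * \<bar>y\<bar>)) \<le> 2 * pi * \<bar>y\<bar> / (1 - exp (- 2 * pi * \<phi>))"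
        using le \<phi>1 y0 by (intro divide_left_mono mult_pos_pos) auto
      also have "\<dots> \<le> 2 * pi * (1 + \<bar>y\<bar>)\<^sup>2 / (1 - exp (- 2 * pi * \<phi>))"
        using \<phi>1 by (intro divide_right_mono mult_left_mono) (auto simp: power2_eq_square algebra_simps)
      finally show ?thesis by simp
    qed
    have "(c * exp (- pi / 2 * \<bar>y\<bar>))\<^sup>2 \<le> (norm (Gamma (1 + \<i> * of_real y)))\<^sup>2"
      unfolding sq[OF y] power_mult_distrib using assms 1 by (intro mult_right_mono) (auto simp: c_def)
    then show "c * exp (- pi / 2 * \<bar>y\<bar>) \<le> norm (Gamma (1 + \<i> * of_real y))"
      by (rule power2_le_imp_le) simp
    have "(norm (Gamma (1 + \<i> * of_real y)))\<^sup>2 \<le> (C * (1 + \<bar>y\<bar>) * exp (- pi / 2 * \<bar>y\<bar>))\<^sup>2"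
      unfolding sq[OF y] power_mult_distrib using \<phi>1 2 by (intro mult_right_mono) (auto simp: C_def)
    then show "norm (Gamma (1 + \<i> * of_real y)) \<le> C * (1 + \<bar>y\<bar>) * exp (- pi / 2 * \<bar>y\<bar>)"
      by (rule power2_le_imp_le) (use \<open>0 < C\<close> in simp)
  qed
qed

lemma norm_pochhammer_bounds:
  fixes z :: complex
  assumes "0 \<le> \<phi>" "\<phi> \<le> \<bar>Im z\<bar>"
  shows "\<phi> ^ n \<le> norm (pochhammer z n)"
    and "norm (pochhammer z n) \<le> ((1 + \<bar>Re z\<bar> + real n) * (1 + \<bar>Im z\<bar>)) ^ n"
proof -
  have "norm (pochhammer z n) = (\<Prod>i<n. norm (z + of_nat i))"
    by (simp add: pochhammer_prod prod_norm atLeast0LessThan)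
  moreover have "(\<Prod>i<n. \<phi>) \<le> (\<Prod>i<n. norm (z + of_nat i))"
  proof (intro prod_mono)
    fix i assume "i \<in> {..<n}"
    show "0 \<le> \<phi> \<and> \<phi> \<le> norm (z + of_nat i)"
      using assms abs_Im_le_cmod[of "z + of_nat i"] by simp
  qed
  moreover have "(\<Prod>i<n. norm (z + of_nat i)) \<le> (\<Prod>i<n. (1 + \<bar>Re z\<bar> + real n) * (1 + \<bar>Im z\<bar>))"
  proof (intro prod_mono conjI norm_ge_zero)
    fix i assume i: "i \<in> {..<n}"
    have "norm (z + of_nat i) \<le> \<bar>Re z + real i\<bar> + \<bar>Im z\<bar>"
      using cmod_le[of "z + of_nat i"] by simp
    also have "\<dots> \<le> (\<bar>Re z\<bar> + real n) + \<bar>Im z\<bar>" using i by auto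
    also have "\<dots> \<le> (1 + \<bar>Re z\<bar> + real n) * (1 + \<bar>Im z\<bar>)"
      by (simp add: algebra_simps)
    finally show "norm (z + of_nat i) \<le> (1 + \<bar>Re z\<bar> + real n) * (1 + \<bar>Im z\<bar>)" .
  qed
  ultimately show "\<phi> ^ n \<le> norm (pochhammer z n)"
    and "norm (pochhammer z n) \<le> ((1 + \<bar>Re z\<bar> + real n) * (1 + \<bar>Im z\<bar>)) ^ n"
    by simp_all
qed

text \<open>The functional equation moves the strip to the right by an integer, at the cost of polynomial
  factors. There monotonicity allows a comparison with the lines \<open>Re z = 1\<close> (from below) and
  \<open>Re z = m + 1\<close> (from above), where the modulus is known up to Pochhammer symbols.\<close>

lemma norm_Gamma_strip:
  assumes "0 < \<phi>"
  obtains C N where "0 < C"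
    "\<And>z :: complex. \<bar>Re z\<bar> \<le> D \<Longrightarrow> \<phi> \<le> \<bar>Im z\<bar> \<Longrightarrow>
       norm (Gamma z) \<le> C * (1 + \<bar>Im z\<bar>) ^ N * exp (- pi / 2 * \<bar>Im z\<bar>)"
    "\<And>z :: complex. \<bar>Re z\<bar> \<le> D \<Longrightarrow> \<phi> \<le> \<bar>Im z\<bar> \<Longrightarrow>
       norm (rGamma z) \<le> C * (1 + \<bar>Im z\<bar>) ^ N * exp (pi / 2 * \<bar>Im z\<bar>)"
proof -
  obtain c C where c: "0 < c" "0 < C"
    "\<And>y. \<phi> \<le> \<bar>y\<bar> \<Longrightarrow> c * exp (- pi / 2 * \<bar>y\<bar>) \<le> norm (Gamma (1 + \<i> * of_real y))"
    "\<And>y. \<phi> \<le> \<bar>y\<bar> \<Longrightarrow> norm (Gamma (1 + \<i> * of_real y)) \<le> C * (1 + \<bar>y\<bar>) * exp (- pi / 2 * \<bar>y\<bar>)"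
    by (rule norm_Gamma_1_imaginary_bounds[OF assms]) blast
  \<comment> \<open>Shifting by \<open>M\<close> moves the real parts of the strip into the interval from \<open>1\<close> to \<open>m + 1\<close>.\<close>
  obtain M :: nat where M: "\<bar>D\<bar> + 1 \<le> real M" using real_arch_simple by blast
  define m where "m = 2 * M"
  have cont: "continuous_on {1..real (m + 1)} (Gamma :: real \<Rightarrow> real)"
    "continuous_on {1..real (m + 1)} (rGamma :: real \<Rightarrow> real)"
    by (intro continuous_intros; force elim!: nonpos_Ints_cases')+
  obtain G where G: "0 < G" "\<And>x. x \<in> {1..real (m + 1)} \<Longrightarrow> Gamma x \<le> G"
  proof -
    obtain B where B: "0 \<le> B" "\<And>x. x \<in> {1..real (m + 1)} \<Longrightarrow> norm (Gamma x) \<le> B"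
      by (rule continuous_on_compact_bound[OF compact_Icc cont(1)]) blast
    have "Gamma x \<le> B + 1" if "x \<in> {1..real (m + 1)}" for x
      using B(2)[OF that] by simp
    with B(1) that[of "B + 1"] show thesis by simp
  qed
  obtain G' where G': "0 < G'" "\<And>x. x \<in> {1..real (m + 1)} \<Longrightarrow> rGamma x \<le> G'"
  proof -
    obtain B where B: "0 \<le> B" "\<And>x. x \<in> {1..real (m + 1)} \<Longrightarrow> norm (rGamma x) \<le> B"
      by (rule continuous_on_compact_bound[OF compact_Icc cont(2)]) blast
    have "rGamma x \<le> B + 1" if "x \<in> {1..real (m + 1)}" for x
      using B(2)[OF that] by simp
    with B(1) that[of "B + 1"] show thesis by simp
  qed
  have m_pos: "0 < Gamma (real (m + 1))" by simp
  define E where "E = 2 + \<bar>D\<bar> + real m"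
  have E: "1 \<le> E" by (simp add: E_def)
  define C1 where "C1 = inverse (\<phi> ^ M) * (G / Gamma (real (m + 1)) * (E ^ m * C))"
  define C2 where "C2 = E ^ M * (G' / c)"
  have pos: "0 < C1" "0 < C2"
    using assms G G' c E m_pos by (auto simp: C1_def C2_def)
  have shift: "Gamma (z + of_nat M) = pochhammer z M * Gamma z" "rGamma z = pochhammer z M * rGamma (z + of_nat M)"
    if "\<phi> \<le> \<bar>Im z\<bar>" for z :: complex
  proof -
    have "z \<notin> \<int>\<^sub>\<le>\<^sub>0" using that assms by (auto elim!: nonpos_Ints_cases')
    then show "Gamma (z + of_nat M) = pochhammer z M * Gamma z"
      by (simp add: pochhammer_Gamma Gamma_eq_zero_iff)
    show "rGamma z = pochhammer z M * rGamma (z + of_nat M)"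
      by (rule pochhammer_rGamma)
  qed
  have b1: "norm (Gamma z) \<le> C1 * (1 + \<bar>Im z\<bar>) ^ (m + 1) * exp (- pi / 2 * \<bar>Im z\<bar>)"
    if z: "\<bar>Re z\<bar> \<le> D" "\<phi> \<le> \<bar>Im z\<bar>" for z
  proof -
    let ?w = "z + of_nat M" and ?v = "of_nat (m + 1) + \<i> * complex_of_real (Im z)"
    let ?u = "1 + \<i> * complex_of_real (Im z)"
    have w: "1 \<le> Re ?w" "Re ?w \<le> real (m + 1)" using z M by (auto simp: m_def)
    have "norm (pochhammer ?u m) \<le> (E * (1 + \<bar>Im z\<bar>)) ^ m"
    proof -
      have "(2 + real m) * (1 + \<bar>Im z\<bar>) \<le> E * (1 + \<bar>Im z\<bar>)"
        by (intro mult_right_mono) (auto simp: E_def)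
      then show ?thesis
        using norm_pochhammer_bounds(2)[of \<phi> ?u m] z assms
        by (intro order_trans[OF norm_pochhammer_bounds(2)[of \<phi>]] power_mono) auto
    qed
    moreover have "Gamma ?v = pochhammer ?u m * Gamma ?u"
    proof -
      have "?u \<notin> \<int>\<^sub>\<le>\<^sub>0"
        using Gamma_neq_zero_if_Re_pos[of ?u] by (auto simp: Gamma_eq_zero_iff)
      from pochhammer_Gamma[OF this, of m] Gamma_neq_zero_if_Re_pos[of ?u] show ?thesis
        by (simp add: add_ac)
    qed
    ultimately have "norm (Gamma ?v) \<le> (E * (1 + \<bar>Im z\<bar>)) ^ m * (C * (1 + \<bar>Im z\<bar>) * exp (- pi / 2 * \<bar>Im z\<bar>))"
      unfolding norm_mult using c(4)[OF z(2)] E by (simp only: norm_mult) (intro mult_mono, auto)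
    then have v: "norm (Gamma ?v) \<le> E ^ m * C * (1 + \<bar>Im z\<bar>) ^ (m + 1) * exp (- pi / 2 * \<bar>Im z\<bar>)"
      by (simp only: power_mult_distrib power_add power_one_right mult_ac)
    have "norm (Gamma ?w) / Gamma (Re ?w) \<le> norm (Gamma ?v) / Gamma (Re ?v)"
      using w by (intro norm_Gamma_ratio_mono) auto
    then have "norm (Gamma ?w) \<le> Gamma (Re ?w) * (norm (Gamma ?v) / Gamma (real (m + 1)))"
      using w Gamma_real_pos[of "Re ?w"] by (simp add: divide_le_eq mult.commute)
    also have "\<dots> \<le> G * (E ^ m * C * (1 + \<bar>Im z\<bar>) ^ (m + 1) * exp (- pi / 2 * \<bar>Im z\<bar>) / Gamma (real (m + 1)))"
      using G(2)[of "Re ?w"] G(1) w m_pos v by (intro mult_mono divide_right_mono) auto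
    finally have "norm (Gamma ?w) \<le> G / Gamma (real (m + 1)) * (E ^ m * C) * (1 + \<bar>Im z\<bar>) ^ (m + 1) * exp (- pi / 2 * \<bar>Im z\<bar>)"
      by simp
    moreover have "\<phi> ^ M * norm (Gamma z) \<le> norm (Gamma ?w)"
      unfolding shift(1)[OF z(2)] norm_mult using z assms
      by (intro mult_right_mono norm_pochhammer_bounds) auto
    ultimately have "\<phi> ^ M * norm (Gamma z) \<le>
        G / Gamma (real (m + 1)) * (E ^ m * C) * (1 + \<bar>Im z\<bar>) ^ (m + 1) * exp (- pi / 2 * \<bar>Im z\<bar>)"
      by linarith
    from mult_left_mono[OF this, of "inverse (\<phi> ^ M)"]
    have "inverse (\<phi> ^ M) * (\<phi> ^ M * norm (Gamma z)) \<le> inverse (\<phi> ^ M) *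
        (G / Gamma (real (m + 1)) * (E ^ m * C) * (1 + \<bar>Im z\<bar>) ^ (m + 1) * exp (- pi / 2 * \<bar>Im z\<bar>))"
      using assms by simp
    moreover have "inverse (\<phi> ^ M) * (\<phi> ^ M * norm (Gamma z)) = norm (Gamma z)"
      using assms by simp
    ultimately show ?thesis
      by (simp only: C1_def mult.assoc)
  qed
  have b2: "norm (rGamma z) \<le> C2 * (1 + \<bar>Im z\<bar>) ^ M * exp (pi / 2 * \<bar>Im z\<bar>)"
    if z: "\<bar>Re z\<bar> \<le> D" "\<phi> \<le> \<bar>Im z\<bar>" for z
  proof -
    let ?w = "z + of_nat M"
    let ?u = "1 + \<i> * complex_of_real (Im z)"
    have w: "1 \<le> Re ?w" "Re ?w \<le> real (m + 1)" using z M by (auto simp: m_def)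
    have "norm (Gamma ?u) / Gamma (Re ?u) \<le> norm (Gamma ?w) / Gamma (Re ?w)"
      using w by (intro norm_Gamma_ratio_mono) auto
    moreover have "c * exp (- pi / 2 * \<bar>Im z\<bar>) \<le> norm (Gamma ?u) / Gamma (Re ?u)"
      using c(3)[OF z(2)] by simp
    ultimately have "c * exp (- pi / 2 * \<bar>Im z\<bar>) \<le> norm (Gamma ?w) / Gamma (Re ?w)"
      by linarith
    moreover have "0 < Gamma (Re ?w)" using w by (intro Gamma_real_pos) linarith
    ultimately have "Gamma (Re ?w) * (c * exp (- pi / 2 * \<bar>Im z\<bar>)) \<le> norm (Gamma ?w)"
      by (metis mult.commute pos_le_divide_eq)
    then have "inverse (norm (Gamma ?w)) \<le> inverse (Gamma (Re ?w) * (c * exp (- pi / 2 * \<bar>Im z\<bar>)))"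
      using w c(1) by (intro le_imp_inverse_le) auto
    then have "norm (rGamma ?w) \<le> rGamma (Re ?w) * (inverse c * exp (pi / 2 * \<bar>Im z\<bar>))"
      by (simp add: rGamma_inverse_Gamma norm_inverse exp_minus)
    also have "\<dots> \<le> G' * (inverse c * exp (pi / 2 * \<bar>Im z\<bar>))"
      using w c(1) by (intro mult_right_mono G') auto
    finally have 1: "norm (rGamma ?w) \<le> G' * (inverse c * exp (pi / 2 * \<bar>Im z\<bar>))" .
    have "norm (pochhammer z M) \<le> ((1 + \<bar>Re z\<bar> + real M) * (1 + \<bar>Im z\<bar>)) ^ M"
      using z assms by (intro norm_pochhammer_bounds(2)[of \<phi>]) auto
    also have "\<dots> \<le> (E * (1 + \<bar>Im z\<bar>)) ^ M"
      using z by (intro power_mono mult_right_mono) (auto simp: E_def m_def)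
    finally have "norm (pochhammer z M) * norm (rGamma ?w) \<le>
        (E * (1 + \<bar>Im z\<bar>)) ^ M * (G' * (inverse c * exp (pi / 2 * \<bar>Im z\<bar>)))"
      using 1 E by (intro mult_mono) auto
    then show ?thesis
      unfolding shift(2)[OF z(2)] norm_mult
      by (simp only: C2_def power_mult_distrib divide_inverse mult_ac)
  qed
  show thesis
  proof (rule that[of "max C1 C2" "max (m + 1) M"])
    fix z :: complex assume z: "\<bar>Re z\<bar> \<le> D" "\<phi> \<le> \<bar>Im z\<bar>"
    show "norm (Gamma z) \<le> max C1 C2 * (1 + \<bar>Im z\<bar>) ^ max (m + 1) M * exp (- pi / 2 * \<bar>Im z\<bar>)"
      by (rule order_trans[OF b1[OF z]]) (use pos in \<open>intro mult_mono power_increasing, auto\<close>)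
    show "norm (rGamma z) \<le> max C1 C2 * (1 + \<bar>Im z\<bar>) ^ max (m + 1) M * exp (pi / 2 * \<bar>Im z\<bar>)"
      by (rule order_trans[OF b2[OF z]]) (use pos in \<open>intro mult_mono power_increasing, auto\<close>)
  qed (use pos in auto)
qed

section \<open>Decay of the Mellin transform\<close>

lemma one_plus_power_le_exp:
  fixes \<delta> :: real
  assumes "0 < \<delta>"
  obtains B where "0 < B" "\<And>y. 0 \<le> y \<Longrightarrow> (1 + y) ^ K \<le> B * exp (\<delta> * y)"
proof (cases "K = 0")
  case True
  with assms show thesis by (intro that[of 1]) auto
next
  case False
  define L where "L = max 1 (real K / \<delta>)"
  show thesis
  proof (rule that[of "L ^ K"])
    fix y :: real assume y: "0 \<le> y"
    have "1 + y \<le> L * (1 + \<delta> * y / real K)"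
    proof -
      have "1 * 1 \<le> L * 1" by (simp add: L_def)
      moreover have "real K / \<delta> * (\<delta> * y / real K) \<le> L * (\<delta> * y / real K)"
        using y assms by (intro mult_right_mono) (auto simp: L_def)
      moreover have "real K / \<delta> * (\<delta> * y / real K) = y" using False assms by simp
      ultimately show ?thesis by (simp only: distrib_left)
    qed
    then have "(1 + y) ^ K \<le> (L * (1 + \<delta> * y / real K)) ^ K"
      using y by (intro power_mono) auto
    also have "\<dots> = L ^ K * (1 + \<delta> * y / real K) ^ K" by (rule power_mult_distrib)
    also have "\<dots> \<le> L ^ K * exp (\<delta> * y)"
      using y assms False
      by (intro mult_left_mono exp_ge_one_plus_x_over_n_power_n) (auto simp: L_def intro: order_trans[of _ 0])
    finally show "(1 + y) ^ K \<le> L ^ K * exp (\<delta> * y)" .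
  qed (auto simp: L_def)
qed

text \<open>The restriction of the Gamma integral to \<open>[A, \<infinity>)\<close>. As \<open>A\<close> is arbitrary, \<open>\<Gamma>\<close> outgrows every
  exponential function.\<close>

lemma Gamma_real_ge_powr:
  fixes a A :: real
  assumes "1 \<le> a" "0 < A"
  shows "A powr (a - 1) * exp (- A) \<le> Gamma a"
proof -
  have G: "((\<lambda>t. t powr (a - 1) / exp t) has_integral Gamma a) {0..}"
    using assms by (intro Gamma_integral_real) simp
  have E: "((\<lambda>t. A powr (a - 1) * exp (- 1 * t)) has_integral A powr (a - 1) * (exp (- 1 * A) / 1)) {A..}"
    by (intro has_integral_mult_right has_integral_exp_minus_to_infinity) simp
  have E': "((\<lambda>t. if t \<in> {A..} then A powr (a - 1) * exp (- 1 * t) else 0) has_integral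
      A powr (a - 1) * (exp (- 1 * A) / 1)) {0..}"
    using E assms by (subst has_integral_restrict) auto
  have "A powr (a - 1) * (exp (- 1 * A) / 1) \<le> Gamma a"
  proof (rule has_integral_le[OF E' G])
    fix t :: real assume "t \<in> {0..}"
    show "(if t \<in> {A..} then A powr (a - 1) * exp (- 1 * t) else 0) \<le> t powr (a - 1) / exp t"
    proof (cases "A \<le> t")
      case True
      then have "A powr (a - 1) \<le> t powr (a - 1)" using assms by (intro powr_mono2) auto
      then show ?thesis using True by (simp add: exp_minus divide_inverse mult_right_mono)
    qed simp
  qed
  then show ?thesis by simp
qed

lemma norm_sin_bounds:
  fixes z :: complex
  shows "norm (sin z) \<le> exp \<bar>Im z\<bar>"
    and "(exp \<bar>Im z\<bar> - exp (- \<bar>Im z\<bar>)) / 2 \<le> norm (sin z)"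
proof -
  define u v where "u = exp (\<i> * z)" and "v = exp (- (\<i> * z))"
  have s: "norm (sin z) = norm (u - v) / 2"
    by (simp add: sin_exp_eq norm_divide norm_mult u_def v_def)
  have n: "norm u = exp (- Im z)" "norm v = exp (Im z)"
    by (simp_all add: u_def v_def norm_exp_eq_Re)
  have "norm (u - v) \<le> exp (- Im z) + exp (Im z)"
    using norm_triangle_ineq4[of u v] n by simp
  also have "\<dots> \<le> 2 * exp \<bar>Im z\<bar>"
    by (cases "Im z \<ge> 0") (simp_all add: exp_le_cancel_iff add_increasing2)
  finally show "norm (sin z) \<le> exp \<bar>Im z\<bar>" using s by simp
  have "norm u - norm v \<le> norm (u - v)" "norm v - norm u \<le> norm (u - v)"
    using norm_triangle_ineq2[of u v] norm_triangle_ineq2[of v u] by (simp_all add: norm_minus_commute)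
  then show "(exp \<bar>Im z\<bar> - exp (- \<bar>Im z\<bar>)) / 2 \<le> norm (sin z)"
    unfolding s n by (cases "Im z \<ge> 0") auto
qed

text \<open>For \<open>k = n = 0\<close> this is \<open>\<alpha>\<close> times the Mellin transform of the stable density; for \<open>1 \<le> k \<le> n\<close> it is,
  up to a constant, the Mellin transform of the common density of the two quotients.\<close>

definition stable_mellin :: "real \<Rightarrow> nat \<Rightarrow> nat \<Rightarrow> complex \<Rightarrow> complex" where
  "stable_mellin \<alpha> k n s = Gamma (of_nat k + (1 - s) / of_real \<alpha>) * rGamma (of_nat n + 1 - s)"

text \<open>The functional equation splits off \<open>k\<close> factors \<open>p/\<alpha> + j\<close> from the numerator and \<open>n\<close> factors \<open>p + j\<close>
  from the denominator, where \<open>p = 1 - s\<close>. At distance \<open>\<phi>\<close> from the real axis the quotient of factors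
  with the same index is bounded, and the remaining \<open>n - k\<close> factors of the denominator are at least
  \<open>\<phi>\<close> in modulus.\<close>

lemma norm_stable_mellin_le_base:
  assumes "0 < \<alpha>" "\<alpha> < 1" "k \<le> n" "0 < \<phi>"
  obtains K where "0 < K"
    "\<And>s. \<phi> \<le> \<bar>Im s\<bar> \<Longrightarrow> norm (stable_mellin \<alpha> k n s) \<le> K * norm (stable_mellin \<alpha> 0 0 s)"
proof -
  define K1 where "K1 = (\<Prod>j<k. (1 + real j / \<phi>) / \<alpha>)"
  have K1: "0 < K1"
    unfolding K1_def using assms by (intro prod_pos) (auto intro!: divide_pos_pos add_pos_nonneg)
  show thesis
  proof (rule that[of "K1 / \<phi> ^ (n - k)"])
    show "0 < K1 / \<phi> ^ (n - k)" using K1 assms by simp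
    fix s assume s: "\<phi> \<le> \<bar>Im s\<bar>"
    define p where "p = 1 - s"
    have p: "\<phi> \<le> \<bar>Im p\<bar>" using s by (simp add: p_def)
    have "norm (pochhammer (p / of_real \<alpha>) k) = (\<Prod>j<k. norm (p / of_real \<alpha> + of_nat j))"
      by (simp add: pochhammer_prod prod_norm atLeast0LessThan)
    also have "\<dots> \<le> (\<Prod>j<k. (1 + real j / \<phi>) / \<alpha> * norm (p + of_nat j))"
    proof (intro prod_mono conjI norm_ge_zero)
      fix j
      have "\<phi> \<le> norm (p + of_nat j)"
        using p abs_Im_le_cmod[of "p + of_nat j"] by simp
      then have "real j * 1 \<le> real j * (norm (p + of_nat j) / \<phi>)"
        using assms by (intro mult_left_mono) auto
      moreover have "norm (p + of_real (\<alpha> * real j)) \<le> norm (p + of_nat j) + real j"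
      proof -
        have "p + of_real (\<alpha> * real j) = (p + of_nat j) - of_real ((1 - \<alpha>) * real j)"
          by (simp add: algebra_simps)
        then have "norm (p + of_real (\<alpha> * real j)) \<le> norm (p + of_nat j) + norm (complex_of_real ((1 - \<alpha>) * real j))"
          by (metis norm_triangle_ineq4)
        also have "norm (complex_of_real ((1 - \<alpha>) * real j)) \<le> real j"
          unfolding norm_of_real using assms by (simp add: abs_mult mult_left_le_one_le)
        finally show ?thesis by simp
      qed
      ultimately have "norm (p + of_real (\<alpha> * real j)) / \<alpha> \<le>
          (norm (p + of_nat j) + real j * (norm (p + of_nat j) / \<phi>)) / \<alpha>"
        using assms by (intro divide_right_mono) auto
      moreover have "norm (p / of_real \<alpha> + of_nat j) = norm (p + of_real (\<alpha> * real j)) / \<alpha>"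
      proof -
        have "p / of_real \<alpha> + of_nat j = (p + of_real (\<alpha> * real j)) / of_real \<alpha>"
          using assms by (simp add: field_simps)
        then show ?thesis using assms by (simp add: norm_divide)
      qed
      ultimately show "norm (p / of_real \<alpha> + of_nat j) \<le> (1 + real j / \<phi>) / \<alpha> * norm (p + of_nat j)"
        by (simp add: field_simps)
    qed
    also have "\<dots> = K1 * norm (pochhammer p k)"
      by (simp only: K1_def prod.distrib prod_norm pochhammer_prod atLeast0LessThan)
    finally have 1: "norm (pochhammer (p / of_real \<alpha>) k) \<le> K1 * norm (pochhammer p k)" .
    have pn: "pochhammer p n = pochhammer p k * pochhammer (p + of_nat k) (n - k)"
      by (rule pochhammer_product) fact
    have 2: "\<phi> ^ (n - k) \<le> norm (pochhammer (p + of_nat k) (n - k))"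
      using p assms by (intro norm_pochhammer_bounds) auto
    have nz: "p / of_real \<alpha> \<notin> \<int>\<^sub>\<le>\<^sub>0" "pochhammer p k \<noteq> 0"
    proof -
      show "p / of_real \<alpha> \<notin> \<int>\<^sub>\<le>\<^sub>0"
      proof
        assume "p / of_real \<alpha> \<in> \<int>\<^sub>\<le>\<^sub>0"
        then obtain m where "p / of_real \<alpha> = of_int m" by (auto elim: nonpos_Ints_cases)
        then have "Im (p / of_real \<alpha>) = 0" by simp
        then show False using p assms by simp
      qed
      show "pochhammer p k \<noteq> 0"
        using norm_pochhammer_bounds(1)[of \<phi> p k] p assms zero_less_power[OF assms(4), of k]
        by (auto simp del: zero_less_power)
    qed
    have "Gamma (of_nat k + p / of_real \<alpha>) = pochhammer (p / of_real \<alpha>) k * Gamma (p / of_real \<alpha>)"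
      using pochhammer_Gamma[OF nz(1), of k] nz(1) by (simp add: Gamma_eq_zero_iff add_ac)
    moreover have "rGamma p = pochhammer p n * rGamma (p + of_nat n)"
      by (rule pochhammer_rGamma)
    moreover have "p + of_nat n = of_nat n + 1 - s" by (simp add: p_def)
    ultimately have "norm (stable_mellin \<alpha> 0 0 s) * norm (pochhammer (p / of_real \<alpha>) k) =
        norm (stable_mellin \<alpha> k n s) * (norm (pochhammer p k) * norm (pochhammer (p + of_nat k) (n - k)))"
      by (simp add: stable_mellin_def p_def[symmetric] norm_mult pn)
    then have "norm (stable_mellin \<alpha> k n s) * (norm (pochhammer p k) * norm (pochhammer (p + of_nat k) (n - k)))
        \<le> norm (stable_mellin \<alpha> 0 0 s) * (K1 * norm (pochhammer p k))"
      using 1 by (metis mult_left_mono norm_ge_zero)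
    then have "norm (stable_mellin \<alpha> k n s) * norm (pochhammer (p + of_nat k) (n - k))
        \<le> norm (stable_mellin \<alpha> 0 0 s) * K1"
    proof -
      assume *: "norm (stable_mellin \<alpha> k n s) * (norm (pochhammer p k) * norm (pochhammer (p + of_nat k) (n - k)))
        \<le> norm (stable_mellin \<alpha> 0 0 s) * (K1 * norm (pochhammer p k))"
      have "norm (pochhammer p k) * (norm (stable_mellin \<alpha> k n s) * norm (pochhammer (p + of_nat k) (n - k)))
        \<le> norm (pochhammer p k) * (norm (stable_mellin \<alpha> 0 0 s) * K1)"
        using * by (simp only: mult_ac)
      then show ?thesis
        by (rule mult_left_le_imp_le) (use nz(2) in simp)
    qed
    moreover have "norm (stable_mellin \<alpha> k n s) * \<phi> ^ (n - k) \<le>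
        norm (stable_mellin \<alpha> k n s) * norm (pochhammer (p + of_nat k) (n - k))"
      using 2 by (rule mult_left_mono) simp
    ultimately have "norm (stable_mellin \<alpha> k n s) * \<phi> ^ (n - k) \<le> norm (stable_mellin \<alpha> 0 0 s) * K1"
      by linarith
    then show "norm (stable_mellin \<alpha> k n s) \<le> K1 / \<phi> ^ (n - k) * norm (stable_mellin \<alpha> 0 0 s)"
      using assms by (simp add: pos_le_divide_eq mult.commute)
  qed
qed

text \<open>The numerator decays like \<open>exp (- \<pi>\<bar>y\<bar> / (2\<alpha>))\<close> and the denominator like \<open>exp (- \<pi>\<bar>y\<bar> / 2)\<close>, up to
  polynomial factors. As \<open>\<alpha> < 1\<close> the quotient decays exponentially, and giving up half of the rate
  absorbs the polynomials.\<close>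

lemma norm_stable_mellin_strip:
  assumes "0 < \<alpha>" "\<alpha> < 1" "0 < \<phi>" "0 \<le> D"
  obtains C c where "0 < C" "0 < c"
    "\<And>s. \<bar>Re s\<bar> \<le> D \<Longrightarrow> \<phi> \<le> \<bar>Im s\<bar> \<Longrightarrow>
       norm (stable_mellin \<alpha> 0 0 s) \<le> C * exp (- c * \<bar>Im s\<bar>)"
proof -
  define D' where "D' = (D + 1) / \<alpha>"
  obtain C N where C: "0 < C"
    "\<And>z :: complex. \<bar>Re z\<bar> \<le> D' \<Longrightarrow> \<phi> \<le> \<bar>Im z\<bar> \<Longrightarrow>
       norm (Gamma z) \<le> C * (1 + \<bar>Im z\<bar>) ^ N * exp (- pi / 2 * \<bar>Im z\<bar>)"
    "\<And>z :: complex. \<bar>Re z\<bar> \<le> D' \<Longrightarrow> \<phi> \<le> \<bar>Im z\<bar> \<Longrightarrow>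
       norm (rGamma z) \<le> C * (1 + \<bar>Im z\<bar>) ^ N * exp (pi / 2 * \<bar>Im z\<bar>)"
    by (rule norm_Gamma_strip[OF assms(3), of D']) blast
  define c where "c = pi / 4 * (1 / \<alpha> - 1)"
  have c: "0 < c" using assms by (simp add: c_def)
  then have "0 < c * \<alpha>" using assms by simp
  then obtain B where B: "0 < B" "\<And>y. 0 \<le> y \<Longrightarrow> (1 + y) ^ (N + N) \<le> B * exp (c * \<alpha> * y)"
    by (rule one_plus_power_le_exp[of _ "N + N"]) blast
  show thesis
  proof (rule that[of "C * C * B" c])
    fix s assume s: "\<bar>Re s\<bar> \<le> D" "\<phi> \<le> \<bar>Im s\<bar>"
    define Y where "Y = \<bar>Im s\<bar> / \<alpha>"
    have \<alpha>1: "a \<le> a / \<alpha>" if "0 \<le> a" for a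
      using that assms by (simp add: pos_le_divide_eq mult_left_le)
    have Y: "\<bar>Im s\<bar> \<le> Y" "0 \<le> Y" "\<bar>Im s\<bar> = \<alpha> * Y"
      using \<alpha>1[of "\<bar>Im s\<bar>"] assms by (auto simp: Y_def)
    have r: "\<bar>1 - Re s\<bar> \<le> D + 1" using s by linarith
    have "norm (Gamma ((1 - s) / of_real \<alpha>)) \<le> C * (1 + Y) ^ N * exp (- pi / 2 * Y)"
    proof -
      have "\<bar>Re ((1 - s) / of_real \<alpha>)\<bar> \<le> D'"
        using r assms by (simp add: D'_def divide_right_mono)
      moreover have "\<bar>Im ((1 - s) / of_real \<alpha>)\<bar> = Y"
        using assms by (simp add: Y_def)
      ultimately show ?thesis using C(2)[of "(1 - s) / of_real \<alpha>"] Y s by simp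
    qed
    moreover have "norm (rGamma (1 - s)) \<le> C * (1 + Y) ^ N * exp (pi / 2 * \<bar>Im s\<bar>)"
    proof -
      have "\<bar>Re (1 - s)\<bar> \<le> D'"
        using r \<alpha>1[of "D + 1"] assms by (simp add: D'_def)
      then have "norm (rGamma (1 - s)) \<le> C * (1 + \<bar>Im s\<bar>) ^ N * exp (pi / 2 * \<bar>Im s\<bar>)"
        using C(3)[of "1 - s"] s by simp
      also have "\<dots> \<le> C * (1 + Y) ^ N * exp (pi / 2 * \<bar>Im s\<bar>)"
        using C(1) Y by (intro mult_right_mono mult_left_mono power_mono) auto
      finally show ?thesis .
    qed
    ultimately have "norm (stable_mellin \<alpha> 0 0 s) \<le>
        (C * (1 + Y) ^ N * exp (- pi / 2 * Y)) * (C * (1 + Y) ^ N * exp (pi / 2 * \<bar>Im s\<bar>))"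
      unfolding stable_mellin_def norm_mult using C(1) Y by (intro mult_mono) auto
    also have "\<dots> = C * C * ((1 + Y) ^ (N + N) * (exp (- pi / 2 * Y) * exp (pi / 2 * \<bar>Im s\<bar>)))"
      by (simp only: power_add mult_ac)
    also have "exp (- pi / 2 * Y) * exp (pi / 2 * \<bar>Im s\<bar>) = exp (- 2 * c * \<bar>Im s\<bar>)"
      unfolding mult_exp_exp using assms by (simp add: Y_def c_def field_simps)
    also have "C * C * ((1 + Y) ^ (N + N) * exp (- 2 * c * \<bar>Im s\<bar>)) \<le>
        C * C * ((B * exp (c * \<alpha> * Y)) * exp (- 2 * c * \<bar>Im s\<bar>))"
      using C(1) B(2)[OF Y(2)] by (intro mult_left_mono mult_right_mono) auto
    also have "\<dots> = C * C * B * (exp (c * \<alpha> * Y) * exp (- 2 * c * \<bar>Im s\<bar>))"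
      by (simp only: mult_ac)
    also have "exp (c * \<alpha> * Y) * exp (- 2 * c * \<bar>Im s\<bar>) = exp (- c * \<bar>Im s\<bar>)"
      unfolding mult_exp_exp Y(3) by (simp add: algebra_simps)
    finally show "norm (stable_mellin \<alpha> 0 0 s) \<le> C * C * B * exp (- c * \<bar>Im s\<bar>)" .
  qed (use C B c in auto)
qed

text \<open>Far to the right the reflection formula turns the transform into a quotient of sines, which
  is of size \<open>exp (- \<pi>\<beta>\<bar>y\<bar>)\<close> with \<open>\<beta> = 1/\<alpha> - 1\<close>, times \<open>\<Gamma>(s) / \<Gamma>(s + w)\<close> with \<open>w = (s - 1) \<beta>\<close>. The latter
  equals \<open>B(s, w) / \<Gamma>(w)\<close>. Here \<open>\<bar>B(s, w)\<bar> \<le> 1\<close>, while \<open>1 / \<bar>\<Gamma>(w)\<bar>\<close> uses up half of the exponential decay in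
  \<open>y\<close> and in return decays faster than any exponential in \<open>Re s\<close>, in particular faster than \<open>t\<close> to
  the power \<open>Re s\<close> can grow.\<close>

lemma norm_stable_mellin_right:
  assumes "0 < \<alpha>" "\<alpha> < 1" "0 < \<phi>" "0 < t"
  obtains D C c where "0 \<le> D" "0 < C" "0 < c"
    "\<And>s. D \<le> Re s \<Longrightarrow> \<phi> \<le> \<bar>Im s\<bar> \<Longrightarrow>
       norm (stable_mellin \<alpha> 0 0 s) * t powr (- Re s) \<le> C * exp (- c * \<bar>Im s\<bar> - Re s)"
proof -
  define \<beta> where "\<beta> = 1 / \<alpha> - 1"
  have \<beta>: "0 < \<beta>" using assms by (simp add: \<beta>_def)
  have \<beta>\<phi>: "0 < \<beta> * \<phi>" using \<beta> assms by simp
  obtain c0 C0 where c0: "0 < c0" 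
    "\<And>y. \<beta> * \<phi> \<le> \<bar>y\<bar> \<Longrightarrow> c0 * exp (- pi / 2 * \<bar>y\<bar>) \<le> norm (Gamma (1 + \<i> * of_real y))"
    by (rule norm_Gamma_1_imaginary_bounds[OF \<beta>\<phi>]) blast
  \<comment> \<open>Chosen such that \<open>A powr (\<beta> * x)\<close> is \<open>exp x * t powr (- x)\<close>.\<close>
  define A where "A = exp ((1 - ln t) / \<beta>)"
  define \<kappa> where "\<kappa> = (1 - exp (- 2 * (pi * \<phi> / \<alpha>))) / 2"
  have \<kappa>: "0 < \<kappa>" using assms by (simp add: \<kappa>_def)
  define C where "C = exp A * A powr (1 + \<beta>) / (c0 * \<kappa>)"
  have A: "0 < A" by (simp add: A_def)
  show thesis
  proof (rule that[of "1 + 1 / \<beta>" C "pi / 2 * \<beta>"])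
    show "0 \<le> 1 + 1 / \<beta>" "0 < C" "0 < pi / 2 * \<beta>" using \<beta> \<kappa> c0 A by (auto simp: C_def)
    fix s assume s: "1 + 1 / \<beta> \<le> Re s" "\<phi> \<le> \<bar>Im s\<bar>"
    define w where "w = (s - 1) * of_real \<beta>"
    define a where "a = (Re s - 1) * \<beta>"
    define Y where "Y = \<bar>Im s\<bar>"
    have a: "1 \<le> a" "1 \<le> Re s" "Re w = a" "0 < Re s" "Im w = \<beta> * Im s"
    proof -
      have "0 < 1 / \<beta>" using \<beta> by simp
      then show "1 \<le> Re s" "0 < Re s" using s by linarith+
      show "1 \<le> a" using s \<beta> by (simp add: a_def field_simps)
      show "Re w = a" "Im w = \<beta> * Im s" by (simp_all add: w_def a_def)
    qed
    have q: "s + w = 1 + (s - 1) / of_real \<alpha>"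
      using assms by (simp add: w_def \<beta>_def field_simps)
    \<comment> \<open>By the reflection formula, both Gamma factors move to the right half-plane.\<close>
    define S where "S = sin (of_real pi * ((1 - s) / of_real \<alpha>))"
    have nz: "Gamma s \<noteq> 0" "Gamma (s + w) \<noteq> 0" "Gamma w \<noteq> 0"
      using a by (auto intro!: Gamma_neq_zero_if_Re_pos)
    have S: "\<kappa> * exp (pi / \<alpha> * Y) \<le> norm S"
    proof -
      have I: "\<bar>Im (of_real pi * ((1 - s) / of_real \<alpha>))\<bar> = pi / \<alpha> * Y"
        using assms by (simp add: Y_def abs_mult)
      have "exp (- (pi / \<alpha> * Y)) \<le> exp (- 2 * (pi * \<phi> / \<alpha>)) * exp (pi / \<alpha> * Y)"
        unfolding mult_exp_exp using s assms by (simp add: Y_def field_simps)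
      then have "\<kappa> * exp (pi / \<alpha> * Y) \<le> (exp (pi / \<alpha> * Y) - exp (- (pi / \<alpha> * Y))) / 2"
        by (simp add: \<kappa>_def diff_divide_distrib algebra_simps)
      also have "\<dots> \<le> norm S"
        using norm_sin_bounds(2)[of "of_real pi * ((1 - s) / of_real \<alpha>)"] unfolding I S_def .
      finally show ?thesis .
    qed
    have Spos: "0 < norm S" using S \<kappa> by (smt (verit) exp_gt_zero mult_pos_pos)
    have "Gamma ((1 - s) / of_real \<alpha>) * Gamma (s + w) = of_real pi / S"
    proof -
      have "1 - (1 - s) / of_real \<alpha> = s + w" unfolding q by (simp add: diff_divide_distrib)
      then show ?thesis
        using Gamma_reflection_complex[of "(1 - s) / of_real \<alpha>"] by (simp add: S_def)
    qed
    then have G1: "norm (Gamma ((1 - s) / of_real \<alpha>)) = pi / (norm S * norm (Gamma (s + w)))"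
      using nz Spos by (simp add: field_simps norm_mult norm_divide flip: norm_mult)
    have "rGamma (1 - s) = sin (of_real pi * s) / of_real pi * Gamma s"
    proof -
      have "rGamma s * Gamma s = 1" using nz(1) by (simp add: rGamma_inverse_Gamma)
      then have "rGamma (1 - s) = (rGamma s * rGamma (1 - s)) * Gamma s" by (simp add: mult_ac)
      then show ?thesis unfolding rGamma_reflection_complex .
    qed
    then have "norm (rGamma (1 - s)) = norm (sin (of_real pi * s)) / pi * norm (Gamma s)"
      by (simp add: norm_mult norm_divide)
    also have "\<dots> \<le> exp (pi * Y) / pi * norm (Gamma s)"
      using norm_sin_bounds(1)[of "of_real pi * s"]
      by (intro mult_right_mono divide_right_mono) (auto simp: Y_def abs_mult)
    finally have G2: "norm (rGamma (1 - s)) \<le> exp (pi * Y) / pi * norm (Gamma s)" .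
    \<comment> \<open>\<open>\<Gamma>(s) / \<Gamma>(s + w)\<close> is a Beta value of modulus at most one, divided by \<open>\<Gamma>(w)\<close>.\<close>
    have G3: "norm (Gamma s) * norm (Gamma w) \<le> norm (Gamma (s + w))"
    proof -
      have "norm (Beta s w) \<le> Beta (Re s) (Re w)"
        using a by (intro norm_Beta_le) auto
      also have "\<dots> \<le> Beta 1 1"
        using a by (intro Beta_real_mono) auto
      also have "\<dots> = 1" by (simp add: Beta_def Gamma_numeral)
      finally show ?thesis
        using nz by (simp add: Beta_def norm_mult norm_divide divide_le_eq)
    qed
    have G4: "Gamma a * (c0 * exp (- pi / 2 * (\<beta> * Y))) \<le> norm (Gamma w)"
    proof -
      have "norm (Gamma (1 + \<i> * of_real (Im w))) / Gamma (Re (1 + \<i> * of_real (Im w))) \<le>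
          norm (Gamma w) / Gamma (Re w)"
        using a by (intro norm_Gamma_ratio_mono) auto
      moreover have "c0 * exp (- pi / 2 * \<bar>Im w\<bar>) \<le>
          norm (Gamma (1 + \<i> * of_real (Im w))) / Gamma (Re (1 + \<i> * of_real (Im w)))"
        using c0(2)[of "Im w"] s a \<beta> by (simp add: abs_mult)
      ultimately have "c0 * exp (- pi / 2 * \<bar>Im w\<bar>) \<le> norm (Gamma w) / Gamma (Re w)" by linarith
      moreover have "\<bar>Im w\<bar> = \<beta> * Y" using a \<beta> by (simp add: Y_def abs_mult)
      moreover have "0 < Gamma a" using a by (intro Gamma_real_pos) linarith
      ultimately show ?thesis
        unfolding a(3) by (simp add: pos_le_divide_eq mult.commute)
    qed
    have G5: "A powr (a - 1) * exp (- A) \<le> Gamma a"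
      using a A by (intro Gamma_real_ge_powr)
    have R1: "norm (stable_mellin \<alpha> 0 0 s) * norm (Gamma w) \<le> exp (pi * Y) / norm S"
    proof -
      have "norm (stable_mellin \<alpha> 0 0 s) * norm (Gamma w) \<le>
          pi / (norm S * norm (Gamma (s + w))) * (exp (pi * Y) / pi * norm (Gamma s)) * norm (Gamma w)"
        unfolding stable_mellin_def norm_mult G1[symmetric]
        using G2 by (intro mult_right_mono mult_mono) auto
      also have "\<dots> = exp (pi * Y) / norm S * (norm (Gamma s) * norm (Gamma w) / norm (Gamma (s + w)))"
        using nz by (simp add: field_simps)
      also have "\<dots> \<le> exp (pi * Y) / norm S * 1"
        using G3 nz by (intro mult_left_mono) (auto simp: divide_le_eq)
      finally show ?thesis by simp
    qed
    also have "exp (pi * Y) / norm S \<le> exp (pi * Y) / (\<kappa> * exp (pi / \<alpha> * Y))"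
      using S Spos \<kappa> by (intro divide_left_mono) auto
    also have "\<dots> = exp (- (pi * \<beta> * Y)) / \<kappa>"
    proof -
      have "exp (pi / \<alpha> * Y) = exp (pi * \<beta> * Y) * exp (pi * Y)"
        unfolding mult_exp_exp by (simp add: \<beta>_def algebra_simps)
      then show ?thesis by (simp add: exp_minus field_simps)
    qed
    finally have R2: "norm (stable_mellin \<alpha> 0 0 s) * norm (Gamma w) \<le> exp (- (pi * \<beta> * Y)) / \<kappa>" .
    define N where "N = norm (stable_mellin \<alpha> 0 0 s)"
    have "N * (A powr (a - 1) * exp (- A) * (c0 * exp (- pi / 2 * (\<beta> * Y)))) \<le>
        N * (Gamma a * (c0 * exp (- pi / 2 * (\<beta> * Y))))"
      using G5 c0(1) by (intro mult_left_mono mult_right_mono) (auto simp: N_def)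
    also have "\<dots> \<le> N * norm (Gamma w)"
      using G4 by (intro mult_left_mono) (auto simp: N_def)
    finally have R3: "N * (A powr (a - 1) * exp (- A) * (c0 * exp (- pi / 2 * (\<beta> * Y)))) \<le> exp (- (pi * \<beta> * Y)) / \<kappa>"
      using R2 unfolding N_def by linarith
    have Aa: "A powr (a - 1) = exp ((1 - ln t) * Re s) / A powr (1 + \<beta>)"
    proof -
      have "A powr (a - 1) = A powr (\<beta> * Re s - (1 + \<beta>))" by (simp add: a_def algebra_simps)
      also have "\<dots> = A powr (\<beta> * Re s) / A powr (1 + \<beta>)" by (rule powr_diff)
      also have "A powr (\<beta> * Re s) = exp ((1 - ln t) * Re s)"
        using \<beta> by (simp add: A_def powr_def)
      finally show ?thesis .
    qed
    have "N * exp ((1 - ln t) * Re s) \<le> C * exp (- pi / 2 * (\<beta> * Y))"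
    proof -
      have "exp (- (pi * \<beta> * Y)) = exp (- pi / 2 * (\<beta> * Y)) * exp (- pi / 2 * (\<beta> * Y))"
        unfolding mult_exp_exp by simp
      then have "(N * exp ((1 - ln t) * Re s) * (exp (- A) / A powr (1 + \<beta>) * c0)) * exp (- pi / 2 * (\<beta> * Y)) \<le>
          (exp (- pi / 2 * (\<beta> * Y)) / \<kappa>) * exp (- pi / 2 * (\<beta> * Y))"
        using R3 unfolding Aa by (simp add: mult_ac)
      then have "N * exp ((1 - ln t) * Re s) * (exp (- A) / A powr (1 + \<beta>) * c0) \<le> exp (- pi / 2 * (\<beta> * Y)) / \<kappa>"
        by (rule mult_right_le_imp_le) simp
      then show ?thesis
        using A c0 \<kappa> by (simp add: C_def exp_minus field_simps)
    qed
    then have "N * exp ((1 - ln t) * Re s) * exp (- Re s) \<le> C * exp (- pi / 2 * (\<beta> * Y)) * exp (- Re s)"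
      by (rule mult_right_mono) simp
    moreover have "exp ((1 - ln t) * Re s) * exp (- Re s) = t powr (- Re s)"
      unfolding mult_exp_exp using assms by (simp add: powr_def algebra_simps)
    moreover have "exp (- pi / 2 * (\<beta> * Y)) * exp (- Re s) = exp (- (pi / 2 * \<beta>) * \<bar>Im s\<bar> - Re s)"
      unfolding mult_exp_exp by (simp add: Y_def)
    ultimately show "norm (stable_mellin \<alpha> 0 0 s) * t powr (- Re s) \<le>
        C * exp (- (pi / 2 * \<beta>) * \<bar>Im s\<bar> - Re s)"
      by (simp add: N_def mult.assoc)
  qed
qed

text \<open>The strip and the region to its right give one bound that is integrable in both directions. This
  is what allows contours to be moved and right loops to be closed.\<close>

lemma norm_stable_mellin_powr_le:
  assumes "0 < \<alpha>" "\<alpha> < 1" "k \<le> n" "0 < \<phi>" "0 < t"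
  obtains C c where "0 < C" "0 < c"
    "\<And>s. - D0 \<le> Re s \<Longrightarrow> \<phi> \<le> \<bar>Im s\<bar> \<Longrightarrow>
       norm (stable_mellin \<alpha> k n s * of_real t powr (- s)) \<le> C * exp (- c * \<bar>Im s\<bar> - Re s)"
proof -
  obtain K where K: "0 < K"
    "\<And>s. \<phi> \<le> \<bar>Im s\<bar> \<Longrightarrow> norm (stable_mellin \<alpha> k n s) \<le> K * norm (stable_mellin \<alpha> 0 0 s)"
    using norm_stable_mellin_le_base[OF assms(1-4)] by blast
  obtain D1 C1 c1 where 1: "0 \<le> D1" "0 < C1" "0 < c1"
    "\<And>s. D1 \<le> Re s \<Longrightarrow> \<phi> \<le> \<bar>Im s\<bar> \<Longrightarrow>
       norm (stable_mellin \<alpha> 0 0 s) * t powr (- Re s) \<le> C1 * exp (- c1 * \<bar>Im s\<bar> - Re s)"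
    using norm_stable_mellin_right[OF assms(1,2,4,5)] by blast
  define D where "D = max D1 \<bar>D0\<bar>"
  have D: "0 \<le> D" by (simp add: D_def)
  obtain C2 c2 where 2: "0 < C2" "0 < c2"
    "\<And>s. \<bar>Re s\<bar> \<le> D \<Longrightarrow> \<phi> \<le> \<bar>Im s\<bar> \<Longrightarrow>
       norm (stable_mellin \<alpha> 0 0 s) \<le> C2 * exp (- c2 * \<bar>Im s\<bar>)"
    using norm_stable_mellin_strip[OF assms(1,2,4) D] by blast
  define E where "E = exp (D * \<bar>1 - ln t\<bar>)"
  define C where "C = K * max C1 (C2 * E)"
  have b: "norm (stable_mellin \<alpha> 0 0 s) * t powr (- Re s) \<le> max C1 (C2 * E) * exp (- min c1 c2 * \<bar>Im s\<bar> - Re s)"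
    if s: "- D0 \<le> Re s" "\<phi> \<le> \<bar>Im s\<bar>" for s
  proof (cases "D \<le> Re s")
    case True
    have "C1 * exp (- c1 * \<bar>Im s\<bar> - Re s) \<le> max C1 (C2 * E) * exp (- min c1 c2 * \<bar>Im s\<bar> - Re s)"
      using 1 2 by (intro mult_mono) (auto intro!: mult_right_mono)
    moreover have "D1 \<le> Re s" using True by (simp add: D_def)
    ultimately show ?thesis using 1(4)[OF _ s(2)] by linarith
  next
    case False
    then have sD: "\<bar>Re s\<bar> \<le> D" using s by (auto simp: D_def)
    have "t powr (- Re s) = exp (Re s * (1 - ln t)) * exp (- Re s)"
      unfolding mult_exp_exp using assms by (simp add: powr_def algebra_simps)
    also have "\<dots> \<le> E * exp (- Re s)"
    proof -
      have "Re s * (1 - ln t) \<le> \<bar>Re s\<bar> * \<bar>1 - ln t\<bar>" by (metis abs_ge_self abs_mult)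
      also have "\<dots> \<le> D * \<bar>1 - ln t\<bar>" using sD by (intro mult_right_mono) auto
      finally show ?thesis by (simp add: E_def)
    qed
    finally have "norm (stable_mellin \<alpha> 0 0 s) * t powr (- Re s) \<le>
        (C2 * exp (- c2 * \<bar>Im s\<bar>)) * (E * exp (- Re s))"
      using 2(3)[OF sD s(2)] 2(1) by (intro mult_mono) auto
    also have "\<dots> = C2 * E * exp (- c2 * \<bar>Im s\<bar> - Re s)"
      by (simp add: exp_diff exp_minus field_simps)
    also have "\<dots> \<le> max C1 (C2 * E) * exp (- min c1 c2 * \<bar>Im s\<bar> - Re s)"
      using 1 2 by (intro mult_mono) (auto intro!: mult_right_mono simp: E_def)
    finally show ?thesis .
  qed
  show thesis
  proof (rule that[of C "min c1 c2"])
    show "0 < C" "0 < min c1 c2" using K 1 2 by (auto simp: C_def)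
    fix s assume s: "- D0 \<le> Re s" "\<phi> \<le> \<bar>Im s\<bar>"
    have "norm (stable_mellin \<alpha> k n s * of_real t powr (- s)) = norm (stable_mellin \<alpha> k n s) * t powr (- Re s)"
      using assms by (simp add: norm_mult norm_powr_real_powr)
    also have "\<dots> \<le> K * norm (stable_mellin \<alpha> 0 0 s) * t powr (- Re s)"
      using K(2)[OF s(2)] by (rule mult_right_mono) simp
    also have "\<dots> \<le> K * (max C1 (C2 * E) * exp (- min c1 c2 * \<bar>Im s\<bar> - Re s))"
      using mult_left_mono[OF b[OF s], of K] K(1) by (simp add: mult.assoc)
    finally show "norm (stable_mellin \<alpha> k n s * of_real t powr (- s)) \<le> C * exp (- min c1 c2 * \<bar>Im s\<bar> - Re s)"
      by (simp add: C_def mult.assoc)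
  qed
qed

section \<open>Fourier inversion\<close>

lemma integral_iexp_Icc:
  assumes "a \<le> b" "t \<noteq> 0"
  shows "(LBINT x:{a..b}. iexp (- (t * x))) = (iexp (- (t * a)) - iexp (- (t * b))) / (\<i> * t)"
proof -
  let ?F = "\<lambda>x. iexp (- (t * x)) / (- \<i> * t)"
  have "((\<lambda>x. iexp (- (t * x))) has_integral (?F b - ?F a)) {a..b}"
  proof (rule fundamental_theorem_of_calculus[OF assms(1)])
    fix x
    have "((\<lambda>z. exp (\<i> * (- (of_real t * z))) / (- \<i> * t)) has_field_derivative
        exp (\<i> * (- (of_real t * of_real x)))) (at (of_real x))"
      using assms(2) by (auto intro!: derivative_eq_intros simp: field_simps)
    from has_vector_derivative_real_field[OF this]
    show "(?F has_vector_derivative iexp (- (t * x))) (at x within {a..b})"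
      by (simp add: has_vector_derivative_at_within)
  qed
  moreover have "set_integrable lborel {a..b} (\<lambda>x. iexp (- (t * x)))"
    by (intro borel_integrable_atLeastAtMost') (auto intro!: continuous_intros)
  ultimately have "(LBINT x:{a..b}. iexp (- (t * x))) = ?F b - ?F a"
    using set_borel_integral_eq_integral(2) integral_unique by metis
  then show ?thesis using assms(2) by (simp add: field_simps)
qed

text \<open>After normalisation \<open>g\<close> is a probability density and \<open>G\<close> a characteristic function, so that Levy's
  theorem expresses the integral of \<open>g\<close> over \<open>[a, b]\<close> as a limit of truncated integrals. The
  integrability of \<open>G\<close> removes the truncation by dominated convergence, Fubini's theorem moves the
  integral over \<open>[a, b]\<close> to the outside, and differentiation with respect to \<open>b\<close> gives the identity at
  every point, both sides being continuous.\<close>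

lemma Fourier_inversion_nonneg:
  fixes g :: "real \<Rightarrow> real" and G :: "real \<Rightarrow> complex"
  assumes g: "continuous_on UNIV g" "\<And>x. 0 \<le> g x"
    and G: "\<And>y. has_bochner_integral lborel (\<lambda>x. iexp (y * x) * of_real (g x)) (G y)"
    and G0: "G 0 \<noteq> 0" and Gi: "integrable lborel G"
  shows "of_real (g x) = 1 / (2 * of_real pi) * (LBINT y. iexp (- (y * x)) * G y)"
proof -
  have gm[measurable]: "g \<in> borel_measurable borel"
    using g by (intro borel_measurable_continuous_onI)
  have Gm[measurable]: "G \<in> borel_measurable borel"
    using borel_measurable_integrable[OF Gi] by simp
  define m where "m = (LBINT x. g x)"
  have gi: "integrable lborel g" and Gm0: "G 0 = of_real m"
  proof -
    have "has_bochner_integral lborel (\<lambda>x. complex_of_real (g x)) (G 0)" using G[of 0] by simp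
    then show "integrable lborel g" "G 0 = of_real m"
      by (auto simp: has_bochner_integral_iff complex_of_real_integrable_eq m_def)
  qed
  have m: "0 < m"
    using Gm0 G0 g(2) by (simp add: m_def less_le Bochner_Integration.integral_nonneg)
  define M where "M = density lborel (\<lambda>x. ennreal (g x / m))"
  have em: "(\<integral>\<^sup>+x. ennreal (g x / m) \<partial>lborel) = 1"
  proof -
    have "(\<integral>\<^sup>+x. ennreal (g x / m) \<partial>lborel) = ennreal (LBINT x. g x / m)"
      using gi g(2) m by (intro nn_integral_eq_integral) auto
    also have "(LBINT x. g x / m) = 1" using m by (simp add: m_def)
    finally show ?thesis by simp
  qed
  have "prob_space M"
    by (rule prob_spaceI) (use em in \<open>simp add: M_def emeasure_density\<close>)
  then interpret M: real_distribution M
    by (simp add: real_distribution_def real_distribution_axioms_def M_def)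
  have char: "char M t = G t / of_real m" for t
  proof -
    have "char M t = (LBINT x. (g x / m) *\<^sub>R iexp (t * x))"
      unfolding char_def M_def using g(2) m by (subst integral_density) auto
    also have "\<dots> = (LBINT x. iexp (t * x) * of_real (g x) / of_real m)"
      by (intro Bochner_Integration.integral_cong) (auto simp: scaleR_conv_of_real field_simps)
    also have "\<dots> = G t / of_real m"
      using G[of t] by (simp add: has_bochner_integral_iff)
    finally show ?thesis .
  qed
  have meas: "measure M {a<..b} = (LBINT x:{a..b}. g x) / m" "measure M {a} = 0" if "a \<le> b" for a b
  proof -
    have E: "emeasure M A = ennreal (LBINT x:A. g x / m)" if "A \<in> sets borel" for A
    proof -
      have "emeasure M A = (\<integral>\<^sup>+x. ennreal (indicator A x * (g x / m)) \<partial>lborel)"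
        unfolding M_def using that
        by (subst emeasure_density) (auto intro!: nn_integral_cong split: split_indicator)
      also have "\<dots> = ennreal (LBINT x. indicator A x * (g x / m))"
        using gi g(2) m that
        by (intro nn_integral_eq_integral)
           (auto intro!: integrable_real_mult_indicator simp: mult.commute split: split_indicator)
      finally show ?thesis by (simp add: set_lebesgue_integral_def)
    qed
    have "measure M A = (LBINT x:A. g x) / m" if "A \<in> sets borel" for A
    proof -
      have "0 \<le> (LBINT x:A. g x / m)"
        using g(2) m by (auto simp: set_lebesgue_integral_def intro!: Bochner_Integration.integral_nonneg)
      then show ?thesis unfolding measure_def E[OF that]
        by (simp add: set_lebesgue_integral_def)
    qed
    note * = this
    have "(LBINT x:{a<..b}. g x) = (LBINT x:{a..b}. g x)"
      unfolding set_lebesgue_integral_def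
      by (intro integral_cong_AE AE_I[of _ _ "{a}"]) (auto split: split_indicator)
    with *[of "{a<..b}"] show "measure M {a<..b} = (LBINT x:{a..b}. g x) / m" by simp
    have "(LBINT x:{a}. g x) = 0"
      unfolding set_lebesgue_integral_def
      by (intro integral_eq_zero_AE AE_I[of _ _ "{a}"]) (auto split: split_indicator)
    with *[of "{a}"] show "measure M {a} = 0" by simp
  qed
  define h where "h = (\<lambda>x. LBINT y. iexp (- (y * x)) * G y)"
  have norm_iexp: "norm (iexp r) = 1" for r by simp
  have key: "(LBINT x:{a..b}. h x) = 2 * of_real pi * of_real (LBINT x:{a..b}. g x)"
    and hi: "set_integrable lborel {a..b} h" if ab: "a \<le> b" for a b
  proof -
    define K where "K = (\<lambda>t. (iexp (- (t * a)) - iexp (- (t * b))) / (\<i> * complex_of_real t))"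
    define H where "H = (\<lambda>t x. indicator {a..b} x *\<^sub>R (iexp (- (t * x)) * G t))"
    have Ki: "set_integrable lborel {a..b} (\<lambda>x. iexp (- (t * x)))" for t :: real
      by (intro borel_integrable_atLeastAtMost') (auto intro!: continuous_intros)
    have A: "has_bochner_integral lborel (H t) ((LBINT x:{a..b}. iexp (- (t * x))) * G t)" for t
      using has_bochner_integral_mult_left[OF has_bochner_integral_integrable[OF Ki[of t, unfolded set_integrable_def]], of "G t"]
      unfolding H_def set_lebesgue_integral_def by (simp add: scaleR_conv_of_real mult_ac)
    have N: "has_bochner_integral lborel (\<lambda>x. norm (H t x)) ((b - a) * norm (G t))" for t
    proof -
      have "norm (H t x) = indicator {a..b} x * norm (G t)" for x
        unfolding H_def by (simp add: norm_mult)
      moreover have "has_bochner_integral lborel (\<lambda>x. indicator {a..b} x * norm (G t)) ((b - a) * norm (G t))"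
        using has_bochner_integral_mult_left[OF has_bochner_integral_real_indicator[of "{a..b}" lborel], of "norm (G t)"] ab
        by simp
      ultimately show ?thesis by simp
    qed
    have B: "has_bochner_integral lborel (\<lambda>t. H t x) (indicator {a..b} x *\<^sub>R h x)" for x
    proof -
      have "integrable lborel (\<lambda>y. iexp (- (y * x)) * G y)"
        by (rule Bochner_Integration.integrable_bound[OF Gi]) (auto simp: norm_mult)
      then show ?thesis
        unfolding H_def h_def by (intro has_bochner_integral_scaleR_right has_bochner_integral_integrable) auto
    qed
    have Ni: "integrable lborel (\<lambda>t. (b - a) * norm (G t))" using Gi by auto
    have "case_prod H \<in> borel_measurable (lborel \<Otimes>\<^sub>M lborel)"
      unfolding H_def by measurable
    note sw = has_bochner_integral_swap[OF this A N Ni B]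
    show "set_integrable lborel {a..b} h" using sw(2) by (simp add: set_integrable_def)
    have KG: "AE t in lborel. K t * G t = (LBINT x:{a..b}. iexp (- (t * x))) * G t"
    proof (rule AE_I[of _ _ "{0}"])
      have "K t * G t = (LBINT x:{a..b}. iexp (- (t * x))) * G t" if "t \<noteq> 0" for t
        unfolding K_def integral_iexp_Icc[OF ab that] ..
      then show "{t \<in> space lborel. \<not> K t * G t = (LBINT x:{a..b}. iexp (- (t * x))) * G t} \<subseteq> {0}"
        by blast
    qed auto
    have Km[measurable]: "K \<in> borel_measurable borel" unfolding K_def by measurable
    have "(\<lambda>T::nat. CLBINT t=-T..T. K t * (G t / of_real m)) \<longlonglongrightarrow> (LBINT t. K t * (G t / of_real m))"
    proof -
      have eq: "(CLBINT t=-(ereal (real T))..ereal (real T). F t) = (LBINT t. indicator {- real T<..<real T} t *\<^sub>R F t)"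
        for T :: nat and F :: "real \<Rightarrow> complex"
        by (simp add: interval_lebesgue_integral_def set_lebesgue_integral_def)
      show ?thesis unfolding eq
      proof (rule integral_dominated_convergence[where w = "\<lambda>t. (b - a) * norm (G t) / m"])
        show "integrable lborel (\<lambda>t. (b - a) * norm (G t) / m)" using Gi by auto
        show "AE t in lborel. (\<lambda>T. indicator {- real T<..<real T} t *\<^sub>R (K t * (G t / of_real m)))
            \<longlonglongrightarrow> K t * (G t / of_real m)"
        proof (rule AE_I2)
          fix t :: real
          obtain T0 :: nat where "\<bar>t\<bar> < real T0" using reals_Archimedean2 by blast
          then have "\<forall>\<^sub>F T in sequentially. indicator {- real T<..<real T} t *\<^sub>R (K t * (G t / of_real m))
              = K t * (G t / of_real m)"
            by (intro eventually_sequentiallyI[of T0]) (auto split: split_indicator)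
          then show "(\<lambda>T. indicator {- real T<..<real T} t *\<^sub>R (K t * (G t / of_real m)))
            \<longlonglongrightarrow> K t * (G t / of_real m)"
            by (rule tendsto_eventually)
        qed
        show "AE t in lborel. norm (indicator {- real T<..<real T} t *\<^sub>R (K t * (G t / of_real m)))
            \<le> (b - a) * norm (G t) / m" for T :: nat
        proof (rule AE_I[of _ _ "{0}"])
          show "{t \<in> space lborel. \<not> norm (indicator {- real T<..<real T} t *\<^sub>R (K t * (G t / of_real m)))
            \<le> (b - a) * norm (G t) / m} \<subseteq> {0}"
          proof (rule subsetI, rule ccontr)
            fix t assume t: "t \<in> {t \<in> space lborel. \<not> norm (indicator {- real T<..<real T} t *\<^sub>R (K t * (G t / of_real m)))
              \<le> (b - a) * norm (G t) / m}" "t \<notin> {0}"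
            have "norm (K t) \<le> b - a"
            proof -
              have "K t = (iexp (t * - a) - iexp (t * - b)) / (\<i> * t)"
                by (simp add: K_def)
              then show ?thesis
                using Levy_Inversion_aux2[of "-b" "-a" t] ab t(2) by simp
            qed
            then have "norm (K t) * (norm (G t) / m) \<le> (b - a) * (norm (G t) / m)"
              using m by (intro mult_right_mono) auto
            then show False using t m ab
              by (auto simp: norm_mult norm_divide split: split_indicator_asm)
          qed
        qed auto
      qed auto
    qed
    moreover have "(\<lambda>T::nat. 1 / (2 * pi) * (CLBINT t=-T..T. K t * (G t / of_real m))) \<longlonglongrightarrow>
        of_real ((LBINT x:{a..b}. g x) / m)"
      using M.Levy_Inversion[OF ab] meas[OF ab] meas(2)[of b b] by (simp add: char K_def)
    ultimately have "of_real ((LBINT x:{a..b}. g x) / m) = 1 / (2 * complex_of_real pi) * (LBINT t. K t * (G t / of_real m))"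
      by (intro LIMSEQ_unique[OF _ tendsto_mult_left]) auto
    also have "(LBINT t. K t * (G t / of_real m)) = (LBINT t. K t * G t) / of_real m"
      by simp
    also have "(LBINT t. K t * G t) = (LBINT t. (LBINT x:{a..b}. iexp (- (t * x))) * G t)"
      using borel_measurable_integrable[OF sw(1)] by (intro integral_cong_AE KG) auto
    also have "\<dots> = (LBINT x:{a..b}. h x)"
      using sw(3) by (simp add: set_lebesgue_integral_def)
    finally show "(LBINT x:{a..b}. h x) = 2 * of_real pi * of_real (LBINT x:{a..b}. g x)"
      using m by (simp add: field_simps)
  qed
  have hc: "continuous_on UNIV h"
    unfolding continuous_on_sequentially
  proof (intro ballI allI impI)
    fix u :: "nat \<Rightarrow> real" and a assume u: "(\<forall>n. u n \<in> UNIV) \<and> u \<longlonglongrightarrow> a"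
    show "(h \<circ> u) \<longlonglongrightarrow> h a"
      unfolding h_def o_def
    proof (rule integral_dominated_convergence[where w = "\<lambda>y. norm (G y)"])
      show "AE y in lborel. (\<lambda>n. iexp (- (y * u n)) * G y) \<longlonglongrightarrow> iexp (- (y * a)) * G y"
        using u by (intro AE_I2 tendsto_intros) auto
    qed (use Gi in \<open>auto simp: norm_mult\<close>)
  qed
  define D where "D = (\<lambda>x. h x - 2 * of_real pi * of_real (g x))"
  have Dc: "continuous_on A D" for A
    unfolding D_def by (intro continuous_intros continuous_on_subset[OF hc] continuous_on_subset[OF g(1)]) auto
  have D0: "integral {a..b} D = 0" if ab: "a \<le> b" for a b
  proof -
    have gs: "set_integrable lborel {a..b} (\<lambda>x. complex_of_real (g x))"
      by (intro borel_integrable_atLeastAtMost') (auto intro!: continuous_intros continuous_on_subset[OF g(1)])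
    have "integral {a..b} h = (LBINT x:{a..b}. h x)"
      using set_borel_integral_eq_integral(2)[OF hi[OF ab]] by simp
    moreover have "integral {a..b} (\<lambda>x. complex_of_real (g x)) = (LBINT x:{a..b}. complex_of_real (g x))"
      using set_borel_integral_eq_integral(2)[OF gs] by simp
    moreover have "(LBINT x:{a..b}. complex_of_real (g x)) = of_real (LBINT x:{a..b}. g x)"
      by (rule set_integral_complex_of_real)
    moreover have "integral {a..b} D = integral {a..b} h - 2 * of_real pi * integral {a..b} (\<lambda>x. complex_of_real (g x))"
      unfolding D_def
      by (subst Henstock_Kurzweil_Integration.integral_diff)
         (auto intro!: integrable_continuous_interval continuous_intros continuous_on_subset[OF hc] continuous_on_subset[OF g(1)])
    ultimately show ?thesis using key[OF ab] by simp
  qed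
  have "((\<lambda>u. integral {x - 1..u} D) has_vector_derivative D x) (at x within {x - 1..x})"
    by (rule integral_has_vector_derivative[OF Dc]) simp
  then have "((\<lambda>u. 0) has_vector_derivative D x) (at x within {x - 1..x})"
    by (rule has_vector_derivative_transform[rotated 2]) (auto simp: D0)
  moreover have "((\<lambda>u. 0) has_vector_derivative (0 :: complex)) (at x within {x - 1..x})" by simp
  ultimately have "D x = 0"
    by (intro vector_derivative_unique_within_closed_interval[of "x - 1" x x "\<lambda>u. 0"]) auto
  then show ?thesis by (simp add: D_def h_def)
qed

section \<open>The Mellin transform of the stable density\<close>

lemma stable_mellin_continuous:
  assumes alpha: "0 < \<alpha>" "\<alpha> < 1"
  shows "continuous_on UNIV (\<lambda>y::real. stable_mellin \<alpha> k n (\<i> * of_real y))"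
proof -
  have "complex_of_nat k + (1 - \<i> * of_real y) / of_real \<alpha> \<notin> \<int>\<^sub>\<le>\<^sub>0" for y :: real
  proof -
    have "0 < Re (complex_of_nat k + (1 - \<i> * of_real y) / of_real \<alpha>)"
      using alpha by (simp add: add_nonneg_pos)
    then show ?thesis
      using Gamma_neq_zero_if_Re_pos Gamma_eq_zero_iff by blast
  qed
  then show ?thesis
    unfolding stable_mellin_def using alpha
    by (intro continuous_on_mult continuous_on_compose2[OF continuous_on_rGamma]
          continuous_on_compose2[OF continuous_on_Gamma[of "- \<int>\<^sub>\<le>\<^sub>0"]]) (auto intro!: continuous_intros)
qed

lemma stable_mellin_integrable:
  assumes alpha: "0 < \<alpha>" "\<alpha> < 1" and "k \<le> n"
  shows "integrable lborel (\<lambda>y. stable_mellin \<alpha> k n (\<i> * of_real y))"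
proof -
  obtain C c where C: "0 < C" "0 < c"
    "\<And>s. - 0 \<le> Re s \<Longrightarrow> 1 \<le> \<bar>Im s\<bar> \<Longrightarrow>
       norm (stable_mellin \<alpha> k n s * of_real 1 powr (- s)) \<le> C * exp (- c * \<bar>Im s\<bar> - Re s)"
    using norm_stable_mellin_powr_le[OF assms, of 1 1 0] by auto
  have cc: "continuous_on {-1..1} (\<lambda>y::real. stable_mellin \<alpha> k n (\<i> * of_real y))"
    by (rule continuous_on_subset[OF stable_mellin_continuous[OF alpha]]) simp
  obtain B where B: "0 \<le> B" "\<And>y. y \<in> {-1..1::real} \<Longrightarrow> norm (stable_mellin \<alpha> k n (\<i> * of_real y)) \<le> B"
    by (rule continuous_on_compact_bound[OF compact_Icc cc]) blast
  have e: "integrable lborel (\<lambda>y. indicator {0<..} y *\<^sub>R exp (- (y * c)))"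
    using integrable_I0i_exp_mscale[OF C(2)] by (simp add: set_integrable_def)
  have e': "integrable lborel (\<lambda>y. indicator {0<..} (0 + (-1) * y) *\<^sub>R exp (- ((0 + (-1) * y) * c)))"
    by (rule lborel_integrable_real_affine[OF e]) simp
  have i: "integrable lborel (\<lambda>y. B * indicator {-1..1::real} y)"
    by simp
  let ?w = "\<lambda>y. B * indicator {-1..1} y + (C * (indicator {0<..} y *\<^sub>R exp (- (y * c))) +
     C * (indicator {0<..} (0 + (-1) * y) *\<^sub>R exp (- ((0 + (-1) * y) * c))))"
  show ?thesis
  proof (rule Bochner_Integration.integrable_bound)
    show "integrable lborel ?w" by (intro Bochner_Integration.integrable_add i integrable_mult_right e e')
    show "(\<lambda>y. stable_mellin \<alpha> k n (\<i> * of_real y)) \<in> borel_measurable lborel"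
      using borel_measurable_continuous_onI[OF stable_mellin_continuous[OF alpha]] by simp
    show "AE y in lborel. norm (stable_mellin \<alpha> k n (\<i> * of_real y)) \<le> norm (?w y)"
    proof (rule AE_I2)
      fix y :: real
      have w: "0 \<le> ?w y" using B C by (auto split: split_indicator)
      have "norm (stable_mellin \<alpha> k n (\<i> * of_real y)) \<le> ?w y"
      proof (cases "\<bar>y\<bar> \<le> 1")
        case True
        then have "norm (stable_mellin \<alpha> k n (\<i> * of_real y)) \<le> B" using B(2)[of y] by (simp add: abs_le_iff)
        also have "B \<le> ?w y" using True C by (auto split: split_indicator)
        finally show ?thesis .
      next
        case False
        then have "norm (stable_mellin \<alpha> k n (\<i> * of_real y)) \<le> C * exp (- c * \<bar>y\<bar>)"
          using C(3)[of "\<i> * of_real y"] by simp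
        also have "\<dots> \<le> ?w y" using B C False by (auto split: split_indicator simp: mult.commute)
        finally show ?thesis .
      qed
      then show "norm (stable_mellin \<alpha> k n (\<i> * of_real y)) \<le> norm (?w y)" using w by simp
    qed
  qed
qed

lemma stable_mellin_0_neq_0:
  assumes alpha: "0 < \<alpha>" "\<alpha> < 1"
  shows "stable_mellin \<alpha> k n 0 \<noteq> 0"
proof -
  have "Gamma (of_nat k + 1 / complex_of_real \<alpha>) \<noteq> 0"
    using alpha by (intro Gamma_neq_zero_if_Re_pos) (simp add: add_nonneg_pos)
  moreover have "Gamma (of_nat n + 1 :: complex) \<noteq> 0"
    by (intro Gamma_neq_zero_if_Re_pos) simp
  ultimately show ?thesis by (simp add: stable_mellin_def rGamma_inverse_Gamma)
qed

text \<open>What the law of $S_\alpha$ contributes to the argument, detached from the probability space on which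
  $S_\alpha$ is defined: a continuous density with the prescribed Laplace transform.\<close>

locale stable_density =
  fixes \<alpha> :: real and f :: "real \<Rightarrow> real"
  assumes alpha: "0 < \<alpha>" "\<alpha> < 1"
    and continuous: "continuous_on {0<..} f"
    and nonneg: "\<And>t. 0 < t \<Longrightarrow> 0 \<le> f t"
    and laplace_integrable: "\<And>l. 0 < l \<Longrightarrow> set_integrable lborel {0<..} (\<lambda>t. exp (- l * t) * f t)"
    and laplace: "\<And>l. 0 < l \<Longrightarrow> (LBINT t:{0<..}. exp (- l * t) * f t) = exp (- (l powr \<alpha>))"

text \<open>Integrability comes for free: the Bochner integral of a function that is not integrable is \<open>0\<close>, and
  the Laplace transform does not vanish.\<close>

lemma stable_rv_imp_stable_density:
  assumes "0 < \<alpha>" "\<alpha> < 1" "stable_rv \<alpha> f \<Omega> S"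
  shows "stable_density \<alpha> f"
proof
  show "0 < \<alpha>" "\<alpha> < 1" by fact+
  from assms(3) have c: "continuous_on {0<..} f" and n: "\<And>t. 0 < t \<Longrightarrow> 0 \<le> f t"
    and d: "distributed \<Omega> lborel S (\<lambda>t. ennreal (indicator {0<..} t * f t))"
    and L: "\<And>l. 0 < l \<Longrightarrow> (LINT \<omega>|\<Omega>. exp (- l * S \<omega>)) = exp (- (l powr \<alpha>))"
    by (auto simp: stable_rv_def has_pdf_on_def)
  show "continuous_on {0<..} f" "\<And>t. 0 < t \<Longrightarrow> 0 \<le> f t" by fact+
  fix l :: real assume l: "0 < l"
  have "(LBINT t. indicator {0<..} t * f t * exp (- l * t)) = (LINT \<omega>|\<Omega>. exp (- l * S \<omega>))"
    by (rule distributed_integral[OF d]) (auto intro: n split: split_indicator)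
  then have e: "(LBINT t:{0<..}. exp (- l * t) * f t) = exp (- (l powr \<alpha>))"
    unfolding L[OF l] set_lebesgue_integral_def by (simp add: mult_ac)
  then show "(LBINT t:{0<..}. exp (- l * t) * f t) = exp (- (l powr \<alpha>))" .
  show "set_integrable lborel {0<..} (\<lambda>t. exp (- l * t) * f t)"
  proof (rule ccontr)
    assume "\<not> set_integrable lborel {0<..} (\<lambda>t. exp (- l * t) * f t)"
    then have "(LBINT t:{0<..}. exp (- l * t) * f t) = 0"
      unfolding set_integrable_def set_lebesgue_integral_def by (rule not_integrable_integral_eq)
    with e show False by simp
  qed
qed

context stable_density
begin

lemma continuous_log: "continuous_on A (\<lambda>x. f (exp x))"
proof -
  have "continuous_on A (f \<circ> exp)"
    by (intro continuous_on_compose continuous_intros continuous_on_subset[OF continuous]) auto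
  then show ?thesis by (simp add: o_def)
qed

lemma measurable_log [measurable]: "(\<lambda>x. f (exp x)) \<in> borel_measurable borel"
  by (intro borel_measurable_continuous_onI continuous_log)

lemma laplace_log_scale:
  "has_bochner_integral lborel (\<lambda>x. exp x * f (exp x) * exp (- exp (y + x))) (exp (- exp (\<alpha> * y)))"
proof -
  let ?F = "\<lambda>t. exp (- exp y * t) * f t"
  have c: "continuous_on {0<..} ?F" by (intro continuous_intros continuous)
  have i: "set_integrable lborel {0<..} ?F" by (rule laplace_integrable) simp
  have a: "?F absolutely_integrable_on {0<..}"
    using i unfolding set_integrable_def by (rule integrable_completion[THEN iffD2, rotated])
      (use i in \<open>auto simp: set_integrable_def dest: borel_measurable_integrable\<close>)
  have j: "integrable lborel (\<lambda>x. exp x *\<^sub>R ?F (exp x))"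
    using exp_substitution(1)[OF c] a by blast
  have "(LBINT x. exp x *\<^sub>R ?F (exp x)) = integral {0<..} ?F"
    using exp_substitution(2)[OF c j] by simp
  also have "\<dots> = (LBINT t:{0<..}. ?F t)"
    using set_borel_integral_eq_integral(2)[OF i] by simp
  also have "\<dots> = exp (- exp (\<alpha> * y))"
    by (subst laplace) (auto simp: powr_def)
  finally have "has_bochner_integral lborel (\<lambda>x. exp x *\<^sub>R ?F (exp x)) (exp (- exp (\<alpha> * y)))"
    using j by (simp add: has_bochner_integral_iff)
  moreover have "exp x *\<^sub>R ?F (exp x) = exp x * f (exp x) * exp (- exp (y + x))" for x
    by (simp add: exp_add)
  ultimately show ?thesis by (simp only:)
qed

text \<open>Fubini's theorem for \<open>f (e\<^sup>x) e\<^sup>x exp (p y - exp (x + y))\<close> with \<open>p = 1 - s\<close>. The integral over \<open>x\<close> is the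
  Laplace transform at \<open>e\<^sup>y\<close>, after which the integral over \<open>y\<close> is \<open>\<Gamma>(p/\<alpha>) / \<alpha>\<close>; in the other order the
  integral over \<open>y\<close> produces \<open>\<Gamma>(p) e\<close> to the power \<open>- p x\<close>.\<close>

lemma mellin_log_scale:
  assumes "Re s < 1"
  shows "has_bochner_integral lborel (\<lambda>x. exp (s * of_real x) * of_real (f (exp x)))
           (stable_mellin \<alpha> 0 0 s / of_real \<alpha>)"
proof -
  define p where "p = 1 - s"
  have p: "0 < Re p" "0 < Re (p / of_real \<alpha>)" using assms alpha by (auto simp: p_def)
  define H where "H = (\<lambda>y x. exp (p * of_real y) * complex_of_real (exp x * f (exp x) * exp (- exp (y + x))))"
  have scale: "has_bochner_integral lborel (\<lambda>y. exp (q * of_real y - of_real (exp (\<alpha> * y)))) (Gamma (q / of_real \<alpha>) / of_real \<alpha>)"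
    if q: "0 < Re q" for q
  proof -
    have "0 < Re (q / of_real \<alpha>)" using q alpha by simp
    note * = Gamma_integral_log_scale[OF this]
    have "has_bochner_integral lborel (\<lambda>y. exp (q / of_real \<alpha> * of_real (0 + \<alpha> * y) - of_real (exp (0 + \<alpha> * y))))
       (Gamma (q / of_real \<alpha>) /\<^sub>R \<bar>\<alpha>\<bar>)"
      using alpha * by (subst lborel_has_bochner_integral_real_affine_iff[symmetric]) auto
    then show ?thesis using alpha by (simp add: scaleR_conv_of_real field_simps)
  qed
  have A: "has_bochner_integral lborel (H y) (exp (p * of_real y) * of_real (exp (- exp (\<alpha> * y))))" for y
    unfolding H_def by (intro has_bochner_integral_mult_right has_bochner_integral_of_real laplace_log_scale)
  have N: "has_bochner_integral lborel (\<lambda>x. norm (H y x)) (exp (Re p * y) * exp (- exp (\<alpha> * y)))" for y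
  proof -
    have "norm (H y x) = exp (Re p * y) * (exp x * f (exp x) * exp (- exp (y + x)))" for x
      using nonneg by (simp add: H_def norm_mult abs_mult)
    then show ?thesis
      by (simp only:) (intro has_bochner_integral_mult_right laplace_log_scale)
  qed
  have N': "integrable lborel (\<lambda>y. exp (Re p * y) * exp (- exp (\<alpha> * y)))"
  proof -
    have "has_bochner_integral lborel (\<lambda>y. Re (exp (of_real (Re p) * of_real y - of_real (exp (\<alpha> * y)))))
        (Re (Gamma (of_real (Re p) / of_real \<alpha>) / of_real \<alpha>))"
      using p by (intro has_bochner_integral_Re scale) simp
    moreover have "Re (exp (of_real (Re p) * of_real y - of_real (exp (\<alpha> * y)))) = exp (Re p * y) * exp (- exp (\<alpha> * y))"
      for y :: real
    proof -
      have "of_real (Re p) * of_real y - of_real (exp (\<alpha> * y)) = complex_of_real (Re p * y - exp (\<alpha> * y))"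
        by simp
      then show ?thesis
        by (simp only: exp_of_real Re_complex_of_real exp_diff exp_minus divide_inverse)
    qed
    ultimately show ?thesis by (simp add: has_bochner_integral_iff)
  qed
  have B: "has_bochner_integral lborel (\<lambda>y. H y x)
     (of_real (exp x * f (exp x)) * (Gamma p * exp (- p * of_real x)))" for x
  proof -
    have "H y x = of_real (exp x * f (exp x)) * exp (p * of_real y - of_real (exp (x + y)))" for y
      by (simp add: H_def exp_diff exp_minus divide_inverse add.commute flip: exp_of_real)
    then show ?thesis
      by (simp only:) (intro has_bochner_integral_mult_right Gamma_integral_log_scale_shift p)
  qed
  have "case_prod H \<in> borel_measurable (lborel \<Otimes>\<^sub>M lborel)"
    unfolding H_def by measurable
  note sw = has_bochner_integral_swap[OF this A N N' B]
  have "(LBINT y. exp (p * of_real y) * of_real (exp (- exp (\<alpha> * y)))) = Gamma (p / of_real \<alpha>) / of_real \<alpha>"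
    using scale[OF p(1)]
    by (simp add: has_bochner_integral_iff exp_diff exp_minus divide_inverse exp_of_real)
  with sw(2,3) have "has_bochner_integral lborel
     (\<lambda>x. of_real (exp x * f (exp x)) * (Gamma p * exp (- p * of_real x))) (Gamma (p / of_real \<alpha>) / of_real \<alpha>)"
    by (simp add: has_bochner_integral_iff)
  from has_bochner_integral_mult_left[OF this, of "rGamma p"]
  have "has_bochner_integral lborel
     (\<lambda>x. of_real (exp x * f (exp x)) * (Gamma p * exp (- p * of_real x)) * rGamma p)
     (stable_mellin \<alpha> 0 0 s / of_real \<alpha>)"
    by (simp add: stable_mellin_def p_def)
  moreover have "of_real (exp x * f (exp x)) * (Gamma p * exp (- p * of_real x)) * rGamma p =
     exp (s * of_real x) * of_real (f (exp x))" for x :: real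
  proof -
    have "exp (of_real x) * exp (- p * of_real x) = exp (s * of_real x)"
      by (simp add: p_def algebra_simps mult_exp_exp)
    moreover have "Gamma p * rGamma p = 1"
      using Gamma_neq_zero_if_Re_pos[OF p(1)] by (simp add: rGamma_inverse_Gamma)
    ultimately show ?thesis
      by (simp add: mult_ac exp_of_real[symmetric])
  qed
  ultimately show ?thesis by (simp only:)
qed

text \<open>The Mellin transform along the imaginary axis is the Fourier transform on the logarithmic scale.\<close>

lemma mellin_inversion:
  assumes h: "continuous_on UNIV h" "\<And>x. 0 \<le> h x" and "k \<le> n" and K: "K \<noteq> 0"
    and M: "\<And>y. has_bochner_integral lborel (\<lambda>x. iexp (y * x) * of_real (h x))
              (K * stable_mellin \<alpha> k n (\<i> * of_real y))"
  shows "of_real (h x) = K / (2 * of_real pi) * (LBINT y. iexp (- (y * x)) * stable_mellin \<alpha> k n (\<i> * of_real y))"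
proof -
  have "of_real (h x) = 1 / (2 * of_real pi) * (LBINT y. iexp (- (y * x)) * (K * stable_mellin \<alpha> k n (\<i> * of_real y)))"
    by (rule Fourier_inversion_nonneg[OF h M])
       (use K stable_mellin_0_neq_0[OF alpha] stable_mellin_integrable[OF alpha assms(3)] in auto)
  also have "(\<lambda>y. iexp (- (y * x)) * (K * stable_mellin \<alpha> k n (\<i> * of_real y))) =
     (\<lambda>y. K * (iexp (- (y * x)) * stable_mellin \<alpha> k n (\<i> * of_real y)))"
    by (simp add: mult_ac)
  finally show ?thesis by (simp only: integral_mult_right_zero) simp
qed

lemma density_eq_mellin_inversion:
  "of_real (f (exp x)) = 1 / (2 * of_real pi * of_real \<alpha>) *
     (LBINT y. iexp (- (y * x)) * stable_mellin \<alpha> 0 0 (\<i> * of_real y))"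
proof -
  have "has_bochner_integral lborel (\<lambda>x. iexp (y * x) * of_real (f (exp x)))
          (1 / of_real \<alpha> * stable_mellin \<alpha> 0 0 (\<i> * of_real y))" for y
    using mellin_log_scale[of "\<i> * of_real y"] by (simp add: mult.assoc)
  from mellin_inversion[OF continuous_log _ _ _ this] alpha show ?thesis
    by (simp add: nonneg mult.commute)
qed

text \<open>The inversion formula bounds the density everywhere, in particular near the origin, about which
  continuity on $(0,\infty)$ says nothing. The dominated convergence arguments below rest on this.\<close>

lemma bounded_density: obtains F where "\<And>t. 0 < t \<Longrightarrow> f t \<le> F"
proof -
  define F where "F = norm (1 / (2 * of_real pi * complex_of_real \<alpha>)) *
     (LBINT y. norm (stable_mellin \<alpha> 0 0 (\<i> * of_real y)))"
  have "f t \<le> F" if t: "0 < t" for t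
  proof -
    have "norm (complex_of_real (f (exp (ln t)))) \<le> norm (1 / (2 * of_real pi * complex_of_real \<alpha>)) *
        (LBINT y. norm (iexp (- (y * ln t)) * stable_mellin \<alpha> 0 0 (\<i> * of_real y)))"
      unfolding density_eq_mellin_inversion norm_mult[of "1 / _"]
      by (intro mult_left_mono integral_norm_bound) simp
    then show ?thesis using t by (simp add: F_def norm_mult)
  qed
  then show thesis by (rule that)
qed
end

section \<open>Averages of the stable density over beta weights\<close>

context stable_density
begin

text \<open>Up to a constant, the density at \<open>t\<close> of the quotient of a tilted stable variable with exponent \<open>c\<close>
  and an independent beta variable with parameters \<open>c + d\<close> and \<open>b\<close>.\<close>

definition beta_average :: "real \<Rightarrow> nat \<Rightarrow> real \<Rightarrow> real \<Rightarrow> real" where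
  "beta_average c d b t = t powr (- c) * integral {0..1} (\<lambda>u. u ^ d * f (t * u) * (1 - u) powr (b - 1))"

text \<open>The weight \<open>u\<^sup>d (1 - u)\<close> to the power \<open>b - 1\<close>, with \<open>du\<close>, after the substitution \<open>u = 1 / (1 + e\<^sup>v)\<close>.\<close>

definition logit_kernel :: "nat \<Rightarrow> real \<Rightarrow> real \<Rightarrow> real" where
  "logit_kernel d b v = exp (b * v - (real d + 1 + b) * ln (1 + exp v))"

lemma logit_kernel_beta:
  assumes "0 < b" "0 \<le> Re q"
  shows "has_bochner_integral lborel (\<lambda>v. of_real (logit_kernel d b v) * exp (- q * of_real (ln (1 + exp v))))
           (Beta (of_nat d + 1 + q) (of_real b))"
proof -
  have "has_bochner_integral lborel (\<lambda>v::real. exp (of_real b * of_real v -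
      ((of_nat d + 1 + q) + of_real b) * of_real (ln (1 + exp v)))) (Beta (of_nat d + 1 + q) (of_real b))"
    using assms by (intro Beta_integral_log_scale) auto
  moreover have "exp (of_real b * of_real v - ((of_nat d + 1 + q) + of_real b) * of_real (ln (1 + exp v))) =
      of_real (logit_kernel d b v) * exp (- q * of_real (ln (1 + exp v)))" for v :: real
  proof -
    have "complex_of_real (logit_kernel d b v) =
        exp (of_real b * of_real v - (of_nat d + 1 + of_real b) * of_real (ln (1 + exp v)))"
      by (simp add: logit_kernel_def flip: exp_of_real)
    then show ?thesis by (simp only: mult_exp_exp) (simp add: algebra_simps)
  qed
  ultimately show ?thesis by (simp only:)
qed

lemma logit_kernel_real:
  assumes "0 < b" "0 \<le> c"
  shows "has_bochner_integral lborel (\<lambda>v. logit_kernel d b v * exp (- c * ln (1 + exp v)))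
           (Beta (real d + 1 + c) b)"
proof -
  have "has_bochner_integral lborel
      (\<lambda>v. Re (of_real (logit_kernel d b v) * exp (- of_real c * of_real (ln (1 + exp v)))))
      (Re (Beta (of_nat d + 1 + of_real c) (of_real b)))"
    using assms by (intro has_bochner_integral_Re logit_kernel_beta) auto
  moreover have "Beta (of_nat d + 1 + of_real c) (of_real b) = complex_of_real (Beta (real d + 1 + c) b)"
    by (simp flip: Beta_complex_of_real)
  moreover have "of_real (logit_kernel d b v) * exp (- of_real c * of_real (ln (1 + exp v))) =
      complex_of_real (logit_kernel d b v * exp (- c * ln (1 + exp v)))" for v :: real
    by (simp flip: exp_of_real)
  ultimately show ?thesis by (simp only: Re_complex_of_real)
qed

lemma logit_kernel_pos: "0 < logit_kernel d b v" by (simp add: logit_kernel_def)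

lemma logit_kernel_measurable [measurable]: "logit_kernel d b \<in> borel_measurable borel"
  unfolding logit_kernel_def by measurable

lemma exp_div_logistic: "exp x / (1 + exp v) = exp (x - ln (1 + exp v))" for x v :: real
  by (simp add: exp_diff add_pos_pos)

lemma average_measurable [measurable]:
  "(\<lambda>(x, v). f (exp x / (1 + exp v))) \<in> borel_measurable (borel \<Otimes>\<^sub>M borel)"
  unfolding exp_div_logistic by measurable

lemma average_integrable:
  assumes "0 < b"
  shows "integrable lborel (\<lambda>v. f (exp x / (1 + exp v)) * logit_kernel d b v)"
proof -
  obtain F where F: "\<And>t. 0 < t \<Longrightarrow> f t \<le> F" by (rule bounded_density) blast
  show ?thesis
  proof (rule Bochner_Integration.integrable_bound)
    show "integrable lborel (\<lambda>v. F * logit_kernel d b v)"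
      using logit_kernel_real[OF assms, of 0 d] by (auto simp: has_bochner_integral_iff)
    show "(\<lambda>v. f (exp x / (1 + exp v)) * logit_kernel d b v) \<in> borel_measurable lborel"
      unfolding exp_div_logistic by measurable
    show "AE v in lborel. norm (f (exp x / (1 + exp v)) * logit_kernel d b v) \<le> norm (F * logit_kernel d b v)"
    proof (rule AE_I2)
      fix v
      have "0 < exp x / (1 + exp v)" by (simp add: add_pos_pos)
      then have "0 \<le> f (exp x / (1 + exp v))" "f (exp x / (1 + exp v)) \<le> F"
        using F nonneg by blast+
      then show "norm (f (exp x / (1 + exp v)) * logit_kernel d b v) \<le> norm (F * logit_kernel d b v)"
        using logit_kernel_pos[of d b v] by (auto simp: abs_mult intro!: mult_right_mono)
    qed
  qed
qed

lemma beta_average_integrand: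
  assumes "0 < b" "0 < t"
  shows "(\<lambda>u. u ^ d * f (t * u) * (1 - u) powr (b - 1)) absolutely_integrable_on {0<..<1}"
    and "integral {0..1} (\<lambda>u. u ^ d * f (t * u) * (1 - u) powr (b - 1)) =
           (LBINT v. f (t / (1 + exp v)) * logit_kernel d b v)"
proof -
  let ?F = "\<lambda>u. u ^ d * f (t * u) * (1 - u) powr (b - 1)"
  have "continuous_on {0<..<1} (f \<circ> (\<lambda>u. t * u))"
    using assms by (intro continuous_on_compose continuous_intros continuous_on_subset[OF continuous]) auto
  then have "continuous_on {0<..<1} (\<lambda>u. f (t * u))" by (simp add: o_def)
  then have c: "continuous_on {0<..<1} ?F"
    by (intro continuous_intros) auto
  have eq: "(exp v / (1 + exp v)\<^sup>2) *\<^sub>R ?F (1 / (1 + exp v)) = f (t / (1 + exp v)) * logit_kernel d b v" for v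
  proof -
    define L where "L = ln (1 + exp v)"
    have L: "1 + exp v = exp L" by (simp add: L_def add_pos_pos)
    have "1 - 1 / (1 + exp v) = exp (v - L)"
      by (simp add: exp_diff flip: L) (simp add: field_simps add_pos_pos L)
    then have "(1 - 1 / (1 + exp v)) powr (b - 1) = exp ((b - 1) * (v - L))"
      by (simp add: powr_def)
    moreover have "exp v / (1 + exp v)\<^sup>2 = exp (v - 2 * L)"
      by (simp add: L exp_diff power2_eq_square mult_exp_exp)
    moreover have "(1 / (1 + exp v)) ^ d = exp (- (real d * L))"
      by (simp add: L exp_minus exp_of_nat_mult power_one_over inverse_eq_divide)
    ultimately have "(exp v / (1 + exp v)\<^sup>2) *\<^sub>R ?F (1 / (1 + exp v)) =
        f (t / (1 + exp v)) * (exp (v - 2 * L) * (exp (- (real d * L)) * exp ((b - 1) * (v - L))))"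
      by simp
    also have "exp (v - 2 * L) * (exp (- (real d * L)) * exp ((b - 1) * (v - L))) = logit_kernel d b v"
      unfolding mult_exp_exp logit_kernel_def L_def[symmetric] by (simp add: algebra_simps)
    finally show ?thesis .
  qed
  have tl: "t / (1 + exp v) = exp (ln t) / (1 + exp v)" for v using assms by simp
  have i: "integrable lborel (\<lambda>v. (exp v / (1 + exp v)\<^sup>2) *\<^sub>R ?F (1 / (1 + exp v)))"
    unfolding eq tl by (rule average_integrable) fact
  show "?F absolutely_integrable_on {0<..<1}"
    using logistic_substitution(1)[OF c] i by blast
  have "integral {0..1} ?F = integral {0<..<1} ?F"
    by (simp add: integral_open_interval_real)
  then show "integral {0..1} ?F = (LBINT v. f (t / (1 + exp v)) * logit_kernel d b v)"
    using logistic_substitution(2)[OF c i] unfolding eq by simp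
qed

lemma beta_average_exp:
  assumes "0 < b"
  shows "beta_average c d b (exp x) = exp (- c * x) * (LBINT v. f (exp x / (1 + exp v)) * logit_kernel d b v)"
  unfolding beta_average_def using beta_average_integrand(2)[OF assms, of "exp x" d] by (simp add: powr_def)

lemma beta_average_nonneg:
  assumes "0 < b" "0 < t" shows "0 \<le> beta_average c d b t"
proof -
  have "0 \<le> f (exp x / (1 + exp v))" for x v
    by (intro nonneg divide_pos_pos add_pos_pos) auto
  then have "0 \<le> beta_average c d b (exp (ln t))"
    unfolding beta_average_exp[OF assms(1)] using logit_kernel_pos
    by (intro mult_nonneg_nonneg Bochner_Integration.integral_nonneg) (auto simp: less_imp_le)
  then show ?thesis using assms by simp
qed

lemma beta_average_continuous_log:
  assumes "0 < b" shows "continuous_on UNIV (\<lambda>x. beta_average c d b (exp x))"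
proof -
  obtain F where F: "\<And>t. 0 < t \<Longrightarrow> f t \<le> F" by (rule bounded_density) blast
  have "continuous_on UNIV (\<lambda>x. LBINT v. f (exp x / (1 + exp v)) * logit_kernel d b v)"
    unfolding continuous_on_sequentially
  proof (intro ballI allI impI)
    fix u :: "nat \<Rightarrow> real" and a assume u: "(\<forall>n. u n \<in> UNIV) \<and> u \<longlonglongrightarrow> a"
    show "((\<lambda>x. LBINT v. f (exp x / (1 + exp v)) * logit_kernel d b v) \<circ> u) \<longlonglongrightarrow>
        (LBINT v. f (exp a / (1 + exp v)) * logit_kernel d b v)"
      unfolding o_def
    proof (rule integral_dominated_convergence[where w = "\<lambda>v. F * logit_kernel d b v"])
      show "integrable lborel (\<lambda>v. F * logit_kernel d b v)"
        using logit_kernel_real[OF assms, of 0 d] by (auto simp: has_bochner_integral_iff)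
      show "(\<lambda>v. f (exp a / (1 + exp v)) * logit_kernel d b v) \<in> borel_measurable lborel"
        "(\<lambda>v. f (exp (u n) / (1 + exp v)) * logit_kernel d b v) \<in> borel_measurable lborel" for n
        unfolding exp_div_logistic by measurable
      show "AE v in lborel. (\<lambda>n. f (exp (u n) / (1 + exp v)) * logit_kernel d b v) \<longlonglongrightarrow>
          f (exp a / (1 + exp v)) * logit_kernel d b v"
      proof (rule AE_I2)
        fix v
        have "isCont (\<lambda>x. f (exp x)) (a - ln (1 + exp v))"
          using continuous_log[of UNIV] by (simp add: continuous_on_eq_continuous_at)
        moreover have "(\<lambda>n. u n - ln (1 + exp v)) \<longlonglongrightarrow> a - ln (1 + exp v)"
          using u by (intro tendsto_intros) auto
        ultimately have "(\<lambda>n. f (exp (u n - ln (1 + exp v)))) \<longlonglongrightarrow> f (exp (a - ln (1 + exp v)))"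
          by (rule isCont_tendsto_compose)
        then show "(\<lambda>n. f (exp (u n) / (1 + exp v)) * logit_kernel d b v) \<longlonglongrightarrow>
          f (exp a / (1 + exp v)) * logit_kernel d b v"
          unfolding exp_div_logistic by (rule tendsto_mult_right)
      qed
      show "AE v in lborel. norm (f (exp (u n) / (1 + exp v)) * logit_kernel d b v) \<le> F * logit_kernel d b v" for n
      proof (rule AE_I2)
        fix v
        have "0 < exp (u n) / (1 + exp v)" by (simp add: add_pos_pos)
        then have "0 \<le> f (exp (u n) / (1 + exp v))" "f (exp (u n) / (1 + exp v)) \<le> F"
          using F nonneg by blast+
        then show "norm (f (exp (u n) / (1 + exp v)) * logit_kernel d b v) \<le> F * logit_kernel d b v"
          using logit_kernel_pos[of d b v] by (auto simp: abs_mult intro!: mult_right_mono)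
      qed
    qed
  qed
  then show ?thesis
    unfolding beta_average_exp[OF assms]
    by (intro continuous_on_mult continuous_on_exp continuous_on_const continuous_on_id)
qed

text \<open>On the logarithmic scale the average is a superposition of translates of the density by
  \<open>ln (1 + e\<^sup>v)\<close>. A translation multiplies the transform by an exponential, and these exponentials
  integrate against the kernel to a Beta value.\<close>

lemma beta_average_mellin:
  assumes "0 < b" "0 \<le> c"
  defines "q \<equiv> \<lambda>y. of_real c - \<i> * of_real y"
  shows "has_bochner_integral lborel (\<lambda>x. iexp (y * x) * of_real (beta_average c d b (exp x)))
           (Beta (of_nat d + 1 + q y) (of_real b) * (stable_mellin \<alpha> 0 0 (- q y) / of_real \<alpha>))"
proof -
  define Q where "Q = q y"
  have Q: "Re Q = c" "Re (- Q) < 1" using assms(2) by (auto simp: Q_def q_def)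
  define s where "s = (\<lambda>v::real. ln (1 + exp v))"
  define H where "H = (\<lambda>v x. complex_of_real (logit_kernel d b v) * (exp (- Q * of_real x) * of_real (f (exp (x - s v)))))"
  let ?M = "stable_mellin \<alpha> 0 0 (- Q) / of_real \<alpha>"
  have shift: "has_bochner_integral lborel (\<lambda>x. exp (p * of_real x) * of_real (f (exp (x - r))))
      (exp (p * of_real r) * (stable_mellin \<alpha> 0 0 p / of_real \<alpha>))" if "Re p < 1" for p r
  proof -
    have "has_bochner_integral lborel (\<lambda>x. exp (p * of_real (- r + x)) * of_real (f (exp (- r + x))))
        (stable_mellin \<alpha> 0 0 p / of_real \<alpha>)"
      using mellin_log_scale[OF that] 
        lborel_has_bochner_integral_real_affine_iff[of 1 "\<lambda>x. exp (p * of_real x) * of_real (f (exp x))" _ "- r"] by simp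
    then have "has_bochner_integral lborel (\<lambda>x. exp (p * of_real r) * (exp (p * of_real (- r + x)) * of_real (f (exp (- r + x)))))
        (exp (p * of_real r) * (stable_mellin \<alpha> 0 0 p / of_real \<alpha>))"
      by (rule has_bochner_integral_mult_right)
    moreover have "exp (p * of_real r) * (exp (p * of_real (- r + x)) * of_real (f (exp (- r + x)))) =
        exp (p * of_real x) * of_real (f (exp (x - r)))" for x
      unfolding mult.assoc[symmetric] mult_exp_exp by (simp add: algebra_simps)
    ultimately show ?thesis by (simp only:)
  qed
  have A: "has_bochner_integral lborel (H v) (of_real (logit_kernel d b v) * (exp (- Q * of_real (s v)) * ?M))" for v
    unfolding H_def by (intro has_bochner_integral_mult_right shift Q)
  define m where "m = Re (stable_mellin \<alpha> 0 0 (of_real (- c)) / of_real \<alpha>)"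
  have N: "has_bochner_integral lborel (\<lambda>x. norm (H v x)) (logit_kernel d b v * exp (- c * s v) * m)" for v
  proof -
    have "has_bochner_integral lborel (\<lambda>x. Re (exp (of_real (- c) * of_real x) * of_real (f (exp (x - s v)))))
      (Re (exp (of_real (- c) * of_real (s v)) * (stable_mellin \<alpha> 0 0 (of_real (- c)) / of_real \<alpha>)))"
      using assms(2) by (intro has_bochner_integral_Re shift) simp
    moreover have "Re (exp (of_real (- c) * of_real x) * of_real (f (exp (x - s v)))) = exp (- c * x) * f (exp (x - s v))" for x
      by (simp add: Re_exp)
    moreover have "Re (exp (of_real (- c) * of_real (s v)) * z) = exp (- c * s v) * Re z" for z
    proof -
      have "exp (of_real (- c) * of_real (s v)) = complex_of_real (exp (- c * s v))" by (simp flip: exp_of_real)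
      then show ?thesis by (simp only: Re_complex_of_real times_complex.sel Im_complex_of_real mult_zero_left diff_zero)
    qed
    ultimately have "has_bochner_integral lborel (\<lambda>x. exp (- c * x) * f (exp (x - s v))) (exp (- c * s v) * m)"
      by (simp only: m_def)
    from has_bochner_integral_mult_right[OF this, of "logit_kernel d b v"]
    show ?thesis
      using nonneg logit_kernel_pos[of d b v] Q by (simp add: H_def norm_mult mult.assoc less_imp_le)
  qed
  have N': "integrable lborel (\<lambda>v. logit_kernel d b v * exp (- c * s v) * m)"
    using logit_kernel_real[OF assms(1,2), of d] unfolding s_def by (auto simp: has_bochner_integral_iff)
  have B: "has_bochner_integral lborel (\<lambda>v. H v x) (iexp (y * x) * of_real (beta_average c d b (exp x)))" for x
  proof -
    have "has_bochner_integral lborel (\<lambda>v. complex_of_real (f (exp x / (1 + exp v)) * logit_kernel d b v))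
       (of_real (LBINT v. f (exp x / (1 + exp v)) * logit_kernel d b v))"
      by (intro has_bochner_integral_of_real has_bochner_integral_integrable average_integrable assms(1))
    from has_bochner_integral_mult_right[OF this, of "exp (- Q * of_real x)"]
    have "has_bochner_integral lborel (\<lambda>v. H v x)
       (exp (- Q * of_real x) * of_real (LBINT v. f (exp x / (1 + exp v)) * logit_kernel d b v))"
      unfolding H_def s_def exp_div_logistic by (simp add: mult_ac)
    moreover have "exp (- Q * of_real x) = iexp (y * x) * of_real (exp (- c * x))"
      unfolding exp_of_real[symmetric] mult_exp_exp by (simp add: Q_def q_def algebra_simps)
    ultimately show ?thesis
      unfolding beta_average_exp[OF assms(1)] by (simp add: mult.assoc)
  qed
  have "case_prod H \<in> borel_measurable (lborel \<Otimes>\<^sub>M lborel)"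
    unfolding H_def s_def by measurable
  note sw = has_bochner_integral_swap[OF this A N N' B]
  have "has_bochner_integral lborel (\<lambda>v. of_real (logit_kernel d b v) * exp (- Q * of_real (s v)) * ?M)
     (Beta (of_nat d + 1 + Q) (of_real b) * ?M)"
    unfolding s_def using Q assms by (intro has_bochner_integral_mult_left logit_kernel_beta) auto
  then have "(LBINT v. of_real (logit_kernel d b v) * (exp (- Q * of_real (s v)) * ?M)) =
      Beta (of_nat d + 1 + Q) (of_real b) * ?M"
    by (simp only: has_bochner_integral_iff mult.assoc)
  from trans[OF sw(3)[symmetric] this] sw(2) show ?thesis
    unfolding Q_def[symmetric] has_bochner_integral_iff by (intro conjI)
qed

text \<open>With \<open>q = k\<alpha> - s\<close> the Beta value is \<open>\<Gamma>(1 + q) \<Gamma>(b) / \<Gamma>(n + 1 - s)\<close>, and its first factor cancels the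
  denominator \<open>\<Gamma>(1 + q)\<close> in the Mellin transform of the stable density.\<close>

lemma beta_average_0_eq:
  assumes "1 \<le> k" "k \<le> n" "0 < t"
  defines "b \<equiv> real n - real k * \<alpha>"
  shows "of_real (beta_average (real k * \<alpha>) 0 b t) = of_real (Gamma b / \<alpha>) / (2 * of_real pi) *
     (LBINT y. iexp (- (y * ln t)) * stable_mellin \<alpha> k n (\<i> * of_real y))"
proof -
  have "real k * \<alpha> < real k * 1" using assms alpha by (intro mult_strict_left_mono) auto
  then have b: "0 < b" using assms(2) by (simp add: b_def)
  have eq: "Beta (of_nat 0 + 1 + q) (of_real b) * (stable_mellin \<alpha> 0 0 (- q) / of_real \<alpha>) =
      of_real (Gamma b / \<alpha>) * stable_mellin \<alpha> k n (\<i> * of_real y)"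
    if q: "q = of_real (real k * \<alpha>) - \<i> * of_real y" for q y
  proof -
    have "0 < Re (1 + q)" using alpha q by (simp add: add_pos_nonneg)
    then have 1: "Gamma (1 + q) * rGamma (1 + q) = 1"
      using Gamma_neq_zero_if_Re_pos by (simp add: rGamma_inverse_Gamma)
    have 2: "1 + q + of_real b = of_nat n + 1 - \<i> * of_real y"
      by (simp add: q b_def)
    have 3: "(1 + q) / of_real \<alpha> = of_nat k + (1 - \<i> * of_real y) / of_real \<alpha>"
      using alpha by (simp add: q field_simps)
    have 4: "of_nat 0 + 1 + q = 1 + q" "of_nat 0 + (1 - - q) / of_real \<alpha> = (1 + q) / of_real \<alpha>"
      "of_nat 0 + 1 - - q = 1 + q" by simp_all
    have "X * G * N * (K * r / a) = (X * r) * (G / a * (K * N))" for X G N K r a :: complex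
      by (simp add: divide_inverse mult_ac)
    then show ?thesis
      unfolding Beta_altdef stable_mellin_def 4 2 3 by (simp only: 1) (simp add: Gamma_complex_of_real)
  qed
  have "of_real (beta_average (real k * \<alpha>) 0 b (exp (ln t))) = of_real (Gamma b / \<alpha>) / (2 * of_real pi) *
     (LBINT y. iexp (- (y * ln t)) * stable_mellin \<alpha> k n (\<i> * of_real y))"
  proof (rule mellin_inversion)
    show "has_bochner_integral lborel (\<lambda>x. iexp (y * x) * of_real (beta_average (real k * \<alpha>) 0 b (exp x)))
       (of_real (Gamma b / \<alpha>) * stable_mellin \<alpha> k n (\<i> * of_real y))" for y
      using beta_average_mellin[OF b, of "real k * \<alpha>" y 0] alpha unfolding eq[OF refl] by simp
    have "Gamma b \<noteq> 0" by (rule less_imp_neq[OF Gamma_real_pos[OF b], symmetric])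
    then have "Gamma b / \<alpha> \<noteq> 0" using alpha by simp
    then show "complex_of_real (Gamma b / \<alpha>) \<noteq> 0" by (simp only: of_real_eq_0_iff) simp
  qed (use b assms(2) in \<open>auto intro: beta_average_continuous_log beta_average_nonneg\<close>)
  then show ?thesis using assms(3) by simp
qed

text \<open>With \<open>q = (k - 1)\<alpha> - s\<close> the Beta value is \<open>\<Gamma>(2 + q) \<Gamma>(b) / \<Gamma>(n + 1 - s)\<close>. Compared with the case
  \<open>d = 0\<close> a factor \<open>1 + q\<close> is left over, and it raises the argument of \<open>\<Gamma>((1 + q)/\<alpha>)\<close> by one. So the
  same transform arises, and the two averages are proportional.\<close>

lemma beta_average_1_eq:
  assumes "1 \<le> k" "k \<le> n" "0 < t"
  defines "b \<equiv> real n - 1 - (real k - 1) * \<alpha>"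
  assumes b: "0 < b"
  shows "of_real (beta_average ((real k - 1) * \<alpha>) 1 b t) = of_real (Gamma b) / (2 * of_real pi) *
     (LBINT y. iexp (- (y * ln t)) * stable_mellin \<alpha> k n (\<i> * of_real y))"
proof -
  have eq: "Beta (of_nat 1 + 1 + q) (of_real b) * (stable_mellin \<alpha> 0 0 (- q) / of_real \<alpha>) =
      of_real (Gamma b) * stable_mellin \<alpha> k n (\<i> * of_real y)"
    if q: "q = of_real ((real k - 1) * \<alpha>) - \<i> * of_real y" for q y
  proof -
    have "0 \<le> (real k - 1) * \<alpha>" using alpha assms(1) by simp
    then have pos: "0 < Re (1 + q)" using q by simp
    have 1: "Gamma (1 + q) * rGamma (1 + q) = 1"
      using Gamma_neq_zero_if_Re_pos[OF pos] by (simp add: rGamma_inverse_Gamma)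
    have plus1: "Gamma (z + 1) = z * Gamma z" if "0 < Re z" for z :: complex
      using Gamma_neq_zero_if_Re_pos[OF that] by (intro Gamma_plus1) (auto simp: Gamma_eq_zero_iff)
    have 2: "of_nat k + (1 - \<i> * of_real y) / of_real \<alpha> = (1 + q) / of_real \<alpha> + 1"
      using alpha by (simp add: q field_simps)
    have 3: "(1 + q) + 1 + of_real b = of_nat n + 1 - \<i> * of_real y"
      by (simp add: q b_def algebra_simps)
    have 4: "of_nat 1 + 1 + q = (1 + q) + 1" "of_nat 0 + (1 - - q) / of_real \<alpha> = (1 + q) / of_real \<alpha>"
      "of_nat 0 + 1 - - q = 1 + q" by simp_all
    have 5: "Gamma ((1 + q) + 1) = (1 + q) * Gamma (1 + q)"
      "Gamma ((1 + q) / of_real \<alpha> + 1) = (1 + q) / of_real \<alpha> * Gamma ((1 + q) / of_real \<alpha>)"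
      by (rule plus1, use pos alpha in simp)+
    have "((p * X) * G * N) * (K * r / a) = (X * r) * (G * ((p / a * K) * N))" for p X G N K r a :: complex
      by (simp add: divide_inverse mult_ac)
    then show ?thesis
      unfolding Beta_altdef stable_mellin_def 3 2 4 5 by (simp only: 1) (simp add: Gamma_complex_of_real)
  qed
  have c: "0 \<le> (real k - 1) * \<alpha>" using alpha assms(1) by simp
  have "of_real (beta_average ((real k - 1) * \<alpha>) 1 b (exp (ln t))) = of_real (Gamma b) / (2 * of_real pi) *
     (LBINT y. iexp (- (y * ln t)) * stable_mellin \<alpha> k n (\<i> * of_real y))"
  proof (rule mellin_inversion)
    show "has_bochner_integral lborel (\<lambda>x. iexp (y * x) * of_real (beta_average ((real k - 1) * \<alpha>) 1 b (exp x)))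
       (of_real (Gamma b) * stable_mellin \<alpha> k n (\<i> * of_real y))" for y
      using beta_average_mellin[OF b c, of y 1] unfolding eq[OF refl] by simp
    have "Gamma b \<noteq> 0" by (rule less_imp_neq[OF Gamma_real_pos[OF b], symmetric])
    then show "complex_of_real (Gamma b) \<noteq> 0" by (simp only: of_real_eq_0_iff) simp
  qed (use b assms(2) in \<open>auto intro: beta_average_continuous_log beta_average_nonneg\<close>)
  then show ?thesis using assms(3) by simp
qed

text \<open>For \<open>n = k = 1\<close> the second beta variable is constant and the second quotient is distributed like
  $S_\alpha$. The transforms for the indices \<open>0, 0\<close> and \<open>1, 1\<close> agree up to \<open>\<alpha>\<close> because both Gamma factors
  gain the factor \<open>1 - s\<close>.\<close>

lemma density_eq_mellin_inversion_1:
  assumes "0 < t"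
  shows "of_real (f t) = 1 / (2 * of_real pi) *
     (LBINT y. iexp (- (y * ln t)) * stable_mellin \<alpha> 1 1 (\<i> * of_real y))"
proof -
  have eq: "stable_mellin \<alpha> 1 1 s = stable_mellin \<alpha> 0 0 s / of_real \<alpha>" if "Re s < 1" for s
  proof -
    have p: "0 < Re (1 - s)" "0 < Re ((1 - s) / of_real \<alpha>)" using that alpha by auto
    have "Gamma ((1 - s) / of_real \<alpha> + 1) = (1 - s) / of_real \<alpha> * Gamma ((1 - s) / of_real \<alpha>)"
      using Gamma_neq_zero_if_Re_pos[OF p(2)] by (intro Gamma_plus1) (auto simp: Gamma_eq_zero_iff)
    moreover have "rGamma (1 - s) = (1 - s) * rGamma (1 + (1 - s))"
      using rGamma_plus1[of "1 - s"] by (simp add: add.commute)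
    ultimately show ?thesis
      by (simp add: stable_mellin_def add_ac add_diff_eq[symmetric])
  qed
  have eq': "stable_mellin \<alpha> 1 1 (\<i> * of_real y) = stable_mellin \<alpha> 0 0 (\<i> * of_real y) / of_real \<alpha>"
    for y by (rule eq) simp
  have "of_real (f (exp (ln t))) = 1 / (2 * of_real pi) *
     (LBINT y. iexp (- (y * ln t)) * stable_mellin \<alpha> 1 1 (\<i> * of_real y))"
    unfolding density_eq_mellin_inversion eq' by simp
  then show ?thesis using assms by simp
qed
end

section \<open>Densities of the quotients\<close>

context stable_density
begin

lemma beta_average_has_integral:
  assumes "0 < b" "0 < t"
  shows "((\<lambda>u. f (t * u) * (1 - u) powr (b - 1)) has_integral (t powr c * beta_average c 0 b t)) {0..1}"
proof -
  have "(\<lambda>u. f (t * u) * (1 - u) powr (b - 1)) integrable_on {0<..<1}"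
    using beta_average_integrand(1)[OF assms, of 0] by (simp add: set_lebesgue_integral_eq_integral(1))
  then have "(\<lambda>u. f (t * u) * (1 - u) powr (b - 1)) integrable_on {0..1}"
    unfolding integrable_on_def has_integral_Icc_iff_Ioo .
  moreover have "t powr c * beta_average c 0 b t = integral {0..1} (\<lambda>u. f (t * u) * (1 - u) powr (b - 1))"
    using assms by (simp add: beta_average_def powr_minus field_simps)
  ultimately show ?thesis by (simp add: has_integral_integrable_integral)
qed

text \<open>The substitution \<open>v = t (1 - u)\<close>.\<close>

lemma stable_G_eq:
  assumes "1 \<le> k" "k \<le> n" "0 < t"
  defines "b \<equiv> real n - real k * \<alpha>"
  shows "stable_G \<alpha> f n k t = \<alpha> ^ k * t powr (- (real k * \<alpha>)) / (Gamma b * f t) *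
           integral {0..1} (\<lambda>u. f (t * u) * (1 - u) powr (b - 1))"
    and "stable_G \<alpha> f n k t = \<alpha> ^ k / (Gamma b * f t) * beta_average (real k * \<alpha>) 0 b t"
    and "0 < b"
proof -
  have "real k * \<alpha> < real k * 1" using assms alpha by (intro mult_strict_left_mono) auto
  then show b: "0 < b" using assms(2) by (simp add: b_def)
  let ?F = "\<lambda>u. f (t * u) * (1 - u) powr (b - 1)"
  define I where "I = integral {0..1} ?F"
  have I: "(?F has_integral I) {0..1}"
    using beta_average_has_integral[OF b assms(3)] I_def by (simp add: has_integral_integrable_integral)
  have "((\<lambda>v. ?F ((- (1 / t)) *\<^sub>R v + 1)) has_integral (1 / \<bar>- (1 / t)\<bar> ^ DIM(real)) *\<^sub>R I)
      ((\<lambda>u. (1 / (- (1 / t))) *\<^sub>R u + - ((1 / (- (1 / t))) *\<^sub>R 1)) ` cbox 0 1)"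
    by (rule has_integral_affinity) (use I assms in auto)
  moreover have "(\<lambda>u. (1 / (- (1 / t))) *\<^sub>R u + - ((1 / (- (1 / t))) *\<^sub>R 1)) ` cbox 0 1 = {0..t}"
    using assms(3) by (subst image_affinity_cbox) (auto simp: max_def min_def)
  ultimately have "((\<lambda>v. ?F (- (v / t) + 1)) has_integral t * I) {0..t}"
    using assms(3) by simp
  then have "((\<lambda>v. t powr (b - 1) * ?F (- (v / t) + 1)) has_integral t powr (b - 1) * (t * I)) {0..t}"
    by (rule has_integral_mult_right)
  moreover have "t powr (b - 1) * ?F (- (v / t) + 1) = f (t - v) * v powr (b - 1)" if "v \<in> {0..t}" for v
  proof -
    have "t * (- (v / t) + 1) = t - v" using assms(3) by (simp add: field_simps)
    moreover have "t powr (b - 1) * (v / t) powr (b - 1) = v powr (b - 1)"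
      using assms(3) that by (simp add: powr_divide)
    ultimately show ?thesis by (simp add: mult_ac)
  qed
  ultimately have "((\<lambda>v. f (t - v) * v powr (b - 1)) has_integral t powr (b - 1) * (t * I)) {0..t}"
    by (subst (asm) has_integral_cong) auto
  then have J: "integral {0..t} (\<lambda>v. f (t - v) * v powr (b - 1)) = t powr (b - 1) * (t * I)"
    by (rule integral_unique)
  have "t powr (b - 1) * t = t ^ n * t powr (- (real k * \<alpha>))"
  proof -
    have "t powr (b - 1) * t = t powr (b - 1) * t powr 1" using assms(3) by simp
    also have "\<dots> = t powr (real n + - (real k * \<alpha>))" unfolding powr_add[symmetric] by (simp add: b_def)
    also have "\<dots> = t ^ n * t powr (- (real k * \<alpha>))" unfolding powr_add using assms(3) by (simp add: powr_realpow)
    finally show ?thesis .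
  qed
  then have E: "t powr (b - 1) * (t * I) = t ^ n * (t powr (- (real k * \<alpha>)) * I)"
    by (simp only: mult.assoc[symmetric])
  then show 1: "stable_G \<alpha> f n k t = \<alpha> ^ k * t powr (- (real k * \<alpha>)) / (Gamma b * f t) * I"
    unfolding stable_G_def b_def[symmetric] J E using assms(3) by simp
  show "stable_G \<alpha> f n k t = \<alpha> ^ k / (Gamma b * f t) * beta_average (real k * \<alpha>) 0 b t"
    unfolding 1 beta_average_def I_def by simp
qed

end

lemma has_pdf_on_cong:
  "(\<And>t. t \<in> A \<Longrightarrow> g t = g' t) \<Longrightarrow> has_pdf_on \<Omega> X A g \<longleftrightarrow> has_pdf_on \<Omega> X A g'"
proof -
  assume "\<And>t. t \<in> A \<Longrightarrow> g t = g' t"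
  then have "(\<lambda>t. ennreal (indicator A t * g t)) = (\<lambda>t. ennreal (indicator A t * g' t))" "\<forall>t\<in>A. g t = g' t"
    by (auto split: split_indicator)
  then show ?thesis unfolding has_pdf_on_def by simp
qed

lemma has_pdf_on_distr:
  "has_pdf_on \<Omega> X A g \<Longrightarrow> distr \<Omega> borel X = density lborel (\<lambda>t. ennreal (indicator A t * g t))"
  unfolding has_pdf_on_def distributed_def by (metis distr_cong sets_lborel)

text \<open>For a fixed value \<open>u\<close> of \<open>B\<close> the substitution \<open>x = u z\<close> replaces \<open>x / u\<close> by \<open>z\<close> and produces the factor \<open>u\<close>.
  Exchanging the two integrals then exposes the density in \<open>z\<close>.\<close>

lemma has_pdf_on_quotient:
  assumes X: "has_pdf_on \<Omega> X {0<..} g" and B: "has_pdf_on \<Omega> B {0<..<1} h"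
    and ind: "prob_space.indep_var \<Omega> borel X borel B"
    and p: "continuous_on {0<..} p"
    and int: "\<And>z. 0 < z \<Longrightarrow> (\<lambda>u. u * g (z * u) * h u) absolutely_integrable_on {0<..<1}"
    and eq: "\<And>z. 0 < z \<Longrightarrow> integral {0<..<1} (\<lambda>u. u * g (z * u) * h u) = p z"
  shows "has_pdf_on \<Omega> (\<lambda>\<omega>. X \<omega> / B \<omega>) {0<..} p"
proof -
  interpret prob_space \<Omega> using X by (simp add: has_pdf_on_def)
  define G H where "G = (\<lambda>t. indicator {0<..} t * g t)" and "H = (\<lambda>t. indicator {0<..<1} t * h t)"
  have dX: "distributed \<Omega> lborel X (\<lambda>t. ennreal (G t))" and dB: "distributed \<Omega> lborel B (\<lambda>t. ennreal (H t))"
    and G0: "\<And>t. 0 \<le> G t" and H0: "\<And>t. 0 \<le> H t"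
    using X B by (auto simp: has_pdf_on_def G_def H_def split: split_indicator)
  have [measurable]: "G \<in> borel_measurable borel" "H \<in> borel_measurable borel"
    using distributed_real_measurable[OF _ dX] distributed_real_measurable[OF _ dB] G0 H0 by auto
  have [measurable]: "X \<in> borel_measurable \<Omega>" "B \<in> borel_measurable \<Omega>"
    using distributed_measurable[OF dX] distributed_measurable[OF dB] by auto
  have pm: "(\<lambda>t. indicator {0<..} t * p t) \<in> borel_measurable borel"
    using borel_measurable_continuous_on_indicator[OF _ p] by simp
  have p0: "0 \<le> p z" if "0 < z" for z
    unfolding eq[OF that, symmetric]
  proof (rule integral_nonneg)
    show "(\<lambda>u. u * g (z * u) * h u) integrable_on {0<..<1}"
      by (rule set_lebesgue_integral_eq_integral(1)[OF int[OF that]])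
    show "0 \<le> u * g (z * u) * h u" if "u \<in> {0<..<1}" for u
      using X B that \<open>0 < z\<close> by (auto simp: has_pdf_on_def intro!: mult_nonneg_nonneg)
  qed
  have "indep_var lborel X lborel B"
    using indep_var_compose[OF ind, of "\<lambda>x. x" lborel "\<lambda>x. x" lborel] by (simp add: o_def)
  then have joint: "distributed \<Omega> (lborel \<Otimes>\<^sub>M lborel) (\<lambda>\<omega>. (X \<omega>, B \<omega>)) (\<lambda>(x, y). ennreal (G x) * ennreal (H y))"
    by (intro distributed_joint_indep dX dB) (auto intro: lborel.sigma_finite_measure_axioms)
  have inner: "(\<integral>\<^sup>+u. ennreal (H u) * (ennreal \<bar>u\<bar> * ennreal (G (u * z))) \<partial>lborel) = ennreal (indicator {0<..} z * p z)" for z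
  proof (cases "0 < z")
    case True
    have pw: "ennreal (H u) * (ennreal \<bar>u\<bar> * ennreal (G (u * z))) =
        ennreal (indicator {0<..<1} u * (u * g (z * u) * h u))" for u
    proof -
      have "ennreal (H u) * (ennreal \<bar>u\<bar> * ennreal (G (u * z))) = ennreal (H u * (\<bar>u\<bar> * G (u * z)))"
        using H0[of u] G0[of "u * z"] by (simp add: ennreal_mult)
      also have "H u * (\<bar>u\<bar> * G (u * z)) = indicator {0<..<1} u * (u * g (z * u) * h u)"
        using True by (auto simp: H_def G_def mult_ac split: split_indicator)
      finally show ?thesis .
    qed
    have m: "(\<lambda>u. indicator {0<..<1} u * (u * g (z * u) * h u)) \<in> borel_measurable borel"
    proof -
      have "(\<lambda>u. H u * (u * G (z * u))) \<in> borel_measurable borel" by measurable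
      moreover have "H u * (u * G (z * u)) = indicator {0<..<1} u * (u * g (z * u) * h u)" for u
        using True by (auto simp: H_def G_def split: split_indicator)
      ultimately show ?thesis by simp
    qed
    have i: "set_integrable lborel {0<..<1} (\<lambda>u. u * g (z * u) * h u)"
      using int[OF True] m integrable_completion[of "\<lambda>u. indicator {0<..<1} u * (u * g (z * u) * h u)" lborel]
      by (simp add: set_integrable_def)
    have "0 \<le> u * g (z * u) * h u" if "u \<in> {0<..<1}" for u
      using X B that True by (auto simp: has_pdf_on_def)
    then have "(\<integral>\<^sup>+u. ennreal (indicator {0<..<1} u * (u * g (z * u) * h u)) \<partial>lborel) =
        ennreal (LBINT u. indicator {0<..<1} u * (u * g (z * u) * h u))"
      using i by (intro nn_integral_eq_integral) (auto simp: set_integrable_def split: split_indicator)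
    also have "(LBINT u. indicator {0<..<1} u * (u * g (z * u) * h u)) = p z"
      using set_borel_integral_eq_integral(2)[OF i] eq[OF True] by (simp add: set_lebesgue_integral_def)
    finally show ?thesis unfolding pw using True by simp
  next
    case False
    then have "ennreal (H u) * (ennreal \<bar>u\<bar> * ennreal (G (u * z))) = 0" for u
      by (auto simp: H_def G_def zero_less_mult_iff split: split_indicator)
    then show ?thesis using False by (simp only:) simp
  qed
  have "distr \<Omega> lborel (\<lambda>\<omega>. X \<omega> / B \<omega>) = density lborel (\<lambda>t. ennreal (indicator {0<..} t * p t))"
  proof (rule measure_eqI)
    fix A assume "A \<in> sets (distr \<Omega> lborel (\<lambda>\<omega>. X \<omega> / B \<omega>))"
    then have [measurable]: "A \<in> sets borel" by simp
    have "emeasure (distr \<Omega> lborel (\<lambda>\<omega>. X \<omega> / B \<omega>)) A = (\<integral>\<^sup>+\<omega>. indicator A (X \<omega> / B \<omega>) \<partial>\<Omega>)"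
      by (subst nn_integral_indicator[symmetric], simp, subst nn_integral_distr) auto
    also have "\<dots> = (\<integral>\<^sup>+\<omega>. (\<lambda>(x, y). indicator A (x / y)) (X \<omega>, B \<omega>) \<partial>\<Omega>)" by simp
    also have "\<dots> = (\<integral>\<^sup>+z. (\<lambda>(x, y). ennreal (G x) * ennreal (H y)) z * (\<lambda>(x, y). indicator A (x / y)) z \<partial>(lborel \<Otimes>\<^sub>M lborel))"
      by (subst distributed_nn_integral[OF joint]) auto
    also have "\<dots> = (\<integral>\<^sup>+u. (\<integral>\<^sup>+x. ennreal (G x) * ennreal (H u) * indicator A (x / u) \<partial>lborel) \<partial>lborel)"
      by (subst lborel_pair.nn_integral_snd[symmetric]) (auto simp: split_beta')
    also have "\<dots> = (\<integral>\<^sup>+u. (\<integral>\<^sup>+z. ennreal (H u) * (ennreal \<bar>u\<bar> * ennreal (G (u * z))) * indicator A z \<partial>lborel) \<partial>lborel)"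
    proof (rule nn_integral_cong)
      fix u :: real
      show "(\<integral>\<^sup>+x. ennreal (G x) * ennreal (H u) * indicator A (x / u) \<partial>lborel) =
          (\<integral>\<^sup>+z. ennreal (H u) * (ennreal \<bar>u\<bar> * ennreal (G (u * z))) * indicator A z \<partial>lborel)"
      proof (cases "u = 0")
        case True
        then show ?thesis by (simp add: H_def)
      next
        case False
        have "(\<integral>\<^sup>+x. ennreal (G x) * ennreal (H u) * indicator A (x / u) \<partial>lborel) =
            ennreal \<bar>u\<bar> * (\<integral>\<^sup>+z. ennreal (G (0 + u * z)) * ennreal (H u) * indicator A ((0 + u * z) / u) \<partial>lborel)"
          using False by (intro nn_integral_real_affine) auto
        also have "\<dots> = (\<integral>\<^sup>+z. ennreal \<bar>u\<bar> * (ennreal (G (0 + u * z)) * ennreal (H u) * indicator A ((0 + u * z) / u)) \<partial>lborel)"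
          by (rule nn_integral_cmult[symmetric]) measurable
        finally show ?thesis using False by (simp add: mult_ac)
      qed
    qed
    also have "\<dots> = (\<integral>\<^sup>+z. (\<integral>\<^sup>+u. ennreal (H u) * (ennreal \<bar>u\<bar> * ennreal (G (u * z))) * indicator A z \<partial>lborel) \<partial>lborel)"
      by (rule lborel_pair.Fubini') measurable
    also have "\<dots> = (\<integral>\<^sup>+z. ennreal (indicator {0<..} z * p z) * indicator A z \<partial>lborel)"
      by (subst nn_integral_multc) (auto simp: inner)
    also have "\<dots> = emeasure (density lborel (\<lambda>t. ennreal (indicator {0<..} t * p t))) A"
      using pm by (subst emeasure_density) auto
    finally show "emeasure (distr \<Omega> lborel (\<lambda>\<omega>. X \<omega> / B \<omega>)) A =
        emeasure (density lborel (\<lambda>t. ennreal (indicator {0<..} t * p t))) A" .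
  qed simp
  then show ?thesis
    using p0 pm prob_space_axioms by (auto simp: has_pdf_on_def distributed_def)
qed

context stable_density
begin

text \<open>The factor \<open>u\<close>, the power \<open>- c\<close> of \<open>z u\<close> from the tilting and the power \<open>c + d - 1\<close> of \<open>u\<close> from the beta
  density combine to \<open>u\<^sup>d\<close> times the power \<open>- c\<close> of \<open>z\<close>.\<close>

lemma tilted_quotient_density:
  fixes d :: nat
  assumes X: "has_pdf_on \<Omega> X {0<..} (\<lambda>t. A * t powr (- c) * f t)"
    and B: "beta_rv (c + real d) b \<Omega> B" and b: "0 < b"
    and ind: "prob_space.indep_var \<Omega> borel X borel B"
  shows "has_pdf_on \<Omega> (\<lambda>\<omega>. X \<omega> / B \<omega>) {0<..} (\<lambda>t. A / Beta (c + real d) b * beta_average c d b t)"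
proof (rule has_pdf_on_quotient[OF X _ ind])
  show "has_pdf_on \<Omega> B {0<..<1} (\<lambda>t. t powr (c + real d - 1) * (1 - t) powr (b - 1) / Beta (c + real d) b)"
    using B b by (simp add: beta_rv_def)
  have "continuous_on {0<..} ((\<lambda>x. beta_average c d b (exp x)) \<circ> ln)"
    by (intro continuous_on_compose continuous_on_subset[OF beta_average_continuous_log[OF b]])
       (auto intro!: continuous_intros)
  then have "continuous_on {0<..} (beta_average c d b)"
    by (rule continuous_on_eq) auto
  then show "continuous_on {0<..} (\<lambda>t. A / Beta (c + real d) b * beta_average c d b t)"
    by (intro continuous_intros)
  fix z :: real assume z: "0 < z"
  let ?K = "A / Beta (c + real d) b * z powr (- c)"
  have e: "u * (A * (z * u) powr (- c) * f (z * u)) * (u powr (c + real d - 1) * (1 - u) powr (b - 1) / Beta (c + real d) b) =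
      ?K * (u ^ d * f (z * u) * (1 - u) powr (b - 1))" if "u \<in> {0<..<1}" for u
  proof -
    have "u * ((z * u) powr (- c) * u powr (c + real d - 1)) = u powr 1 * (u powr (- c) * u powr (c + real d - 1)) * z powr (- c)"
      using z that by (simp add: powr_mult)
    also have "u powr 1 * (u powr (- c) * u powr (c + real d - 1)) = u powr (real d)"
      unfolding powr_add[symmetric] by simp
    also have "\<dots> = u ^ d" using that by (simp add: powr_realpow)
    finally have "u * ((z * u) powr (- c) * u powr (c + real d - 1)) = u ^ d * z powr (- c)" .
    then have "A * f (z * u) * (1 - u) powr (b - 1) / Beta (c + real d) b * (u * ((z * u) powr (- c) * u powr (c + real d - 1))) =
      A * f (z * u) * (1 - u) powr (b - 1) / Beta (c + real d) b * (u ^ d * z powr (- c))" by simp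
    then show ?thesis by (simp add: mult_ac)
  qed
  have "(\<lambda>u. ?K * (u ^ d * f (z * u) * (1 - u) powr (b - 1))) absolutely_integrable_on {0<..<1}"
    using beta_average_integrand(1)[OF b z] by (rule set_integrable_mult_right)
  then show "(\<lambda>u. u * (A * (z * u) powr (- c) * f (z * u)) * (u powr (c + real d - 1) * (1 - u) powr (b - 1) / Beta (c + real d) b))
      absolutely_integrable_on {0<..<1}"
    by (subst set_integrable_cong[OF refl refl e]) auto
  have "integral {0<..<1} (\<lambda>u. u * (A * (z * u) powr (- c) * f (z * u)) * (u powr (c + real d - 1) * (1 - u) powr (b - 1) / Beta (c + real d) b)) =
     integral {0<..<1} (\<lambda>u. ?K * (u ^ d * f (z * u) * (1 - u) powr (b - 1)))"
    using e by (rule Henstock_Kurzweil_Integration.integral_cong)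
  also have "\<dots> = ?K * integral {0<..<1} (\<lambda>u. u ^ d * f (z * u) * (1 - u) powr (b - 1))" by simp
  also have "\<dots> = A / Beta (c + real d) b * beta_average c d b z"
    by (simp add: beta_average_def integral_open_interval_real)
  finally show "integral {0<..<1} (\<lambda>u. u * (A * (z * u) powr (- c) * f (z * u)) * (u powr (c + real d - 1) * (1 - u) powr (b - 1) / Beta (c + real d) b)) =
     A / Beta (c + real d) b * beta_average c d b z" .
qed

text \<open>The normalised average that turns out to be the density of both quotients.\<close>

definition mixture_density :: "nat \<Rightarrow> nat \<Rightarrow> real \<Rightarrow> real" where
  "mixture_density n k t = \<alpha> * Gamma (real n) / (Gamma (real k) * Gamma (real n - real k * \<alpha>)) *
     beta_average (real k * \<alpha>) 0 (real n - real k * \<alpha>) t"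

lemma mixture_density_eq:
  assumes "1 \<le> k" "k \<le> n" "0 < t"
  shows "of_real (mixture_density n k t) = of_real (Gamma (real n) / Gamma (real k)) * (1 / (2 * of_real pi) *
     (LBINT y. iexp (- (y * ln t)) * stable_mellin \<alpha> k n (\<i> * of_real y)))"
proof -
  have "Gamma (real n - real k * \<alpha>) \<noteq> 0"
    by (rule less_imp_neq[OF Gamma_real_pos, symmetric]) (rule stable_G_eq(3)[OF assms])
  then show ?thesis
    unfolding mixture_density_def of_real_mult beta_average_0_eq[OF assms] using alpha by simp
qed

lemma continuous_mixture_density:
  assumes "1 \<le> k" "k \<le> n"
  shows "continuous_on {0<..} (mixture_density n k)"
proof -
  have b: "0 < real n - real k * \<alpha>" by (rule stable_G_eq(3)[OF assms, of 1]) simp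
  have "continuous_on {0<..} ((\<lambda>x. beta_average (real k * \<alpha>) 0 (real n - real k * \<alpha>) (exp x)) \<circ> ln)"
    by (intro continuous_on_compose continuous_on_subset[OF beta_average_continuous_log[OF b]])
       (auto intro!: continuous_intros)
  then have "continuous_on {0<..} (beta_average (real k * \<alpha>) 0 (real n - real k * \<alpha>))"
    by (rule continuous_on_eq) auto
  then show ?thesis unfolding mixture_density_def[abs_def] by (intro continuous_intros)
qed

lemma stable_G_mixture_density:
  assumes "1 \<le> k" "k \<le> n" "0 < t"
  shows "stable_G \<alpha> f n k t = \<alpha> ^ (k - 1) * Gamma (real k) / Gamma (real n) * (mixture_density n k t / f t)"
proof -
  have nz: "Gamma (real n) \<noteq> 0" "Gamma (real k) \<noteq> 0"
    using assms by (auto intro!: less_imp_neq[OF Gamma_real_pos, symmetric])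
  have "\<alpha> ^ k = \<alpha> * \<alpha> ^ (k - 1)" using assms(1) by (simp flip: power_Suc)
  then show ?thesis
    unfolding stable_G_eq(2)[OF assms] mixture_density_def using nz by simp
qed

lemma quotient_density:
  assumes "1 \<le> k" "k \<le> n"
    and X: "tilted_stable_rv \<alpha> (real k * \<alpha>) f \<Omega> X"
    and B: "beta_rv (real k * \<alpha>) (real n - real k * \<alpha>) \<Omega> B"
    and ind: "prob_space.indep_var \<Omega> borel X borel B"
  shows "has_pdf_on \<Omega> (\<lambda>\<omega>. X \<omega> / B \<omega>) {0<..} (mixture_density n k)"
proof -
  define c b where "c = real k * \<alpha>" and "b = real n - real k * \<alpha>"
  have b: "0 < b" unfolding b_def by (rule stable_G_eq(3)[OF assms(1,2), of 1]) simp
  have c: "0 < c" using assms alpha by (simp add: c_def)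
  have "has_pdf_on \<Omega> (\<lambda>\<omega>. X \<omega> / B \<omega>) {0<..}
     (\<lambda>t. Gamma (c + 1) / Gamma (c / \<alpha> + 1) / Beta (c + real 0) b * beta_average c 0 b t)"
    by (rule tilted_quotient_density[OF _ _ b ind])
       (use X B in \<open>simp_all add: tilted_stable_rv_def c_def b_def\<close>)
  also have "(\<lambda>t. Gamma (c + 1) / Gamma (c / \<alpha> + 1) / Beta (c + real 0) b * beta_average c 0 b t) = mixture_density n k"
  proof -
    have "x \<notin> \<int>\<^sub>\<le>\<^sub>0" if "0 < x" for x :: real
      using that nonpos_Ints_nonpos by force
    then have G: "Gamma (c + 1) = real k * \<alpha> * Gamma c" "Gamma (real k + 1) = real k * Gamma (real k)"
      using c assms(1) by (auto intro!: Gamma_plus1 simp: c_def)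
    have e: "c / \<alpha> + 1 = real k + 1" "c + real 0 + b = real n" using alpha by (simp_all add: b_def c_def)
    have pos: "0 < Gamma c" "0 < Gamma b" "0 < Gamma (real k)" "0 < Gamma (real n)" "0 < real k"
      using b c assms by auto
    have "(m * a * u) / (m * v) / (u * w / x) = a * x / (v * w)"
      if "0 < m" "0 < u" "0 < v" "0 < w" "0 < x" for a m u v w x :: real
      using that by (simp add: field_simps)
    from this[OF pos(5,1,3,2,4)]
    have "Gamma (c + 1) / Gamma (c / \<alpha> + 1) / Beta (c + real 0) b = \<alpha> * Gamma (real n) / (Gamma (real k) * Gamma b)"
      unfolding Beta_def e G by simp
    then show ?thesis by (simp add: mixture_density_def[abs_def] b_def c_def)
  qed
  finally show ?thesis .
qed

text \<open>The average with \<open>d = 1\<close> is identified with the one with \<open>d = 0\<close> through their common Mellin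
  transform. Only for \<open>n = 1\<close> the second parameter of the beta law is \<open>0\<close>; the quotient is then \<open>X\<close>
  itself up to a null set.\<close>

lemma quotient_density_shifted:
  assumes "1 \<le> k" "k \<le> n"
    and X: "tilted_stable_rv \<alpha> ((real k - 1) * \<alpha>) f \<Omega> X"
    and B: "beta_rv ((real k - 1) * \<alpha> + 1) (real n - 1 - (real k - 1) * \<alpha>) \<Omega> B"
    and ind: "prob_space.indep_var \<Omega> borel X borel B"
  shows "has_pdf_on \<Omega> (\<lambda>\<omega>. X \<omega> / B \<omega>) {0<..} (mixture_density n k)"
proof -
  define c b where "c = (real k - 1) * \<alpha>" and "b = real n - 1 - (real k - 1) * \<alpha>"
  have c: "0 \<le> c" using assms alpha by (simp add: c_def)
  have ca: "c / \<alpha> + 1 = real k" using alpha(1) unfolding c_def by simp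
  show ?thesis
  proof (cases "n = 1")
    case True
    with assms have k: "k = 1" and n: "n = 1" by auto
    have bz: "b = 0" "c = 0" by (simp_all add: b_def c_def k n)
    have ps: "prob_space \<Omega>" and m: "B \<in> borel_measurable \<Omega>" and ae: "AE \<omega> in \<Omega>. B \<omega> = 1"
      using B bz unfolding b_def[symmetric] by (auto simp: beta_rv_def)
    have "has_pdf_on \<Omega> X {0<..} (\<lambda>t. Gamma (0 + 1) / Gamma (0 / \<alpha> + 1) * t powr - 0 * f t)"
      using X bz unfolding c_def[symmetric] by (simp add: tilted_stable_rv_def)
    also have "has_pdf_on \<Omega> X {0<..} (\<lambda>t. Gamma (0 + 1) / Gamma (0 / \<alpha> + 1) * t powr - 0 * f t) \<longleftrightarrow>
        has_pdf_on \<Omega> X {0<..} (mixture_density n k)"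
    proof (rule has_pdf_on_cong)
      fix t :: real assume "t \<in> {0<..}"
      then have t: "0 < t" by simp
      have "complex_of_real (mixture_density n k t) = of_real (f t)"
        using mixture_density_eq[OF assms(1,2) t] density_eq_mellin_inversion_1[OF t] unfolding k n by simp
      then have "mixture_density n k t = f t" by (simp only: of_real_eq_iff)
      then show "Gamma (0 + 1) / Gamma (0 / \<alpha> + 1) * t powr - 0 * f t = mixture_density n k t"
        using t by simp
    qed
    finally have pX: "has_pdf_on \<Omega> X {0<..} (mixture_density n k)" .
    then have Xm: "X \<in> borel_measurable \<Omega>" by (auto simp: has_pdf_on_def distributed_def)
    have "distr \<Omega> lborel (\<lambda>\<omega>. X \<omega> / B \<omega>) = distr \<Omega> lborel X"
      using ae Xm m by (intro distr_cong_AE) auto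
    then show ?thesis using pX Xm m by (simp add: has_pdf_on_def distributed_def)
  next
    case False
    with assms have n: "1 < n" by auto
    have b: "0 < b"
    proof (cases "k = 1")
      case True then show ?thesis using n by (simp add: b_def)
    next
      case False
      then have "(real k - 1) * \<alpha> < (real k - 1) * 1"
        using assms(1) alpha by (intro mult_strict_left_mono) auto
      then show ?thesis using assms(2) by (simp add: b_def)
    qed
    have "has_pdf_on \<Omega> (\<lambda>\<omega>. X \<omega> / B \<omega>) {0<..}
       (\<lambda>t. Gamma (c + 1) / Gamma (c / \<alpha> + 1) / Beta (c + real 1) b * beta_average c 1 b t)"
      by (rule tilted_quotient_density[OF _ _ b ind])
         (use X B in \<open>simp_all add: tilted_stable_rv_def c_def b_def\<close>)
    also have "has_pdf_on \<Omega> (\<lambda>\<omega>. X \<omega> / B \<omega>) {0<..}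
       (\<lambda>t. Gamma (c + 1) / Gamma (c / \<alpha> + 1) / Beta (c + real 1) b * beta_average c 1 b t) \<longleftrightarrow>
      has_pdf_on \<Omega> (\<lambda>\<omega>. X \<omega> / B \<omega>) {0<..} (mixture_density n k)"
    proof (rule has_pdf_on_cong)
      fix t :: real assume "t \<in> {0<..}"
      then have t: "0 < t" by simp
      have pos: "0 < Gamma (c + 1)" "0 < Gamma b" "0 < Gamma (real k)" "0 < Gamma (real n)"
        using b c assms by auto
      have cb: "c + 1 + b = real n" by (simp add: b_def c_def)
      have A: "Gamma (c + 1) / Gamma (c / \<alpha> + 1) / Beta (c + real 1) b = Gamma (real n) / Gamma (real k) / Gamma b"
        unfolding Beta_def ca using cb pos by (simp add: field_simps)
      have "complex_of_real (Gamma (real n) / Gamma (real k) / Gamma b * beta_average c 1 b t) = of_real (mixture_density n k t)"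
        unfolding mixture_density_eq[OF assms(1,2) t] of_real_mult
          beta_average_1_eq[OF assms(1,2) t, folded c_def b_def, OF b]
        using pos by simp
      then show "Gamma (c + 1) / Gamma (c / \<alpha> + 1) / Beta (c + real 1) b * beta_average c 1 b t = mixture_density n k t"
        unfolding A by (simp only: of_real_eq_iff)
    qed
    finally show ?thesis .
  qed
qed
end

section \<open>Divergence along left loops\<close>

lemma has_integral_atLeast_tendsto:
  fixes h :: "real \<Rightarrow> 'b :: banach"
  assumes "(h has_integral I) {a..}"
  shows "((\<lambda>R. integral {a..a + R} h) \<longlongrightarrow> I) at_top"
proof (rule tendstoI)
  fix e :: real assume e: "0 < e"
  have nb: "\<not> (\<exists>u v. {a..} = cbox u (v::real))"
  proof
    assume "\<exists>u v. {a..} = cbox u (v::real)"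
    then obtain u v where "{a..} = cbox u v" by blast
    moreover have "max a v + 1 \<in> {a..}" by simp
    ultimately show False by auto
  qed
  have "(h has_integral I) {a..} \<longleftrightarrow> (\<forall>e>0. \<exists>B>0. \<forall>u v. ball 0 B \<subseteq> cbox u v \<longrightarrow>
      (\<exists>z. ((\<lambda>x. if x \<in> {a..} then h x else 0) has_integral z) (cbox u v) \<and> norm (z - I) < e))"
    by (subst has_integral_alt) (rule if_not_P[OF nb])
  from this[THEN iffD1, OF assms, rule_format, OF e]
  obtain B where B: "0 < B" "\<And>u v. ball 0 B \<subseteq> cbox u v \<Longrightarrow>
      \<exists>z. ((\<lambda>x. if x \<in> {a..} then h x else 0) has_integral z) (cbox u v) \<and> norm (z - I) < e"
    by auto
  show "\<forall>\<^sub>F R in at_top. dist (integral {a..a + R} h) I < e"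
  proof (rule eventually_at_top_linorderI[of "B + \<bar>a\<bar>"])
    fix R assume R: "B + \<bar>a\<bar> \<le> R"
    have "ball 0 B \<subseteq> cbox (- B - \<bar>a\<bar>) (a + R)"
      using R by (auto simp: dist_norm abs_less_iff)
    from B(2)[OF this] obtain z
      where z: "((\<lambda>x. if x \<in> {a..} then h x else 0) has_integral z) {- B - \<bar>a\<bar>..a + R}" "norm (z - I) < e"
      by auto
    have "((\<lambda>x. if x \<in> {a..a + R} then h x else 0) has_integral z) {- B - \<bar>a\<bar>..a + R}"
      by (rule has_integral_eq[OF _ z(1)]) auto
    then have "(h has_integral z) {a..a + R}"
      by (subst (asm) has_integral_restrict) (use B(1) in auto)
    then show "dist (integral {a..a + R} h) I < e"
      using z(2) by (simp add: integral_unique dist_norm)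
  qed
qed

text \<open>The imaginary part of the Digamma series is a sum of terms \<open>Im z / \<bar>z + n\<bar>\<^sup>2\<close>, so that it stays bounded
  on horizontal rays to the right, although the real part grows.\<close>

lemma Im_Digamma_bound:
  obtains Z where "0 \<le> Z" "\<And>z :: complex. 1 \<le> Re z \<Longrightarrow> \<bar>Im (Digamma z)\<bar> \<le> Z * \<bar>Im z\<bar>"
proof -
  have sm: "summable (\<lambda>n. inverse (real (Suc n) ^ 2))"
    using inverse_power_summable[of 2, where 'a = real] by (subst summable_Suc_iff) simp
  define Z where "Z = (\<Sum>n. inverse (real (Suc n) ^ 2))"
  have "\<bar>Im (Digamma z)\<bar> \<le> Z * \<bar>Im z\<bar>" if z: "1 \<le> Re z" for z :: complex
  proof -
    have "z \<noteq> 0" using z by auto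
    from tendsto_rabs[OF tendsto_Im[OF Digamma_LIMSEQ[OF this]]]
    have L: "(\<lambda>m. \<bar>Im (of_real (ln (real m)) - (\<Sum>n<m. inverse (z + of_nat n)))\<bar>) \<longlonglongrightarrow> \<bar>Im (Digamma z)\<bar>" .
    have "\<bar>Im (of_real (ln (real m)) - (\<Sum>n<m. inverse (z + of_nat n)))\<bar> \<le> Z * \<bar>Im z\<bar>" for m
    proof -
      have Im_le: "\<bar>Im (inverse (z + of_nat n))\<bar> \<le> inverse (real (Suc n) ^ 2) * \<bar>Im z\<bar>" for n
      proof -
        have n: "real (Suc n) \<le> norm (z + of_nat n)"
          using z complex_Re_le_cmod[of "z + of_nat n"] by simp
        then have "real (Suc n) ^ 2 \<le> (norm (z + of_nat n))\<^sup>2" by (intro power_mono) auto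
        then have "\<bar>Im z\<bar> / (norm (z + of_nat n))\<^sup>2 \<le> \<bar>Im z\<bar> / real (Suc n) ^ 2"
          using n by (intro divide_left_mono mult_pos_pos zero_less_power) auto
        moreover have "\<bar>Im (inverse (z + of_nat n))\<bar> = \<bar>Im z\<bar> / (norm (z + of_nat n))\<^sup>2"
        proof -
          have "(norm (z + of_nat n))\<^sup>2 = (Re z + real n)\<^sup>2 + (Im z)\<^sup>2"
            by (simp add: cmod_power2)
          then show ?thesis by simp
        qed
        ultimately show ?thesis by (simp add: divide_inverse mult.commute)
      qed
      have "\<bar>Im (of_real (ln (real m)) - (\<Sum>n<m. inverse (z + of_nat n)))\<bar> \<le> (\<Sum>n<m. \<bar>Im (inverse (z + of_nat n))\<bar>)"
      proof -
        have "Im (of_real (ln (real m)) - (\<Sum>n<m. inverse (z + of_nat n))) = - (\<Sum>n<m. Im (inverse (z + of_nat n)))"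
          by (simp only: minus_complex.sel Im_sum Im_complex_of_real diff_0)
        then show ?thesis by (simp only: abs_minus_cancel sum_abs)
      qed
      also have "\<dots> \<le> (\<Sum>n<m. inverse (real (Suc n) ^ 2)) * \<bar>Im z\<bar>"
        unfolding sum_distrib_right by (intro sum_mono Im_le)
      also have "\<dots> \<le> Z * \<bar>Im z\<bar>"
        unfolding Z_def by (intro mult_right_mono sum_le_suminf[OF sm]) auto
      finally show ?thesis .
    qed
    then show ?thesis using L LIMSEQ_le_const2 by blast
  qed
  moreover have "0 \<le> Z" unfolding Z_def by (intro suminf_nonneg sm) simp
  ultimately show thesis by (intro that)
qed

lemma norm_Gamma_le_Gamma_Re: "0 < Re z \<Longrightarrow> norm (Gamma z) \<le> Gamma (Re z)" for z :: complex
proof -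
  assume z: "0 < Re z"
  have "norm (Gamma z) = norm (LBINT x. exp (z * of_real x - of_real (exp x)))"
    using Gamma_integral_log_scale[OF z] by (simp add: has_bochner_integral_iff)
  also have "\<dots> \<le> (LBINT x. norm (exp (z * of_real x - of_real (exp x))))" by (rule integral_norm_bound)
  also have "\<dots> = Gamma (Re z)"
    using Gamma_integral_log_scale_real(1)[OF z] by (simp add: has_bochner_integral_iff)
  finally show ?thesis .
qed

text \<open>To the left both Gamma values can be compared with real ones: the numerator by monotonicity in the
  real part, the denominator by the triangle inequality. The quotient of the real values is at least
  \<open>\<Gamma>(w)\<close>, where \<open>w\<close> grows linearly in \<open>r\<close> because of \<open>\<alpha> < 1\<close>, and \<open>\<Gamma>(w)\<close> outweighs the power of \<open>t\<close>.\<close>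

lemma stable_mellin_left_lower_bound:
  assumes \<alpha>: "0 < \<alpha>" "\<alpha> < 1" and t: "0 < t"
  obtains c R0 where "0 < c" "0 \<le> R0"
    "\<And>r. R0 \<le> r \<Longrightarrow> c \<le> norm (stable_mellin \<alpha> k n (p - of_real r) * of_real t powr (- (p - of_real r)))"
proof -
  define \<beta> where "\<beta> = 1 / \<alpha> - 1"
  have \<beta>: "0 < \<beta>" using \<alpha> by (simp add: \<beta>_def)
  \<comment> \<open>Chosen such that \<open>A powr (\<beta> * r)\<close> cancels \<open>t powr r\<close>.\<close>
  define A where "A = exp (- ln t / \<beta>)"
  define g where "g = norm (Gamma (1 + \<i> * of_real (- Im p / \<alpha>)))"
  have g: "0 < g" unfolding g_def using Gamma_neq_zero_if_Re_pos by simp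
  define E where "E = - (ln t / \<beta>) * ((1 - Re p) * \<beta> + real k - real n - 1) - Re p * ln t"
  define R0 where "R0 = \<bar>Re p\<bar> + (real n + 1) / \<beta> + real n"
  show thesis
  proof (rule that[of "g * (exp E * exp (- A))" R0])
    show "0 < g * (exp E * exp (- A))" using g by simp
    show "0 \<le> R0" using \<beta> by (simp add: R0_def)
    fix r assume r: "R0 \<le> r"
    define u where "u = 1 - p + of_real r"
    define w where "w = Re u * \<beta> + real k - real n"
    have "0 \<le> (real n + 1) / \<beta>" using \<beta> by simp
    then have ru: "Re u = 1 - Re p + r" "(real n + 1) / \<beta> \<le> Re u" "1 \<le> Re u"
      using r by (auto simp: u_def R0_def)
    then have "real n + 1 \<le> Re u * \<beta>" using \<beta> by (simp add: pos_divide_le_eq)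
    then have w: "1 \<le> w" by (simp add: w_def)
    define z where "z = of_nat k + u / of_real \<alpha>"
    have Rz: "Re z = real n + Re u + w" "Im z = - Im p / \<alpha>"
      using \<alpha> by (simp_all add: z_def w_def \<beta>_def u_def field_simps)
    have z1: "1 \<le> Re z" using Rz ru w by simp
    have G1: "g * Gamma (Re z) \<le> norm (Gamma z)"
    proof -
      have "norm (Gamma (1 + \<i> * of_real (Im z))) / Gamma (Re (1 + \<i> * of_real (Im z))) \<le> norm (Gamma z) / Gamma (Re z)"
        using z1 by (intro norm_Gamma_ratio_mono) auto
      moreover have "0 < Gamma (Re z)" using z1 by (intro Gamma_real_pos) linarith
      ultimately show ?thesis unfolding Rz(2) g_def[symmetric] by (simp add: pos_le_divide_eq)
    qed
    have G2: "1 / Gamma (real n + Re u) \<le> norm (rGamma (of_nat n + u))"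
    proof -
      have "0 < Re (of_nat n + u)" using ru by simp
      then have "norm (Gamma (of_nat n + u)) \<le> Gamma (real n + Re u)" "Gamma (of_nat n + u) \<noteq> 0"
        using norm_Gamma_le_Gamma_Re[of "of_nat n + u"] Gamma_neq_zero_if_Re_pos by auto
      then show ?thesis
        by (simp add: rGamma_inverse_Gamma norm_inverse norm_divide inverse_eq_divide frac_le)
    qed
    have pos: "0 < Gamma (real n + Re u)" "0 < Gamma w" "0 < Gamma (Re z)"
      using ru w z1 by (intro Gamma_real_pos; linarith)+
    have G3: "Gamma w * Gamma (real n + Re u) \<le> Gamma (Re z)"
    proof -
      have "Beta (real n + Re u) w \<le> Beta 1 1" using ru w by (intro Beta_real_mono) auto
      also have "Beta 1 (1 :: real) = 1" by (simp add: Beta_def Gamma_numeral)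
      finally have "Gamma (real n + Re u) * Gamma w / Gamma (Re z) \<le> 1"
        unfolding Beta_def Rz(1) by simp
      then show ?thesis using pos by (simp add: divide_le_eq mult.commute)
    qed
    have G4: "A powr (w - 1) * exp (- A) \<le> Gamma w"
      using w by (intro Gamma_real_ge_powr) (auto simp: A_def)
    have "A powr (w - 1) * t powr (r - Re p) = exp E"
    proof -
      have "A powr (w - 1) * t powr (r - Re p) = exp (- (ln t / \<beta>) * (w - 1) + (r - Re p) * ln t)"
        using t by (simp add: A_def powr_def mult_exp_exp mult.commute)
      moreover have "w - 1 = ((1 - Re p) * \<beta> + real k - real n - 1) + r * \<beta>"
        by (simp add: w_def ru(1) algebra_simps)
      moreover have "(ln t / \<beta>) * (r * \<beta>) = r * ln t" using \<beta> by simp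
      ultimately show ?thesis by (simp only: E_def distrib_left mult_minus_left left_diff_distrib) simp
    qed
    then have "g * (exp E * exp (- A)) = g * (A powr (w - 1) * exp (- A)) * t powr (r - Re p)"
      by (simp add: mult_ac)
    also have "\<dots> \<le> g * Gamma w * t powr (r - Re p)"
      using g G4 by (intro mult_right_mono mult_left_mono) auto
    also have "g * Gamma w \<le> (g * Gamma (Re z)) * (1 / Gamma (real n + Re u))"
      using G3 g pos by (simp add: pos_le_divide_eq mult.assoc)
    also have "\<dots> \<le> norm (Gamma z) * norm (rGamma (of_nat n + u))"
      using G1 G2 pos g by (intro mult_mono) auto
    finally have "g * (exp E * exp (- A)) \<le> norm (Gamma z) * norm (rGamma (of_nat n + u)) * t powr (r - Re p)"
      by (simp add: mult_right_mono)
    moreover have "z = of_nat k + (1 - (p - of_real r)) / of_real \<alpha>" "of_nat n + u = of_nat n + 1 - (p - of_real r)"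
      by (simp_all add: z_def u_def)
    ultimately show "g * (exp E * exp (- A)) \<le> norm (stable_mellin \<alpha> k n (p - of_real r) * of_real t powr (- (p - of_real r)))"
      using t by (simp add: stable_mellin_def norm_mult norm_powr_real_powr)
  qed
qed

text \<open>Along the ray the integrand is the exponential of a combination of \<open>ln_Gamma\<close> values; its phase
  \<open>\<theta>\<close> moves with the imaginary part of the corresponding Digamma values, which is bounded.\<close>

lemma stable_mellin_left_phase:
  assumes \<alpha>: "0 < \<alpha>" "\<alpha> < 1" and t: "0 < t"
  obtains \<theta> K R0 where "0 < K" "0 \<le> R0"
    "\<And>r. R0 \<le> r \<Longrightarrow> stable_mellin \<alpha> k n (p - of_real r) * of_real t powr (- (p - of_real r)) =
       of_real (norm (stable_mellin \<alpha> k n (p - of_real r) * of_real t powr (- (p - of_real r)))) * cis (\<theta> r)"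
    "\<And>r r'. R0 \<le> r \<Longrightarrow> r \<le> r' \<Longrightarrow> \<bar>\<theta> r' - \<theta> r\<bar> \<le> K * (r' - r)"
proof -
  obtain Z where Z: "0 \<le> Z" "\<And>z :: complex. 1 \<le> Re z \<Longrightarrow> \<bar>Im (Digamma z)\<bar> \<le> Z * \<bar>Im z\<bar>"
    by (rule Im_Digamma_bound) blast
  define K where "K = Z * \<bar>Im p / \<alpha>\<bar> / \<alpha> + Z * \<bar>Im p\<bar> + 1"
  define R0 where "R0 = \<bar>Re p\<bar>"
  define a where "a = (\<lambda>s. of_nat k + (1 - p + s) / of_real \<alpha>)"
  define b where "b = (\<lambda>s. of_nat n + (1 - p + s))"
  define \<Lambda> where "\<Lambda> = (\<lambda>s. ln_Gamma (a s) - ln_Gamma (b s) - (p - s) * of_real (ln t))"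
  define \<Lambda>' where "\<Lambda>' = (\<lambda>s. Digamma (a s) / of_real \<alpha> - Digamma (b s) + of_real (ln t))"
  have ab: "1 \<le> Re (a (of_real r))" "1 \<le> Re (b (of_real r))" "Im (a (of_real r)) = - Im p / \<alpha>" "Im (b (of_real r)) = - Im p"
    if "R0 \<le> r" for r
  proof -
    have x: "1 \<le> 1 - Re p + r" using that by (auto simp: R0_def)
    then have "\<alpha> \<le> 1 - Re p + r" using \<alpha> by linarith
    then have "1 \<le> (1 - Re p + r) / \<alpha>" using \<alpha> by (simp add: pos_le_divide_eq)
    then show "1 \<le> Re (a (of_real r))" by (simp add: a_def)
    show "1 \<le> Re (b (of_real r))" using x by (simp add: b_def)
    show "Im (a (of_real r)) = - Im p / \<alpha>" "Im (b (of_real r)) = - Im p" by (simp_all add: a_def b_def)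
  qed
  have nonpos: "z \<notin> \<real>\<^sub>\<le>\<^sub>0" "z \<notin> \<int>\<^sub>\<le>\<^sub>0" if "1 \<le> Re z" for z
  proof -
    show *: "z \<notin> \<real>\<^sub>\<le>\<^sub>0" using that by (auto simp: complex_nonpos_Reals_iff)
    show "z \<notin> \<int>\<^sub>\<le>\<^sub>0" using * nonpos_Ints_subset_nonpos_Reals by blast
  qed
  have F: "stable_mellin \<alpha> k n (p - of_real r) * of_real t powr (- (p - of_real r)) = exp (\<Lambda> (of_real r))"
    if r: "R0 \<le> r" for r
  proof -
    have "of_nat k + (1 - (p - of_real r)) / of_real \<alpha> = a (of_real r)" "of_nat n + 1 - (p - of_real r) = b (of_real r)"
      by (simp_all add: a_def b_def)
    moreover have "Gamma (a (of_real r)) = exp (ln_Gamma (a (of_real r)))" "rGamma (b (of_real r)) = exp (- ln_Gamma (b (of_real r)))"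
      using nonpos ab[OF r] by (simp_all add: Gamma_complex_altdef rGamma_complex_altdef)
    moreover have "complex_of_real t powr (- (p - of_real r)) = exp (- ((p - of_real r) * of_real (ln t)))"
      using t by (simp add: powr_def Ln_of_real algebra_simps)
    ultimately show ?thesis
      unfolding stable_mellin_def \<Lambda>_def by (simp only: mult_exp_exp) simp
  qed
  have deriv: "((\<lambda>r. Im (\<Lambda> (of_real r))) has_real_derivative Im (\<Lambda>' (of_real r))) (at r within S)"
    if r: "R0 \<le> r" for r S
  proof -
    have "(\<Lambda> has_field_derivative \<Lambda>' (of_real r)) (at (of_real r))"
      unfolding \<Lambda>_def \<Lambda>'_def a_def b_def using nonpos[of "a (of_real r)"] nonpos[of "b (of_real r)"] ab[OF r] \<alpha>
      by (auto intro!: derivative_eq_intros simp: a_def b_def)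
    from has_vector_derivative_real_field[OF this]
    have "((\<lambda>r. \<Lambda> (of_real r)) has_vector_derivative \<Lambda>' (of_real r)) (at r within S)"
      by (rule has_vector_derivative_at_within)
    from bounded_linear.has_vector_derivative[OF bounded_linear_Im this]
    show ?thesis by (simp add: has_real_derivative_iff_has_vector_derivative)
  qed
  have bound: "\<bar>Im (\<Lambda>' (of_real r))\<bar> \<le> K" if r: "R0 \<le> r" for r
  proof -
    have "\<bar>Im (Digamma (a (of_real r)) / of_real \<alpha>)\<bar> \<le> Z * \<bar>Im p / \<alpha>\<bar> / \<alpha>"
    proof -
      have "\<bar>Im (Digamma (a (of_real r)))\<bar> / \<alpha> \<le> Z * \<bar>Im (a (of_real r))\<bar> / \<alpha>"
        using Z(2)[OF ab(1)[OF r]] \<alpha> by (intro divide_right_mono) auto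
      then show ?thesis unfolding ab(3)[OF r] using \<alpha> by simp
    qed
    moreover have "\<bar>Im (Digamma (b (of_real r)))\<bar> \<le> Z * \<bar>Im p\<bar>"
      using Z(2)[OF ab(2)[OF r]] ab(4)[OF r] by simp
    moreover have "Im (\<Lambda>' (of_real r)) = Im (Digamma (a (of_real r)) / of_real \<alpha>) - Im (Digamma (b (of_real r)))"
      by (simp add: \<Lambda>'_def)
    ultimately show ?thesis unfolding K_def by linarith
  qed
  show thesis
  proof (rule that[of K R0 "\<lambda>r. Im (\<Lambda> (of_real r))"])
    show "0 < K" using Z(1) \<alpha> by (simp add: K_def add_nonneg_pos)
    show "0 \<le> R0" by (simp add: R0_def)
    fix r assume r: "R0 \<le> r"
    show "stable_mellin \<alpha> k n (p - of_real r) * of_real t powr (- (p - of_real r)) =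
       of_real (norm (stable_mellin \<alpha> k n (p - of_real r) * of_real t powr (- (p - of_real r)))) * cis (Im (\<Lambda> (of_real r)))"
      unfolding F[OF r] norm_exp_eq_Re by (rule exp_eq_polar)
    fix r' assume r': "r \<le> r'"
    have "norm (Im (\<Lambda> (of_real r')) - Im (\<Lambda> (of_real r))) \<le> K * norm (r' - r)"
    proof (rule field_differentiable_bound[where S = "{r..r'}" and f' = "\<lambda>r. Im (\<Lambda>' (of_real r))"])
      fix x assume "x \<in> {r..r'}"
      then have x: "R0 \<le> x" using r by simp
      show "((\<lambda>r. Im (\<Lambda> (of_real r))) has_real_derivative Im (\<Lambda>' (of_real x))) (at x within {r..r'})"
        by (rule deriv[OF x])
      show "norm (Im (\<Lambda>' (of_real x))) \<le> K" using bound[OF x] by simp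
    qed (use r' in auto)
    then show "\<bar>Im (\<Lambda> (of_real r')) - Im (\<Lambda> (of_real r))\<bar> \<le> K * (r' - r)" using r' by simp
  qed
qed

text \<open>On an interval of length \<open>1/K\<close> the phase turns by at most one radian. The integral over such an
  interval therefore stays away from \<open>0\<close>, however far out the interval lies, whereas it would tend to
  \<open>0\<close> if the improper integral converged.\<close>

lemma stable_mellin_left_ray_not_integrable:
  assumes \<alpha>: "0 < \<alpha>" "\<alpha> < 1" and t: "0 < t"
  shows "\<not> (\<lambda>r. stable_mellin \<alpha> k n (p - of_real r) * of_real t powr (- (p - of_real r))) integrable_on {0..}"
proof
  define h where "h = (\<lambda>r. stable_mellin \<alpha> k n (p - of_real r) * of_real t powr (- (p - of_real r)))"
  assume "(\<lambda>r. stable_mellin \<alpha> k n (p - of_real r) * of_real t powr (- (p - of_real r))) integrable_on {0..}"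
  then have hi: "h integrable_on {0..}" by (simp add: h_def)
  obtain c R1 where c: "0 < c" "0 \<le> R1" "\<And>r. R1 \<le> r \<Longrightarrow> c \<le> norm (h r)"
    unfolding h_def by (rule stable_mellin_left_lower_bound[OF assms, of k n p]) blast
  obtain \<theta> K R2 where K: "0 < K" "0 \<le> R2" "\<And>r. R2 \<le> r \<Longrightarrow> h r = of_real (norm (h r)) * cis (\<theta> r)"
    "\<And>r r'. R2 \<le> r \<Longrightarrow> r \<le> r' \<Longrightarrow> \<bar>\<theta> r' - \<theta> r\<bar> \<le> K * (r' - r)"
    unfolding h_def by (rule stable_mellin_left_phase[OF assms, of k n p]) blast
  define \<delta> where "\<delta> = 1 / K"
  have \<delta>: "0 < \<delta>" using K by (simp add: \<delta>_def)
  have lim: "((\<lambda>R. integral {0..0 + R} h) \<longlongrightarrow> integral {0..} h) at_top"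
    by (intro has_integral_atLeast_tendsto integrable_integral hi)
  have "filterlim (\<lambda>R. R + \<delta>) at_top at_top"
    by (rule filterlim_at_top_mono[OF filterlim_ident]) (use \<delta> in \<open>auto intro: eventuallyI\<close>)
  from tendsto_diff[OF filterlim_compose[OF lim this] lim]
  have "((\<lambda>R. integral {0..R + \<delta>} h - integral {0..R} h) \<longlongrightarrow> 0) at_top"
    by simp
  then have "\<forall>\<^sub>F R in at_top. dist (integral {0..R + \<delta>} h - integral {0..R} h) 0 < \<delta> * (c / 2)"
    using \<delta> c by (intro tendstoD) auto
  then have "\<forall>\<^sub>F R in at_top. max R1 R2 \<le> R \<and> norm (integral {0..R + \<delta>} h - integral {0..R} h) < \<delta> * (c / 2)"
    by (intro eventually_conj eventually_ge_at_top) (simp add: dist_norm)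
  then obtain R where R: "max R1 R2 \<le> R" "norm (integral {0..R + \<delta>} h - integral {0..R} h) < \<delta> * (c / 2)"
    using eventually_happens'[OF trivial_limit_at_top_linorder] by blast
  have R0: "0 \<le> R" using R c by simp
  have i: "h integrable_on {a..b}" if "0 \<le> a" for a b
    using integrable_on_subcbox[OF hi, of a b] that by auto
  have "integral {0..R} h + integral {R..R + \<delta>} h = integral {0..R + \<delta>} h"
    using R0 \<delta> i by (intro Henstock_Kurzweil_Integration.integral_combine) auto
  then have J: "norm (integral {R..R + \<delta>} h) < \<delta> * (c / 2)" using R(2) by (metis add_diff_cancel_left')
  define e where "e = cis (- \<theta> R)"
  have hJ: "((\<lambda>r. Re (h r * e)) has_integral Re (integral {R..R + \<delta>} h * e)) {R..R + \<delta>}"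
  proof -
    have "((\<lambda>r. h r * e) has_integral integral {R..R + \<delta>} h * e) {R..R + \<delta>}"
      by (intro has_integral_mult_left integrable_integral i R0)
    from has_integral_linear[OF this bounded_linear_Re] show ?thesis by (simp add: o_def)
  qed
  have hc: "((\<lambda>r. c / 2) has_integral \<delta> * (c / 2)) {R..R + \<delta>}"
    using has_integral_const_real[of "c / 2" R "R + \<delta>"] \<delta> by simp
  have "\<delta> * (c / 2) \<le> Re (integral {R..R + \<delta>} h * e)"
  proof (rule has_integral_le[OF hc hJ])
    fix r assume r: "r \<in> {R..R + \<delta>}"
    have rr: "R1 \<le> r" "R2 \<le> r" "R2 \<le> R" using r R by auto
    have "\<bar>\<theta> r - \<theta> R\<bar> \<le> K * (r - R)" using K(4)[OF rr(3)] r by simp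
    also have "\<dots> \<le> K * \<delta>" using r K by (intro mult_left_mono) auto
    also have "\<dots> = 1" using K by (simp add: \<delta>_def)
    finally have "\<bar>\<theta> r - \<theta> R\<bar> \<le> pi / 3" using pi_gt3 by simp
    then have "cos (pi / 3) \<le> cos \<bar>\<theta> r - \<theta> R\<bar>"
      by (intro cos_monotone_0_pi_le) (auto intro: order_trans[of _ "pi / 3"])
    then have cos: "1 / 2 \<le> cos (\<theta> r - \<theta> R)" by (simp add: cos_60)
    have "h r * e = of_real (norm (h r)) * cis (\<theta> r - \<theta> R)"
      unfolding e_def by (subst K(3)[OF rr(2)]) (simp add: mult.assoc cis_mult)
    then have "Re (h r * e) = norm (h r) * cos (\<theta> r - \<theta> R)" by simp
    moreover have "c * (1 / 2) \<le> norm (h r) * cos (\<theta> r - \<theta> R)"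
      using c rr cos by (intro mult_mono) auto
    ultimately show "c / 2 \<le> Re (h r * e)" by simp
  qed
  also have "\<dots> \<le> norm (integral {R..R + \<delta>} h * e)" by (rule complex_Re_le_cmod)
  also have "\<dots> = norm (integral {R..R + \<delta>} h)" by (simp add: norm_mult e_def)
  finally show False using J by simp
qed

section \<open>The Mellin--Barnes integrand\<close>

lemma contour_integral_ray:
  fixes d :: complex
  assumes "0 \<le> r" and "continuous_on (closed_segment a (a + of_real r * d)) F"
  shows "contour_integral (linepath a (a + of_real r * d)) F = d * integral {0..r} (\<lambda>x. F (a + of_real x * d))"
proof (cases "r = 0")
  case False
  with assms(1) have r: "0 < r" by simp
  define g where "g = (\<lambda>x. F (a + of_real x * d))"
  have "continuous_on {0..r} g"
    unfolding g_def
  proof (rule continuous_on_compose2[OF assms(2)])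
    show "(\<lambda>x. a + of_real x * d) ` {0..r} \<subseteq> closed_segment a (a + of_real r * d)"
    proof clarify
      fix x assume x: "x \<in> {0..r}"
      then show "a + of_real x * d \<in> closed_segment a (a + of_real r * d)"
        unfolding in_segment using r
        by (intro exI[of _ "x / r"]) (auto simp: scaleR_conv_of_real field_simps)
    qed
  qed (intro continuous_intros)
  then have "(g has_integral integral {0..r} g) (cbox 0 r)"
    using integrable_continuous_interval[of 0 r g] by (simp add: has_integral_integrable_integral)
  from has_integral_affinity[OF this, of r 0] r
  have "((\<lambda>x. g (r * x)) has_integral (1 / r) *\<^sub>R integral {0..r} g) ((\<lambda>x. x / r) ` {0..r})"
    by simp
  moreover have "(\<lambda>x. x / r) ` {0..r} = {0..1}"
    using r by (auto simp: image_iff intro!: bexI[of _ "_ * r"])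
  ultimately have "((\<lambda>x. g (r * x) * (of_real r * d)) has_integral (1 / r) *\<^sub>R integral {0..r} g * (of_real r * d)) {0..1}"
    by (intro has_integral_mult_left) simp
  moreover have "(1 / r) *\<^sub>R integral {0..r} g * (of_real r * d) = d * integral {0..r} g"
    using r by (simp add: scaleR_conv_of_real)
  moreover have "g (r * x) * (of_real r * d) = F (linepath a (a + of_real r * d) x) * (a + of_real r * d - a)" for x
    by (simp add: g_def linepath_def scaleR_conv_of_real algebra_simps)
  ultimately have "(F has_contour_integral d * integral {0..r} g) (linepath a (a + of_real r * d))"
    by (simp add: has_contour_integral_linepath)
  then show ?thesis by (simp add: g_def contour_integral_unique)
qed simp

text \<open>The contour integrals are studied for a fixed argument \<open>t\<close> and fixed indices; \<open>k = n = 0\<close> gives the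
  denominator of the quotient of Fox functions.\<close>

locale mellin_barnes =
  fixes \<alpha> t :: real and k n :: nat
  assumes alpha: "0 < \<alpha>" "\<alpha> < 1" and t: "0 < t" and kn: "k \<le> n"
begin

definition integrand :: "complex \<Rightarrow> complex" where
  "integrand s = stable_mellin \<alpha> k n s * of_real t powr (- s)"

text \<open>The poles of the numerator. At some of them the integrand is regular, because the reciprocal Gamma
  factor vanishes there, but contours have to separate them all.\<close>

definition poles :: "complex set" where
  "poles = {s. of_nat k + (1 - s) / of_real \<alpha> \<in> \<int>\<^sub>\<le>\<^sub>0}"

lemma poles_eq: "poles = range (\<lambda>m. of_real (1 + \<alpha> * (real k + real m)))"
proof (intro equalityI subsetI)
  fix s assume "s \<in> poles"
  then obtain m where "of_nat k + (1 - s) / of_real \<alpha> = - of_nat m"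
    by (auto simp: poles_def elim: nonpos_Ints_cases')
  then have "(1 - s) / of_real \<alpha> = - of_nat m - of_nat k" by (simp add: algebra_simps)
  then have "1 - s = of_real \<alpha> * (- of_nat m - of_nat k)" using alpha by (simp add: field_simps)
  then have "s = of_real (1 + \<alpha> * (real k + real m))" by (simp add: algebra_simps)
  then show "s \<in> range (\<lambda>m. of_real (1 + \<alpha> * (real k + real m)))" by blast
next
  fix s assume "s \<in> range (\<lambda>m. complex_of_real (1 + \<alpha> * (real k + real m)))"
  then obtain m where "s = of_real (1 + \<alpha> * (real k + real m))" by auto
  then have "of_nat k + (1 - s) / of_real \<alpha> = - of_nat m" using alpha by (simp add: field_simps)
  then show "s \<in> poles" by (simp add: poles_def)
qed

lemma poles_real: "z \<in> poles \<Longrightarrow> Im z = 0" "z \<in> poles \<Longrightarrow> 1 \<le> Re z"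
  using alpha by (auto simp: poles_eq)

lemma closed_poles: "closed poles"
proof -
  have "closed ((\<lambda>s. of_nat k + (1 - s) / of_real \<alpha>) -` (\<int>\<^sub>\<le>\<^sub>0 :: complex set))"
    using alpha by (intro closed_vimage closed_nonpos_Ints continuous_intros) auto
  then show ?thesis by (simp add: poles_def vimage_def)
qed

lemma finite_poles: "finite {z \<in> poles. Re z \<le> X}"
proof (rule finite_subset)
  show "{z \<in> poles. Re z \<le> X} \<subseteq> (\<lambda>m. of_real (1 + \<alpha> * (real k + real m))) ` {..nat \<lceil>X / \<alpha>\<rceil>}"
  proof
    fix z assume z: "z \<in> {z \<in> poles. Re z \<le> X}"
    then obtain m where m: "z = of_real (1 + \<alpha> * (real k + real m))" by (auto simp: poles_eq)
    have "\<alpha> * real m \<le> X"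
    proof -
      have "\<alpha> * real m \<le> \<alpha> * (real k + real m)" using alpha by (intro mult_left_mono) auto
      then show ?thesis using z m by simp
    qed
    then have "real m \<le> X / \<alpha>" using alpha by (simp add: pos_le_divide_eq mult.commute)
    then have "m \<le> nat \<lceil>X / \<alpha>\<rceil>" by linarith
    then show "z \<in> (\<lambda>m. of_real (1 + \<alpha> * (real k + real m))) ` {..nat \<lceil>X / \<alpha>\<rceil>}" using m by blast
  qed
qed simp

lemma holomorphic_integrand: "integrand holomorphic_on - poles"
proof -
  have 1: "(Gamma \<circ> (\<lambda>s. of_nat k + (1 - s) / of_real \<alpha>)) holomorphic_on - poles"
    using alpha by (intro holomorphic_on_compose_gen[of _ _ Gamma "- \<int>\<^sub>\<le>\<^sub>0"] holomorphic_intros) (auto simp: poles_def)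
  have 2: "(rGamma \<circ> (\<lambda>s. of_nat n + 1 - s)) holomorphic_on - poles"
    by (intro holomorphic_on_compose holomorphic_intros)
  have 3: "(\<lambda>s. exp (- s * of_real (ln t))) holomorphic_on - poles"
    by (intro holomorphic_intros)
  have "(\<lambda>s. (Gamma \<circ> (\<lambda>s. of_nat k + (1 - s) / of_real \<alpha>)) s * (rGamma \<circ> (\<lambda>s. of_nat n + 1 - s)) s *
     exp (- s * of_real (ln t))) holomorphic_on - poles"
    by (intro holomorphic_on_mult 1 2 3)
  also have "(\<lambda>s. (Gamma \<circ> (\<lambda>s. of_nat k + (1 - s) / of_real \<alpha>)) s * (rGamma \<circ> (\<lambda>s. of_nat n + 1 - s)) s *
     exp (- s * of_real (ln t))) = integrand"
    using t by (simp add: fun_eq_iff integrand_def stable_mellin_def powr_def Ln_of_real)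
  finally show ?thesis .
qed

lemma continuous_integrand: "S \<inter> poles = {} \<Longrightarrow> continuous_on S integrand"
  by (rule holomorphic_on_imp_continuous_on, rule holomorphic_on_subset[OF holomorphic_integrand]) auto

lemma integrable_on_segment:
  "closed_segment a b \<inter> poles = {} \<Longrightarrow> integrand contour_integrable_on linepath a b"
  by (intro contour_integrable_continuous_linepath continuous_integrand)

lemma integrand_decay:
  assumes "0 < \<phi>"
  obtains C c where "0 < C" "0 < c"
    "\<And>s. - D \<le> Re s \<Longrightarrow> \<phi> \<le> \<bar>Im s\<bar> \<Longrightarrow> norm (integrand s) \<le> C * exp (- c * \<bar>Im s\<bar> - Re s)"
  unfolding integrand_def by (rule norm_stable_mellin_powr_le[OF alpha kn assms t]) blast

definition axis_integral :: complex where "axis_integral = (LBINT y. integrand (\<i> * of_real y))"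

lemma integrand_imaginary: "integrand (\<i> * of_real y) = iexp (- (y * ln t)) * stable_mellin \<alpha> k n (\<i> * of_real y)"
  using t by (simp add: integrand_def powr_def Ln_of_real mult_ac)

lemma integrable_imaginary_axis: "integrable lborel (\<lambda>y. integrand (\<i> * of_real y))"
proof (rule Bochner_Integration.integrable_bound[OF stable_mellin_integrable[OF alpha kn]])
  have "continuous_on UNIV (\<lambda>y. integrand (\<i> * of_real y))"
    unfolding integrand_imaginary by (intro continuous_intros stable_mellin_continuous alpha)
  then show "(\<lambda>y. integrand (\<i> * of_real y)) \<in> borel_measurable lborel"
    by (simp add: borel_measurable_continuous_onI)
qed (simp add: integrand_imaginary norm_mult)

abbreviation seg_integral :: "complex \<Rightarrow> complex \<Rightarrow> complex" where
  "seg_integral a b \<equiv> contour_integral (linepath a b) integrand"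

lemma imaginary_axis_limit:
  assumes "filterlim a at_bot L" "filterlim b at_top L"
  shows "((\<lambda>x. seg_integral (\<i> * of_real (a x)) (\<i> * of_real (b x))) \<longlongrightarrow> \<i> * axis_integral) L"
proof -
  define h where "h = (\<lambda>y. integrand (\<i> * of_real y))"
  have hi: "h integrable_on UNIV"
    using integrable_imaginary_axis unfolding h_def by (rule integrable_on_lborel)
  have hJ: "integral UNIV h = axis_integral"
    unfolding axis_integral_def h_def by (rule integral_lborel[OF integrable_imaginary_axis])
  have "(h has_integral axis_integral) UNIV" using hi hJ by (simp add: has_integral_integrable_integral)
  then have ev: "\<forall>e>0. \<exists>B>0. \<forall>u v. ball 0 B \<subseteq> cbox u v \<longrightarrow> norm (integral (cbox u v) h - axis_integral) < e"
    by (subst (asm) has_integral') (auto simp: integral_unique; metis integral_unique)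
  have lim: "((\<lambda>x. integral {a x..b x} h) \<longlongrightarrow> axis_integral) L"
  proof (rule tendstoI)
    fix e :: real assume "0 < e"
    with ev obtain B where B: "0 < B" "\<And>u v. ball 0 B \<subseteq> cbox u v \<Longrightarrow> norm (integral (cbox u v) h - axis_integral) < e"
      by meson
    have "\<forall>\<^sub>F x in L. a x \<le> - B" "\<forall>\<^sub>F x in L. B \<le> b x"
      using assms by (auto simp: filterlim_at_bot filterlim_at_top)
    then show "\<forall>\<^sub>F x in L. dist (integral {a x..b x} h) axis_integral < e"
    proof eventually_elim
      case (elim x)
      then have "ball 0 B \<subseteq> cbox (a x) (b x)" by (auto simp: dist_norm abs_less_iff)
      then show ?case using B(2)[of "a x" "b x"] by (simp add: dist_norm)
    qed
  qed
  have "\<forall>\<^sub>F x in L. a x \<le> 0" "\<forall>\<^sub>F x in L. 0 \<le> b x"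
    using assms by (auto simp: filterlim_at_bot filterlim_at_top)
  then have "\<forall>\<^sub>F x in L. \<i> * integral {a x..b x} h = seg_integral (\<i> * of_real (a x)) (\<i> * of_real (b x))"
  proof eventually_elim
    case (elim x)
    have re: "Re z = 0" if "z \<in> closed_segment (\<i> * of_real u) (\<i> * of_real v)" for z u v
      using that by (auto simp: in_segment)
    have np: "closed_segment (\<i> * of_real u) (\<i> * of_real v) \<inter> poles = {}" for u v
      using re poles_real(2) by force
    have R: "seg_integral 0 (0 + of_real r * d) = d * integral {0..r} (\<lambda>x. integrand (0 + of_real x * d))"
      if "0 \<le> r" "d = \<i> \<or> d = - \<i>" for r d
    proof (rule contour_integral_ray[OF that(1)])
      show "continuous_on (closed_segment 0 (0 + complex_of_real r * d)) integrand"
        using np[of 0 r] np[of 0 "- r"] that(2) by (intro continuous_integrand) (auto simp: mult.commute)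
    qed
    have "seg_integral (\<i> * of_real (a x)) (\<i> * of_real (b x)) =
       seg_integral (\<i> * of_real (a x)) 0 + seg_integral 0 (\<i> * of_real (b x))"
    proof (rule contour_integral_split_linepath[OF continuous_integrand[OF np]])
      have "0 \<in> closed_segment (a x) (b x)" using elim by (simp add: closed_segment_eq_real_ivl)
      then have "\<i> * of_real 0 \<in> (\<lambda>y. \<i> * complex_of_real y) ` closed_segment (a x) (b x)" by blast
      also have "linear (\<lambda>y. \<i> * complex_of_real y)"
        by (intro linearI) (simp_all add: algebra_simps scaleR_conv_of_real)
      then have "(\<lambda>y. \<i> * complex_of_real y) ` closed_segment (a x) (b x) = closed_segment (\<i> * of_real (a x)) (\<i> * of_real (b x))"
        by (rule closed_segment_linear_image[symmetric])
      finally show "0 \<in> closed_segment (\<i> * of_real (a x)) (\<i> * of_real (b x))" by simp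
    qed
    also have "seg_integral (\<i> * of_real (a x)) 0 = - seg_integral 0 (\<i> * of_real (a x))"
      using contour_integral_reverse_linepath[OF continuous_integrand[OF np[of "a x" 0]]] by simp
    also have "seg_integral 0 (\<i> * of_real (a x)) = - \<i> * integral {0..- a x} (\<lambda>y. integrand (0 + of_real y * - \<i>))"
      using R[of "- a x" "- \<i>"] elim by (simp add: mult.commute)
    also have "integral {0..- a x} (\<lambda>y. integrand (0 + of_real y * - \<i>)) = integral {a x..0} h"
      using Henstock_Kurzweil_Integration.integral_reflect_real[of 0 "a x" h] by (simp add: h_def mult.commute)
    also have "seg_integral 0 (\<i> * of_real (b x)) = \<i> * integral {0..b x} h"
      using R[of "b x" "\<i>"] elim by (simp add: h_def mult.commute)
    also have "- (- \<i> * integral {a x..0} h) + \<i> * integral {0..b x} h = \<i> * (integral {a x..0} h + integral {0..b x} h)"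
      by (simp add: algebra_simps)
    also have "integral {a x..0} h + integral {0..b x} h = integral {a x..b x} h"
      using elim by (intro Henstock_Kurzweil_Integration.integral_combine integrable_on_subinterval[OF hi]) auto
    finally show ?case by simp
  qed
  moreover have "((\<lambda>x. \<i> * integral {a x..b x} h) \<longlongrightarrow> \<i> * axis_integral) L"
    by (intro tendsto_intros lim)
  ultimately show ?thesis by (rule Lim_transform_eventually[rotated])
qed

end

section \<open>Vertical contours\<close>

lemma closed_segment_box:
  fixes a b z :: complex
  assumes "z \<in> closed_segment a b"
  shows "min (Re a) (Re b) \<le> Re z" "Re z \<le> max (Re a) (Re b)"
    and "min (Im a) (Im b) \<le> Im z" "Im z \<le> max (Im a) (Im b)"
proof -
  obtain u where "0 \<le> u" "u \<le> 1" "z = (1 - u) *\<^sub>R a + u *\<^sub>R b"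
    using assms unfolding in_segment by blast
  then have "Re z \<in> closed_segment (Re a) (Re b)" "Im z \<in> closed_segment (Im a) (Im b)"
    unfolding in_segment by auto
  then show "min (Re a) (Re b) \<le> Re z" "Re z \<le> max (Re a) (Re b)"
    and "min (Im a) (Im b) \<le> Im z" "Im z \<le> max (Im a) (Im b)"
    by (auto simp: closed_segment_eq_real_ivl split: if_splits)
qed

lemma path_image_Re_bounded:
  assumes "valid_path g"
  obtains M where "\<And>z. z \<in> path_image g \<Longrightarrow> Re z \<le> M"
proof -
  obtain B where "\<forall>z\<in>path_image g. norm z \<le> B"
    using compact_imp_bounded[OF compact_path_image[OF valid_path_imp_path[OF assms]]]
    unfolding bounded_iff by blast
  then have "\<And>z. z \<in> path_image g \<Longrightarrow> Re z \<le> B" by (meson complex_Re_le_cmod order_trans)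
  then show thesis by (rule that)
qed

lemma path_image_closed_contour:
  fixes g :: "real \<Rightarrow> complex" and R :: real and \<kappa> :: contour_kind
  defines "p \<equiv> pathstart g + of_real R * start_dir \<kappa>" and "q \<equiv> pathfinish g + of_real R * end_dir \<kappa>"
    and "e \<equiv> (if \<kappa> = Right_Loop then of_real R else - of_real R)"
  shows "path_image (closed_contour \<kappa> g R) = closed_segment p (pathstart g) \<union> path_image g \<union>
     closed_segment (pathfinish g) q \<union> closed_segment q (q + e) \<union> closed_segment (q + e) (p + e) \<union>
     closed_segment (p + e) p"
    and "valid_path g \<Longrightarrow> valid_path (closed_contour \<kappa> g R)"
    and "pathstart (closed_contour \<kappa> g R) = p" "pathfinish (closed_contour \<kappa> g R) = p"
  unfolding closed_contour_def truncated_contour_def Let_def p_def[symmetric] q_def[symmetric] e_def[symmetric]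
  by (simp_all add: path_image_join Un_assoc)

lemma contour_integral_closed_contour:
  fixes g :: "real \<Rightarrow> complex" and R :: real and \<kappa> :: contour_kind
  defines "p \<equiv> pathstart g + of_real R * start_dir \<kappa>" and "q \<equiv> pathfinish g + of_real R * end_dir \<kappa>"
    and "e \<equiv> (if \<kappa> = Right_Loop then of_real R else - of_real R)"
  assumes "valid_path g" "h contour_integrable_on g"
    and "continuous_on (path_image (closed_contour \<kappa> g R)) h"
  shows "contour_integral (closed_contour \<kappa> g R) h =
     contour_integral (linepath p (pathstart g)) h + contour_integral g h +
     contour_integral (linepath (pathfinish g) q) h + contour_integral (linepath q (q + e)) h +
     contour_integral (linepath (q + e) (p + e)) h + contour_integral (linepath (p + e) p) h"
proof -
  note * = assms(6)[unfolded path_image_closed_contour, folded p_def q_def e_def]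
  have "h contour_integrable_on linepath p (pathstart g)" "h contour_integrable_on linepath (pathfinish g) q"
    "h contour_integrable_on linepath q (q + e)" "h contour_integrable_on linepath (q + e) (p + e)"
    "h contour_integrable_on linepath (p + e) p"
    by (intro contour_integrable_continuous_linepath continuous_on_subset[OF *]; blast)+
  then show ?thesis
    unfolding closed_contour_def truncated_contour_def Let_def p_def[symmetric] q_def[symmetric] e_def[symmetric]
    using assms(4,5) by (simp add: algebra_simps)
qed

context mellin_barnes
begin

lemma disjoint_polesI: "(\<And>z. z \<in> S \<Longrightarrow> Im z \<noteq> 0 \<or> Re z < 1) \<Longrightarrow> S \<inter> poles = {}"
  by (metis disjoint_iff leD poles_real)

lemma horizontal_segment_avoids_poles:
  assumes "Im a = Im b" "Im a \<noteq> 0"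
  shows "closed_segment a b \<inter> poles = {}"
proof (intro disjoint_polesI disjI1)
  fix z assume "z \<in> closed_segment a b"
  from closed_segment_box(3,4)[OF this] assms show "Im z \<noteq> 0" by simp
qed

text \<open>The contours in the definition of the Fox function for \<open>M = 0\<close> and \<open>N = 1\<close>: all poles of the Gamma factors of the
  numerator belong to the right of them.\<close>

definition admissible :: "contour_kind \<Rightarrow> (real \<Rightarrow> complex) \<Rightarrow> bool" where
  "admissible \<kappa> g \<longleftrightarrow> infinite_contour \<kappa> g \<and> (\<forall>s\<in>poles. right_of_contour \<kappa> g s)"

lemma admissible_valid: "admissible \<kappa> g \<Longrightarrow> valid_path g"
  by (simp add: admissible_def infinite_contour_def)

lemma ray_in_closed_contour:
  assumes "0 \<le> r" "r \<le> R"
  shows "pathstart g + of_real r * start_dir \<kappa> \<in> path_image (closed_contour \<kappa> g R)"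
    and "pathfinish g + of_real r * end_dir \<kappa> \<in> path_image (closed_contour \<kappa> g R)"
proof -
  have seg: "a + of_real r * d \<in> closed_segment a (a + of_real R * d)" for a d :: complex
  proof (cases "R = 0")
    case False
    then show ?thesis unfolding in_segment using assms
      by (intro exI[of _ "r / R"]) (auto simp: scaleR_conv_of_real field_simps)
  qed (use assms in auto)
  show "pathstart g + of_real r * start_dir \<kappa> \<in> path_image (closed_contour \<kappa> g R)"
    unfolding path_image_closed_contour using seg closed_segment_commute by blast
  show "pathfinish g + of_real r * end_dir \<kappa> \<in> path_image (closed_contour \<kappa> g R)"
    unfolding path_image_closed_contour using seg by blast
qed

lemma admissible_avoids_poles:
  assumes "admissible \<kappa> g"
  shows "0 \<le> r \<Longrightarrow> pathstart g + of_real r * start_dir \<kappa> \<notin> poles"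
    and "0 \<le> r \<Longrightarrow> pathfinish g + of_real r * end_dir \<kappa> \<notin> poles"
    and "path_image g \<inter> poles = {}"
proof -
  have ev: "\<exists>R\<ge>r. s \<notin> path_image (closed_contour \<kappa> g R)" if "s \<in> poles" for s r
  proof -
    have "\<forall>\<^sub>F R in at_top. s \<notin> path_image (closed_contour \<kappa> g R)"
      using assms that by (auto simp: admissible_def right_of_contour_def elim: eventually_mono)
    then have "\<forall>\<^sub>F R in at_top. r \<le> R \<and> s \<notin> path_image (closed_contour \<kappa> g R)"
      by (intro eventually_conj eventually_ge_at_top)
    then show ?thesis using eventually_happens'[OF trivial_limit_at_top_linorder] by blast
  qed
  show "pathstart g + of_real r * start_dir \<kappa> \<notin> poles" if "0 \<le> r"
    using ev[of "pathstart g + of_real r * start_dir \<kappa>" r] ray_in_closed_contour(1)[OF that] by blast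
  show "pathfinish g + of_real r * end_dir \<kappa> \<notin> poles" if "0 \<le> r"
    using ev[of "pathfinish g + of_real r * end_dir \<kappa>" r] ray_in_closed_contour(2)[OF that] by blast
  show "path_image g \<inter> poles = {}"
    using ev[of _ 0] unfolding path_image_closed_contour by blast
qed

lemma admissible_segments:
  assumes "admissible \<kappa> g" "0 \<le> r"
  shows "closed_segment (pathstart g) (pathstart g + of_real r * start_dir \<kappa>) \<inter> poles = {}"
    and "closed_segment (pathfinish g) (pathfinish g + of_real r * end_dir \<kappa>) \<inter> poles = {}"
proof -
  have seg: "\<exists>x\<ge>0. z = a + of_real x * d" if "z \<in> closed_segment a (a + of_real r * d)" for z a d :: complex
  proof -
    from that obtain u where "0 \<le> u" "z = (1 - u) *\<^sub>R a + u *\<^sub>R (a + of_real r * d)"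
      unfolding in_segment by blast
    then show ?thesis using assms(2)
      by (intro exI[of _ "u * r"]) (auto simp: scaleR_conv_of_real algebra_simps)
  qed
  show "closed_segment (pathstart g) (pathstart g + of_real r * start_dir \<kappa>) \<inter> poles = {}"
    "closed_segment (pathfinish g) (pathfinish g + of_real r * end_dir \<kappa>) \<inter> poles = {}"
    using seg admissible_avoids_poles[OF assms(1)] by blast+
qed

text \<open>The two rays may be truncated at different lengths. This is needed when a right loop is cut by a
  vertical line, since its two ends need not have the same real part.\<close>

lemma infinite_contour_integral_limit:
  assumes adm: "admissible \<kappa> g" and I: "has_infinite_contour_integral integrand I \<kappa> g"
    and a: "filterlim a at_top L" and b: "filterlim b at_top L"
  shows "((\<lambda>x. seg_integral (pathstart g + of_real (a x) * start_dir \<kappa>) (pathstart g) +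
       contour_integral g integrand +
       seg_integral (pathfinish g) (pathfinish g + of_real (b x) * end_dir \<kappa>)) \<longlongrightarrow> I) L"
proof -
  from I obtain I0 I1 I2 where
    I0: "((\<lambda>r. integrand (pathstart g + of_real r * start_dir \<kappa>)) has_integral I0) {0..}" and
    I1: "(integrand has_contour_integral I1) g" and
    I2: "((\<lambda>r. integrand (pathfinish g + of_real r * end_dir \<kappa>)) has_integral I2) {0..}" and
    eq: "I = - start_dir \<kappa> * I0 + I1 + end_dir \<kappa> * I2"
    unfolding has_infinite_contour_integral_def by blast
  have lim: "((\<lambda>x. seg_integral w (w + of_real (c x) * d)) \<longlongrightarrow> d * I') L"
    if c: "filterlim c at_top L" and I': "((\<lambda>r. integrand (w + of_real r * d)) has_integral I') {0..}"
      and np: "\<And>r. 0 \<le> r \<Longrightarrow> closed_segment w (w + of_real r * d) \<inter> poles = {}" for w d I' c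
  proof -
    have "\<forall>\<^sub>F x in L. 0 \<le> c x" using c by (auto simp: filterlim_at_top)
    then have "\<forall>\<^sub>F x in L. d * integral {0..0 + c x} (\<lambda>r. integrand (w + of_real r * d)) =
        seg_integral w (w + of_real (c x) * d)"
    proof eventually_elim
      case (elim x)
      then show ?case
        using contour_integral_ray[OF elim continuous_integrand[OF np[OF elim]]] by simp
    qed
    moreover have "((\<lambda>x. d * integral {0..0 + c x} (\<lambda>r. integrand (w + of_real r * d))) \<longlongrightarrow> d * I') L"
      by (intro tendsto_intros filterlim_compose[OF has_integral_atLeast_tendsto[OF I'] c])
    ultimately show ?thesis by (rule Lim_transform_eventually[rotated])
  qed
  have rev: "\<forall>\<^sub>F x in L. - seg_integral (pathstart g) (pathstart g + of_real (a x) * start_dir \<kappa>) =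
      seg_integral (pathstart g + of_real (a x) * start_dir \<kappa>) (pathstart g)"
  proof -
    have "\<forall>\<^sub>F x in L. 0 \<le> a x" using a by (auto simp: filterlim_at_top)
    then show ?thesis
    proof eventually_elim
      case (elim x)
      have "closed_segment (pathstart g + of_real (a x) * start_dir \<kappa>) (pathstart g) \<inter> poles = {}"
        using admissible_segments(1)[OF adm elim] by (simp add: closed_segment_commute)
      then show ?case
        using contour_integral_reverse_linepath[OF continuous_integrand] by metis
    qed
  qed
  have "((\<lambda>x. seg_integral (pathstart g + of_real (a x) * start_dir \<kappa>) (pathstart g))
      \<longlongrightarrow> - (start_dir \<kappa> * I0)) L"
    by (rule Lim_transform_eventually[OF tendsto_minus[OF lim[OF a I0 admissible_segments(1)[OF adm]]] rev])
  then have "((\<lambda>x. seg_integral (pathstart g + of_real (a x) * start_dir \<kappa>) (pathstart g) +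
       contour_integral g integrand +
       seg_integral (pathfinish g) (pathfinish g + of_real (b x) * end_dir \<kappa>))
     \<longlongrightarrow> - (start_dir \<kappa> * I0) + contour_integral g integrand + end_dir \<kappa> * I2) L"
    by (intro tendsto_add tendsto_const lim[OF b I2 admissible_segments(2)[OF adm]])
  then show ?thesis
    unfolding eq using contour_integral_unique[OF I1] by simp
qed

lemma half_plane_primitive:
  obtains \<Phi> where "\<And>a b. Re a < 1 \<Longrightarrow> Re b < 1 \<Longrightarrow> seg_integral a b = \<Phi> b - \<Phi> a"
proof -
  have "integrand holomorphic_on {s. Re s < 1}"
    by (rule holomorphic_on_subset[OF holomorphic_integrand]) (use poles_real(2) in force)
  then obtain \<Phi> where \<Phi>: "\<And>s. s \<in> {s. Re s < 1} \<Longrightarrow> (\<Phi> has_field_derivative integrand s) (at s)"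
    using holomorphic_convex_primitive'[OF convex_halfspace_Re_lt open_halfspace_Re_lt, of integrand 1]
      at_within_open[OF _ open_halfspace_Re_lt, of _ 1] by metis
  have "seg_integral a b = \<Phi> b - \<Phi> a" if "Re a < 1" "Re b < 1" for a b
  proof -
    have "closed_segment a b \<subseteq> {s. Re s < 1}"
      using that by (intro closed_segment_subset convex_halfspace_Re_lt) auto
    then have "(integrand has_contour_integral (\<Phi> (pathfinish (linepath a b)) - \<Phi> (pathstart (linepath a b)))) (linepath a b)"
      by (intro contour_integral_primitive[of "{s. Re s < 1}"])
         (auto intro: has_field_derivative_at_within[OF \<Phi>])
    then show ?thesis by (simp add: contour_integral_unique)
  qed
  then show thesis by (rule that)
qed

text \<open>The integrand has a primitive for \<open>Re s < 1\<close>. If \<open>p\<close> and \<open>q\<close> lie further to the right, the horizontal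
  sides are split where they cross the imaginary axis, and only the part on the left is deformed.\<close>

lemma shift_to_imaginary_axis:
  assumes q: "Re q = Re p" "0 < Im q" "Im p < 0" and R: "\<bar>Re p\<bar> \<le> R"
  shows "seg_integral q (q - of_real R) +
      seg_integral (q - of_real R) (p - of_real R) + seg_integral (p - of_real R) p =
    seg_integral q (\<i> * of_real (Im q)) +
      seg_integral (\<i> * of_real (Im q)) (\<i> * of_real (Im p)) +
      seg_integral (\<i> * of_real (Im p)) p"
proof -
  obtain \<Phi> where \<Phi>: "\<And>a b. Re a < 1 \<Longrightarrow> Re b < 1 \<Longrightarrow> seg_integral a b = \<Phi> b - \<Phi> a"
    by (rule half_plane_primitive) blast
  show ?thesis
  proof (cases "Re p < 1")
    case True
    have "0 \<le> R" using R by simp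
    then show ?thesis using True q by (simp add: \<Phi>)
  next
    case False
    note np = horizontal_segment_avoids_poles
    have seg: "\<i> * of_real (Im z) \<in> closed_segment z (z - of_real R)" if "Re z = Re p" for z
    proof -
      have R0: "0 < R" "Re p \<le> R" using False R by auto
      then have "\<i> * of_real (Im z) = (1 - Re p / R) *\<^sub>R z + (Re p / R) *\<^sub>R (z - of_real R)"
        using that by (simp add: complex_eq_iff field_simps)
      then show ?thesis unfolding in_segment using R0 False by (intro exI[of _ "Re p / R"]) auto
    qed
    have R1: "Re p - R < 1" using R False by auto
    have "seg_integral q (q - of_real R) = seg_integral q (\<i> * of_real (Im q)) +
        seg_integral (\<i> * of_real (Im q)) (q - of_real R)"
    proof (rule contour_integral_split_linepath)
      show "continuous_on (closed_segment q (q - of_real R)) integrand"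
        using q by (intro continuous_integrand np) auto
      show "\<i> * of_real (Im q) \<in> closed_segment q (q - of_real R)"
        using q by (intro seg) simp
    qed
    moreover have "seg_integral (p - of_real R) p =
        seg_integral (p - of_real R) (\<i> * of_real (Im p)) + seg_integral (\<i> * of_real (Im p)) p"
    proof (rule contour_integral_split_linepath)
      show "continuous_on (closed_segment (p - of_real R) p) integrand"
        using q by (intro continuous_integrand np) auto
      show "\<i> * of_real (Im p) \<in> closed_segment (p - of_real R) p"
        using seg[of p] by (subst closed_segment_commute) simp
    qed
    ultimately show ?thesis using q R1 by (simp add: \<Phi>)
  qed
qed

lemma horizontal_integral_bound:
  assumes "Im a = Im b" "Re a \<le> Re b \<or> Re b \<le> Re a" and ne: "Im a \<noteq> 0"
    and B: "\<And>s. min (Re a) (Re b) \<le> Re s \<Longrightarrow> Re s \<le> max (Re a) (Re b) \<Longrightarrow> Im s = Im a \<Longrightarrow> norm (integrand s) \<le> B"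
  shows "norm (seg_integral a b) \<le> B * \<bar>Re b - Re a\<bar>"
proof -
  have mem: "min (Re a) (Re b) \<le> Re z \<and> Re z \<le> max (Re a) (Re b) \<and> Im z = Im a" if z: "z \<in> closed_segment a b" for z
    using closed_segment_box[OF z] assms(1) by simp
  have "norm (integrand a) \<le> B" by (rule B) auto
  then have "0 \<le> B" using norm_ge_zero[of "integrand a"] by linarith
  moreover have "integrand contour_integrable_on linepath a b"
    by (intro integrable_on_segment horizontal_segment_avoids_poles assms(1) ne)
  ultimately have "norm (seg_integral a b) \<le> B * norm (b - a)"
  proof (intro contour_integral_bound_linepath)
    fix z assume "z \<in> closed_segment a b"
    from mem[OF this] show "norm (integrand z) \<le> B" by (intro B) auto
  qed
  moreover have "norm (b - a) = \<bar>Re b - Re a\<bar>" using assms(1) by (simp add: norm_complex_def)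
  ultimately show ?thesis by simp
qed

text \<open>The curve that closes the truncated contour on the left winds around no pole: for the finitely many
  poles with real part at most \<open>M\<close> this is the hypothesis, and the others lie to the right of the whole
  curve. By Cauchy's theorem the truncated contour can be replaced by the other three sides, and these
  by a segment of the imaginary axis and two horizontal connections, which vanish in the limit.
  The left side itself has to be moved back first, since the integrand explodes to the left.\<close>

lemma vertical_contour_integral:
  assumes adm: "admissible Vertical g" and I: "has_infinite_contour_integral integrand I Vertical g"
  shows "I = \<i> * axis_integral"
proof -
  define \<gamma> where "\<gamma> = Re (pathstart g)"
  have vp: "valid_path g" by (rule admissible_valid[OF adm])
  have "infinite_contour Vertical g" using adm unfolding admissible_def by (rule conjunct1)
  from this[unfolded infinite_contour_def, THEN conjunct2, THEN conjunct2]
  have ends: "Re (pathstart g) = \<gamma>" "Re (pathfinish g) = \<gamma>"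
    by (simp_all add: \<gamma>_def)
  define p q where "p = (\<lambda>R::real. pathstart g + of_real R * start_dir Vertical)"
    and "q = (\<lambda>R::real. pathfinish g + of_real R * end_dir Vertical)"
  have pq: "Re (p R) = \<gamma>" "Re (q R) = \<gamma>" "Im (p R) = Im (pathstart g) - R" "Im (q R) = Im (pathfinish g) + R" for R
    using ends by (simp_all add: p_def q_def)
  obtain M where M: "\<And>z. z \<in> path_image g \<Longrightarrow> Re z \<le> M"
    by (rule path_image_Re_bounded[OF vp]) blast
  have M\<gamma>: "\<gamma> \<le> M" using M[OF pathstart_in_path_image] by (simp add: \<gamma>_def)
  have "\<forall>\<^sub>F R in at_top. \<forall>z\<in>{z \<in> poles. Re z \<le> M}. z \<notin> path_image (closed_contour Vertical g R) \<and>
      winding_number (closed_contour Vertical g R) z = 0"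
    using adm by (intro eventually_ball_finite finite_poles) (auto simp: admissible_def right_of_contour_def)
  moreover have "\<forall>\<^sub>F R in at_top. max (max \<bar>\<gamma>\<bar> 1) (max (\<bar>Im (pathstart g)\<bar> + 1) (\<bar>Im (pathfinish g)\<bar> + 1)) \<le> (R::real)"
    by (rule eventually_ge_at_top)
  ultimately have eq: "\<forall>\<^sub>F R in at_top. seg_integral (p R) (pathstart g) + contour_integral g integrand +
      seg_integral (pathfinish g) (q R) =
      seg_integral (\<i> * of_real (Im (p R))) (\<i> * of_real (Im (q R))) -
      seg_integral (q R) (\<i> * of_real (Im (q R))) -
      seg_integral (\<i> * of_real (Im (p R))) (p R)"
  proof eventually_elim
    case (elim R)
    let ?c = "closed_contour Vertical g R"
    have R: "\<bar>\<gamma>\<bar> \<le> R" "1 \<le> R" "\<bar>Im (pathstart g)\<bar> + 1 \<le> R" "\<bar>Im (pathfinish g)\<bar> + 1 \<le> R" using elim(2) by auto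
    have sub: "path_image ?c \<subseteq> {s. Re s \<le> M}"
    proof -
      have "closed_segment a b \<subseteq> {s. Re s \<le> M}" if "Re a \<le> M" "Re b \<le> M" for a b
        using that by (intro closed_segment_subset convex_halfspace_Re_le) auto
      then show ?thesis
        unfolding path_image_closed_contour p_def[symmetric] q_def[symmetric]
        using M pq ends M\<gamma> R by (intro Un_least) auto
    qed
    have w: "z \<notin> path_image ?c \<and> winding_number ?c z = 0" if z: "z \<in> poles" for z
    proof (cases "Re z \<le> M")
      case False
      then have "winding_number ?c z = 0"
        using sub path_image_closed_contour[where g = g and R = R and \<kappa> = Vertical] vp
        by (intro winding_number_zero_outside[of _ "{s. Re s \<le> M}"] convex_halfspace_Re_le)
           (auto intro: valid_path_imp_path)
      then show ?thesis using False sub by blast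
    qed (use elim(1) z in auto)
    have "(integrand has_contour_integral 0) ?c"
      by (rule Cauchy_theorem_global[of "- poles"])
         (use closed_poles holomorphic_integrand w vp path_image_closed_contour[where g = g and R = R and \<kappa> = Vertical] in auto)
    then have "contour_integral ?c integrand = 0" by (rule contour_integral_unique)
    moreover have "path_image ?c \<inter> poles = {}" using w by blast
    moreover have "path_image g \<inter> poles = {}" by (rule admissible_avoids_poles(3)[OF adm])
    then have "integrand contour_integrable_on g"
      using contour_integrable_holomorphic_simple[OF holomorphic_integrand open_Compl[OF closed_poles] vp] by blast
    ultimately have sum: "seg_integral (p R) (pathstart g) + contour_integral g integrand +
       seg_integral (pathfinish g) (q R) +
       (seg_integral (q R) (q R - of_real R) +
       seg_integral (q R - of_real R) (p R - of_real R) + seg_integral (p R - of_real R) (p R)) = 0"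
      using contour_integral_closed_contour[OF vp, where h = integrand and R = R and \<kappa> = Vertical] continuous_integrand[of "path_image ?c"]
      unfolding p_def q_def by (simp add: add.assoc)
    have sh: "seg_integral (q R) (q R - of_real R) +
       seg_integral (q R - of_real R) (p R - of_real R) + seg_integral (p R - of_real R) (p R) =
       seg_integral (q R) (\<i> * of_real (Im (q R))) +
       seg_integral (\<i> * of_real (Im (q R))) (\<i> * of_real (Im (p R))) +
       seg_integral (\<i> * of_real (Im (p R))) (p R)"
      using R pq by (intro shift_to_imaginary_axis) auto
    have "closed_segment (\<i> * of_real (Im (q R))) (\<i> * of_real (Im (p R))) \<inter> poles = {}"
      by (intro disjoint_polesI) (auto dest: closed_segment_box(2))
    then have "seg_integral (\<i> * of_real (Im (q R))) (\<i> * of_real (Im (p R))) =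
        - seg_integral (\<i> * of_real (Im (p R))) (\<i> * of_real (Im (q R)))"
      by (intro contour_integral_reverse_linepath continuous_integrand)
    with sum show ?case unfolding sh by (simp add: eq_neg_iff_add_eq_0[symmetric])
  qed
  obtain C c where C: "0 < C" "0 < c"
    "\<And>s. - \<bar>\<gamma>\<bar> \<le> Re s \<Longrightarrow> 1 \<le> \<bar>Im s\<bar> \<Longrightarrow> norm (integrand s) \<le> C * exp (- c * \<bar>Im s\<bar> - Re s)"
    by (rule integrand_decay[of 1 "\<bar>\<gamma>\<bar>"]) auto
  have small: "((\<lambda>R. seg_integral (u R) (v R)) \<longlongrightarrow> 0) at_top"
    if uv: "\<And>R. Im (u R) = Im (v R)" "\<And>R. Re (u R) = 0 \<and> Re (v R) = \<gamma> \<or> Re (v R) = 0 \<and> Re (u R) = \<gamma>"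
      and y: "filterlim (\<lambda>R. \<bar>Im (u R)\<bar>) at_top at_top" for u v
  proof (rule Lim_null_comparison)
    have "\<forall>\<^sub>F R in at_top. 1 \<le> \<bar>Im (u R)\<bar>" using y by (auto simp: filterlim_at_top)
    then show "\<forall>\<^sub>F R in at_top. norm (seg_integral (u R) (v R)) \<le> C * exp \<bar>\<gamma>\<bar> * \<bar>\<gamma>\<bar> * exp (- (c * \<bar>Im (u R)\<bar>))"
    proof eventually_elim
      case (elim R)
      have "norm (seg_integral (u R) (v R)) \<le> C * exp (\<bar>\<gamma>\<bar> - c * \<bar>Im (u R)\<bar>) * \<bar>Re (v R) - Re (u R)\<bar>"
      proof (rule horizontal_integral_bound)
        show "Im (u R) \<noteq> 0" using elim by auto
        fix s assume s: "min (Re (u R)) (Re (v R)) \<le> Re s" "Im s = Im (u R)"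
        then have "- \<bar>\<gamma>\<bar> \<le> Re s" using uv(2)[of R] by auto
        then have "norm (integrand s) \<le> C * exp (- c * \<bar>Im (u R)\<bar> - Re s)" using C(3)[of s] s elim by simp
        also have "\<dots> \<le> C * exp (\<bar>\<gamma>\<bar> - c * \<bar>Im (u R)\<bar>)" using \<open>- \<bar>\<gamma>\<bar> \<le> Re s\<close> C(1) by (intro mult_left_mono) auto
        finally show "norm (integrand s) \<le> C * exp (\<bar>\<gamma>\<bar> - c * \<bar>Im (u R)\<bar>)" .
      qed (use uv in auto)
      also have "\<bar>Re (v R) - Re (u R)\<bar> = \<bar>\<gamma>\<bar>" using uv(2)[of R] by auto
      also have "C * exp (\<bar>\<gamma>\<bar> - c * \<bar>Im (u R)\<bar>) * \<bar>\<gamma>\<bar> = C * exp \<bar>\<gamma>\<bar> * \<bar>\<gamma>\<bar> * exp (- (c * \<bar>Im (u R)\<bar>))"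
        by (simp add: exp_diff exp_minus field_simps)
      finally show ?case .
    qed
    have "filterlim (\<lambda>R. c * \<bar>Im (u R)\<bar>) at_top at_top"
      using C(2) y by (rule filterlim_tendsto_pos_mult_at_top[OF tendsto_const])
    then have "((\<lambda>R. exp (- (c * \<bar>Im (u R)\<bar>))) \<longlongrightarrow> 0) at_top"
      by (intro filterlim_compose[OF exp_at_bot] filterlim_compose[OF filterlim_uminus_at_bot_at_top])
    from tendsto_mult_right_zero[OF this]
    show "((\<lambda>R. C * exp \<bar>\<gamma>\<bar> * \<bar>\<gamma>\<bar> * exp (- (c * \<bar>Im (u R)\<bar>))) \<longlongrightarrow> 0) at_top" .
  qed
  have bot: "filterlim (\<lambda>R. Im (p R)) at_bot at_top" and top: "filterlim (\<lambda>R. Im (q R)) at_top at_top"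
  proof -
    have shift: "filterlim (\<lambda>R::real. c + R) at_top at_top" for c
      by (rule filterlim_tendsto_add_at_top[OF tendsto_const filterlim_ident])
    show "filterlim (\<lambda>R. Im (q R)) at_top at_top" unfolding pq by (rule shift)
    show "filterlim (\<lambda>R. Im (p R)) at_bot at_top"
      using shift[of "- Im (pathstart g)"] unfolding pq filterlim_uminus_at_bot by simp
  qed
  have abs: "filterlim (\<lambda>R. \<bar>Im (p R)\<bar>) at_top at_top" "filterlim (\<lambda>R. \<bar>Im (q R)\<bar>) at_top at_top"
  proof -
    show "filterlim (\<lambda>R. \<bar>Im (q R)\<bar>) at_top at_top"
      by (rule filterlim_at_top_mono[OF top]) (simp add: eventuallyI)
    have "filterlim (\<lambda>R. - Im (p R)) at_top at_top" using bot by (simp add: filterlim_uminus_at_bot)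
    then show "filterlim (\<lambda>R. \<bar>Im (p R)\<bar>) at_top at_top"
      by (rule filterlim_at_top_mono) (simp add: eventuallyI)
  qed
  have "((\<lambda>R. seg_integral (\<i> * of_real (Im (p R))) (\<i> * of_real (Im (q R))) -
      seg_integral (q R) (\<i> * of_real (Im (q R))) -
      seg_integral (\<i> * of_real (Im (p R))) (p R)) \<longlongrightarrow> \<i> * axis_integral - 0 - 0) at_top"
    by (intro tendsto_diff imaginary_axis_limit bot top small) (use pq abs in auto)
  then have "((\<lambda>R. seg_integral (p R) (pathstart g) + contour_integral g integrand +
      seg_integral (pathfinish g) (q R)) \<longlongrightarrow> \<i> * axis_integral - 0 - 0) at_top"
    by (rule Lim_transform_eventually) (use eq in \<open>auto elim: eventually_mono\<close>)
  moreover have "((\<lambda>R. seg_integral (p R) (pathstart g) + contour_integral g integrand +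
      seg_integral (pathfinish g) (q R)) \<longlongrightarrow> I) at_top"
    unfolding p_def q_def by (rule infinite_contour_integral_limit[OF adm I filterlim_ident filterlim_ident])
  ultimately show ?thesis
    using tendsto_unique[OF trivial_limit_at_top_linorder] by fastforce
qed

end

section \<open>Right loops\<close>

text \<open>\<open>Ln (c (w - z))\<close> is a primitive of \<open>1 / (w - z)\<close> off the half-line from \<open>z\<close> on which \<open>c (w - z)\<close> is real and
  not positive.\<close>

lemma winding_number_zero_slit:
  assumes \<gamma>: "valid_path \<gamma>" "pathfinish \<gamma> = pathstart \<gamma>"
    and slit: "\<And>w. w \<in> path_image \<gamma> \<Longrightarrow> c * (w - z) \<notin> \<real>\<^sub>\<le>\<^sub>0"
  shows "winding_number \<gamma> z = 0"
proof -
  have ne: "c * (w - z) \<noteq> 0" if "w \<in> path_image \<gamma>" for w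
    using slit[OF that] by auto
  have "((\<lambda>w. 1 / (w - z)) has_contour_integral (Ln (c * (pathfinish \<gamma> - z)) - Ln (c * (pathstart \<gamma> - z)))) \<gamma>"
  proof (rule contour_integral_primitive[OF _ \<gamma>(1) order_refl])
    fix w assume w: "w \<in> path_image \<gamma>"
    have "((\<lambda>w. Ln (c * (w - z))) has_field_derivative 1 / (w - z)) (at w)"
      using slit[OF w] ne[OF w] by (auto intro!: derivative_eq_intros simp: field_simps)
    then show "((\<lambda>w. Ln (c * (w - z))) has_field_derivative 1 / (w - z)) (at w within path_image \<gamma>)"
      by (rule has_field_derivative_at_within)
  qed
  then have "contour_integral \<gamma> (\<lambda>w. 1 / (w - z)) = 0"
    using \<gamma>(2) by (simp add: contour_integral_unique)
  moreover have "z \<notin> path_image \<gamma>" using ne by auto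
  ultimately show ?thesis using winding_number_valid_path[OF \<gamma>(1)] by simp
qed

lemma horizontal_segment_mem:
  fixes a b c :: complex
  assumes "Im a = Im c" "Im b = Im c" "Re a \<le> Re c" "Re c \<le> Re b"
  shows "c \<in> closed_segment a b"
proof -
  have "Re c \<in> closed_segment (Re a) (Re b)" using assms by (simp add: closed_segment_eq_real_ivl)
  then obtain u where u: "0 \<le> u" "u \<le> 1" "Re c = (1 - u) * Re a + u * Re b" unfolding in_segment by auto
  then have "c = (1 - u) *\<^sub>R a + u *\<^sub>R b" using assms by (simp add: complex_eq_iff algebra_simps)
  with u show ?thesis unfolding in_segment by blast
qed

lemma vertical_segment_mem:
  fixes a b c :: complex
  assumes "Re a = Re c" "Re b = Re c" "Im a \<le> Im c" "Im c \<le> Im b"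
  shows "c \<in> closed_segment a b"
proof -
  have "Im c \<in> closed_segment (Im a) (Im b)" using assms by (simp add: closed_segment_eq_real_ivl)
  then obtain u where u: "0 \<le> u" "u \<le> 1" "Im c = (1 - u) * Im a + u * Im b" unfolding in_segment by auto
  then have "c = (1 - u) *\<^sub>R a + u *\<^sub>R b" using assms by (simp add: complex_eq_iff algebra_simps)
  with u show ?thesis unfolding in_segment by blast
qed

context mellin_barnes
begin

lemma pole_far_right: obtains z where "z \<in> poles" "M < Re z"
proof -
  obtain m :: nat where m: "M / \<alpha> < real m" using reals_Archimedean2 by blast
  then have "M < \<alpha> * real m" using alpha by (simp add: pos_divide_less_eq mult.commute)
  moreover have "\<alpha> * real m \<le> \<alpha> * (real k + real m)" using alpha by (intro mult_left_mono) auto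
  ultimately have "M < Re (of_real (1 + \<alpha> * (real k + real m)))" by simp
  then show thesis by (intro that) (auto simp: poles_eq)
qed

text \<open>Otherwise a pole beyond the real parts of \<open>g\<close> could be joined to infinity by a vertical half-line that
  does not meet the closed curve, and the winding number about it would be \<open>0\<close>.\<close>

lemma right_loop_heights:
  assumes adm: "admissible Right_Loop g"
  shows "Im (pathstart g) < 0" "0 < Im (pathfinish g)"
proof -
  let ?a = "Im (pathstart g)" and ?b = "Im (pathfinish g)"
  have vp: "valid_path g" by (rule admissible_valid[OF adm])
  have "infinite_contour Right_Loop g" using adm unfolding admissible_def by (rule conjunct1)
  from this[unfolded infinite_contour_def, THEN conjunct2, THEN conjunct2]
  have ab: "?a < ?b" by simp
  obtain M where M: "\<And>z. z \<in> path_image g \<Longrightarrow> Re z \<le> M"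
    by (rule path_image_Re_bounded[OF vp]) blast
  obtain z where z: "z \<in> poles" "M < Re z" by (rule pole_far_right)
  have "right_of_contour Right_Loop g z" using adm z(1) unfolding admissible_def by blast
  then have "\<forall>\<^sub>F R in at_top. z \<notin> path_image (closed_contour Right_Loop g R) \<and>
      winding_number (closed_contour Right_Loop g R) z = -1"
    unfolding right_of_contour_def by simp
  then obtain R where R: "z \<notin> path_image (closed_contour Right_Loop g R)"
      "winding_number (closed_contour Right_Loop g R) z = -1"
    using eventually_happens'[OF trivial_limit_at_top_linorder] by blast
  let ?c = "closed_contour Right_Loop g R"
  have cl: "valid_path ?c" "pathfinish ?c = pathstart ?c"
    using path_image_closed_contour[where g = g and R = R and \<kappa> = Right_Loop] vp by auto
  have im: "Re w \<le> M \<or> (?a \<le> Im w \<and> Im w \<le> ?b)" if w: "w \<in> path_image ?c" for w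
  proof -
    have "?a \<le> Im w \<and> Im w \<le> ?b" if "w \<in> closed_segment x y" "Im x \<in> {?a, ?b}" "Im y \<in> {?a, ?b}" for x y
      using closed_segment_box(3,4)[OF that(1)] that(2,3) ab by auto
    then show ?thesis
      using w M unfolding path_image_closed_contour by auto
  qed
  have Imz: "Im z = 0" by (rule poles_real(1)[OF z(1)])
  show "?a < 0"
  proof (rule ccontr)
    assume a: "\<not> ?a < 0"
    have "winding_number ?c z = 0"
    proof (rule winding_number_zero_slit[OF cl, of "- \<i>"])
      fix w assume w: "w \<in> path_image ?c"
      show "- \<i> * (w - z) \<notin> \<real>\<^sub>\<le>\<^sub>0"
      proof
        assume "- \<i> * (w - z) \<in> \<real>\<^sub>\<le>\<^sub>0"
        then have "Re w = Re z" "Im w \<le> 0" using Imz by (auto simp: complex_nonpos_Reals_iff)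
        then have "w = z" using im[OF w] z(2) a Imz by (auto simp: complex_eq_iff)
        then show False using w R(1) by simp
      qed
    qed
    then show False using R(2) by simp
  qed
  show "0 < ?b"
  proof (rule ccontr)
    assume b: "\<not> 0 < ?b"
    have "winding_number ?c z = 0"
    proof (rule winding_number_zero_slit[OF cl, of "\<i>"])
      fix w assume w: "w \<in> path_image ?c"
      show "\<i> * (w - z) \<notin> \<real>\<^sub>\<le>\<^sub>0"
      proof
        assume "\<i> * (w - z) \<in> \<real>\<^sub>\<le>\<^sub>0"
        then have "Re w = Re z" "0 \<le> Im w" using Imz by (auto simp: complex_nonpos_Reals_iff)
        then have "w = z" using im[OF w] z(2) b Imz by (auto simp: complex_eq_iff)
        then show False using w R(1) by simp
      qed
    qed
    then show False using R(2) by simp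
  qed
qed

text \<open>Midway between two consecutive poles.\<close>

definition cut_abscissa :: "nat \<Rightarrow> real" where "cut_abscissa j = 1 + \<alpha> * (real k + real j + 1 / 2)"

lemma cut_avoids_poles:
  assumes "z \<in> poles"
  shows "Re z \<noteq> cut_abscissa j" "Re z < cut_abscissa j + \<alpha> / 2 \<Longrightarrow> Re z < cut_abscissa j"
proof -
  obtain m where m: "z = of_real (1 + \<alpha> * (real k + real m))" using assms by (auto simp: poles_eq)
  have d: "Re z - cut_abscissa j = \<alpha> * (real m - real j - 1 / 2)" by (simp add: m cut_abscissa_def algebra_simps)
  have "real m - real j - 1 / 2 \<noteq> 0"
  proof
    assume "real m - real j - 1 / 2 = 0"
    then have "2 * real m = real (2 * j + 1)" by simp
    then have "2 * m = 2 * j + 1" by (metis of_nat_eq_iff of_nat_mult of_nat_numeral)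
    then show False by presburger
  qed
  then show "Re z \<noteq> cut_abscissa j" using d alpha by auto
  show "Re z < cut_abscissa j" if "Re z < cut_abscissa j + \<alpha> / 2"
  proof -
    have "\<alpha> * (real m - real j - 1 / 2) < \<alpha> * (1 / 2)" using d that by simp
    then have "real m - real j - 1 / 2 < 1 / 2" using alpha by (simp add: mult_less_cancel_left_pos)
    then have "real m < real (j + 1)" by simp
    then have "m \<le> j" by simp
    then have "real m - real j - 1 / 2 < 0" by simp
    then have "\<alpha> * (real m - real j - 1 / 2) < 0" using alpha by (simp add: mult_pos_neg)
    then show ?thesis using d by simp
  qed
qed

lemma filterlim_cut_abscissa: "filterlim cut_abscissa at_top sequentially"
proof -
  have "filterlim (\<lambda>j. (1 + \<alpha> * (real k + 1 / 2)) + \<alpha> * real j) at_top sequentially"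
    using alpha by (intro filterlim_tendsto_add_at_top[OF tendsto_const]
        filterlim_tendsto_pos_mult_at_top[OF tendsto_const] filterlim_real_sequentially) auto
  then show ?thesis by (simp add: cut_abscissa_def[abs_def] algebra_simps)
qed

text \<open>The part of a right loop on the left of the line \<open>Re s = X\<close>, closed along this line.\<close>

definition cut_loop :: "(real \<Rightarrow> complex) \<Rightarrow> real \<Rightarrow> real \<Rightarrow> complex" where
  "cut_loop g X = linepath (Complex X (Im (pathstart g))) (pathstart g) +++ g +++
     linepath (pathfinish g) (Complex X (Im (pathfinish g))) +++
     linepath (Complex X (Im (pathfinish g))) (Complex X (Im (pathstart g)))"

lemma cut_loop_props:
  shows "path_image (cut_loop g X) = closed_segment (Complex X (Im (pathstart g))) (pathstart g) \<union> path_image g \<union>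
      closed_segment (pathfinish g) (Complex X (Im (pathfinish g))) \<union>
      closed_segment (Complex X (Im (pathfinish g))) (Complex X (Im (pathstart g)))"
    and "pathfinish (cut_loop g X) = pathstart (cut_loop g X)"
    and "valid_path g \<Longrightarrow> valid_path (cut_loop g X)"
  unfolding cut_loop_def by (simp_all add: path_image_join Un_assoc)

lemma contour_integral_cut_loop:
  assumes "valid_path g" "h contour_integrable_on g" and c: "continuous_on (path_image (cut_loop g X)) h"
  shows "contour_integral (cut_loop g X) h =
     contour_integral (linepath (Complex X (Im (pathstart g))) (pathstart g)) h + contour_integral g h +
     contour_integral (linepath (pathfinish g) (Complex X (Im (pathfinish g)))) h +
     contour_integral (linepath (Complex X (Im (pathfinish g))) (Complex X (Im (pathstart g)))) h"
proof -
  note * = c[unfolded cut_loop_props(1)]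
  have "h contour_integrable_on linepath (Complex X (Im (pathstart g))) (pathstart g)"
    "h contour_integrable_on linepath (pathfinish g) (Complex X (Im (pathfinish g)))"
    "h contour_integrable_on linepath (Complex X (Im (pathfinish g))) (Complex X (Im (pathstart g)))"
    by (intro contour_integrable_continuous_linepath continuous_on_subset[OF *]; blast)+
  then show ?thesis unfolding cut_loop_def using assms(1,2) by (simp add: algebra_simps)
qed

text \<open>How far a right loop must be truncated before its winding number around a pole is \<open>-1\<close> may depend on
  the pole. The cut loop works for all poles on its left at once: it differs from a sufficiently long
  closed contour by a polygon to the right of \<open>z\<close>, where \<open>Ln (w - z)\<close> is a primitive of \<open>1 / (w - z)\<close>.\<close>

lemma winding_number_cut_loop:
  assumes adm: "admissible Right_Loop g" and M: "\<And>w. w \<in> path_image g \<Longrightarrow> Re w \<le> M" "M < X"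
    and z: "z \<in> poles" "Re z < X"
  shows "z \<notin> path_image (cut_loop g X)" "winding_number (cut_loop g X) z = -1"
proof -
  let ?p0 = "pathstart g" and ?q0 = "pathfinish g"
  let ?pX = "Complex X (Im ?p0)" and ?qX = "Complex X (Im ?q0)"
  let ?h = "\<lambda>w. 1 / (w - z)"
  have vp: "valid_path g" by (rule admissible_valid[OF adm])
  have ends: "Re ?p0 < X" "Re ?q0 < X" using M pathstart_in_path_image pathfinish_in_path_image by fastforce+
  have "right_of_contour Right_Loop g z" using adm z(1) unfolding admissible_def by blast
  then have "\<forall>\<^sub>F R in at_top. z \<notin> path_image (closed_contour Right_Loop g R) \<and>
      winding_number (closed_contour Right_Loop g R) z = -1"
    unfolding right_of_contour_def by simp
  then have "\<forall>\<^sub>F R in at_top. (z \<notin> path_image (closed_contour Right_Loop g R) \<and>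
      winding_number (closed_contour Right_Loop g R) z = -1) \<and> \<bar>X\<bar> + \<bar>Re ?p0\<bar> + \<bar>Re ?q0\<bar> \<le> R"
    by (rule eventually_conj[OF _ eventually_ge_at_top])
  then obtain R where R: "z \<notin> path_image (closed_contour Right_Loop g R)"
      "winding_number (closed_contour Right_Loop g R) z = -1" "\<bar>X\<bar> + \<bar>Re ?p0\<bar> + \<bar>Re ?q0\<bar> \<le> R"
    using eventually_happens'[OF trivial_limit_at_top_linorder] by blast
  define p q where "p = ?p0 + of_real R" and "q = ?q0 + of_real R"
  have pq: "Re p = Re ?p0 + R" "Re q = Re ?q0 + R" "Im p = Im ?p0" "Im q = Im ?q0" by (simp_all add: p_def q_def)
  have big: "X \<le> Re p" "X \<le> Re q" "0 \<le> R" using R(3) by (auto simp: pq)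
  let ?c = "closed_contour Right_Loop g R"
  have img: "path_image ?c = closed_segment p ?p0 \<union> path_image g \<union> closed_segment ?q0 q \<union>
     closed_segment q (q + of_real R) \<union> closed_segment (q + of_real R) (p + of_real R) \<union> closed_segment (p + of_real R) p"
    unfolding path_image_closed_contour by (simp add: p_def q_def)
  have mem: "?pX \<in> closed_segment p ?p0" "?qX \<in> closed_segment ?q0 q"
    using ends big by (auto simp: pq closed_segment_commute[of p] intro!: horizontal_segment_mem)
  have sub: "closed_segment ?pX ?p0 \<subseteq> path_image ?c" "closed_segment ?q0 ?qX \<subseteq> path_image ?c"
  proof -
    have "closed_segment ?pX ?p0 \<subseteq> closed_segment p ?p0" "closed_segment ?q0 ?qX \<subseteq> closed_segment ?q0 q"
      using mem by (simp_all add: subset_closed_segment)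
    then show "closed_segment ?pX ?p0 \<subseteq> path_image ?c" "closed_segment ?q0 ?qX \<subseteq> path_image ?c"
      unfolding img by blast+
  qed
  have vert: "z \<notin> closed_segment ?qX ?pX"
    using closed_segment_box(1,2)[of z ?qX ?pX] z(2) by auto
  show zT: "z \<notin> path_image (cut_loop g X)"
    unfolding cut_loop_props(1) using sub vert R(1) img by blast
  have hc: "continuous_on S ?h" if "z \<notin> S" for S using that by (intro continuous_intros) auto
  have hg: "?h contour_integrable_on g"
  proof (rule contour_integrable_holomorphic_simple[OF _ open_delete[OF open_UNIV] vp])
    show "?h holomorphic_on UNIV - {z}" by (intro holomorphic_intros) auto
    show "path_image g \<subseteq> UNIV - {z}" using R(1) img by auto
  qed
  have lin: "contour_integral (linepath a b) ?h = Ln (b - z) - Ln (a - z)" if "Re z < Re a" "Re z < Re b" for a b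
  proof -
    have "(?h has_contour_integral (Ln (pathfinish (linepath a b) - z) - Ln (pathstart (linepath a b) - z))) (linepath a b)"
    proof (rule contour_integral_primitive[OF _ _ order_refl])
      fix w assume "w \<in> path_image (linepath a b)"
      then have "Re z < Re w" using closed_segment_box(1)[of w a b] that by auto
      then have "w - z \<notin> \<real>\<^sub>\<le>\<^sub>0" "w \<noteq> z" by (auto simp: complex_nonpos_Reals_iff)
      then have "((\<lambda>w. Ln (w - z)) has_field_derivative ?h w) (at w)"
        by (auto intro!: derivative_eq_intros simp: inverse_eq_divide)
      then show "((\<lambda>w. Ln (w - z)) has_field_derivative ?h w) (at w within path_image (linepath a b))"
        by (rule has_field_derivative_at_within)
    qed simp
    then show ?thesis by (simp add: contour_integral_unique)
  qed
  have s1: "contour_integral (linepath p ?p0) ?h = contour_integral (linepath p ?pX) ?h + contour_integral (linepath ?pX ?p0) ?h"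
    using R(1) img mem by (intro contour_integral_split_linepath hc) auto
  have s2: "contour_integral (linepath ?q0 q) ?h = contour_integral (linepath ?q0 ?qX) ?h + contour_integral (linepath ?qX q) ?h"
    using R(1) img mem by (intro contour_integral_split_linepath hc) auto
  have "contour_integral ?c ?h = contour_integral (linepath p ?p0) ?h + contour_integral g ?h +
     contour_integral (linepath ?q0 q) ?h + contour_integral (linepath q (q + of_real R)) ?h +
     contour_integral (linepath (q + of_real R) (p + of_real R)) ?h + contour_integral (linepath (p + of_real R) p) ?h"
    using contour_integral_closed_contour[OF vp hg, where R = R and \<kappa> = Right_Loop] hc[OF R(1)]
    by (simp add: p_def q_def)
  also have "\<dots> = contour_integral (cut_loop g X) ?h"
    unfolding contour_integral_cut_loop[OF vp hg hc[OF zT]] s1 s2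
    using z(2) big by (simp add: lin)
  finally have "contour_integral (cut_loop g X) ?h = contour_integral ?c ?h" ..
  then show "winding_number (cut_loop g X) z = -1"
    using R(2) winding_number_valid_path[OF _ R(1)] winding_number_valid_path[OF cut_loop_props(3)[OF vp] zT]
      path_image_closed_contour(2)[OF vp, where R = R and \<kappa> = Right_Loop] by simp
qed

text \<open>The cut loop winds around each of the poles with real part below \<open>X\<close> once clockwise, the rectangle
  with corners \<open>- \<i>X\<close> and \<open>X + \<i>X\<close> once counterclockwise. By the residue theorem their integrals cancel,
  whatever the residues are.\<close>

lemma right_loop_truncated:
  assumes adm: "admissible Right_Loop g" and M: "\<And>w. w \<in> path_image g \<Longrightarrow> Re w \<le> M"
    and X: "X = cut_abscissa j" "M < X" "\<bar>Im (pathstart g)\<bar> < X" "\<bar>Im (pathfinish g)\<bar> < X"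
  shows "seg_integral (Complex X (Im (pathstart g))) (pathstart g) + contour_integral g integrand +
      seg_integral (pathfinish g) (Complex X (Im (pathfinish g))) =
    seg_integral (Complex 0 (- X)) (Complex 0 X) -
    (seg_integral (Complex 0 (- X)) (Complex X (- X)) +
     seg_integral (Complex X (- X)) (Complex X (Im (pathstart g))) +
     seg_integral (Complex X (Im (pathfinish g))) (Complex X X) +
     seg_integral (Complex X X) (Complex 0 X))"
proof -
  let ?p0 = "pathstart g" and ?q0 = "pathfinish g"
  let ?pX = "Complex X (Im ?p0)" and ?qX = "Complex X (Im ?q0)"
  define a1 a2 a3 a4 where a: "a1 = Complex 0 (- X)" "a2 = Complex X (- X)" "a3 = Complex X X" "a4 = Complex 0 X"
  have vp: "valid_path g" by (rule admissible_valid[OF adm])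
  have h: "Im ?p0 < 0" "0 < Im ?q0" using right_loop_heights[OF adm] by auto
  have X0: "0 < X" using X(3) by linarith
  have ends: "Re ?p0 < X" "Re ?q0 < X" using M X(2) pathstart_in_path_image pathfinish_in_path_image by fastforce+
  let ?S = "{s. Re s < X + \<alpha> / 2}" and ?P = "{z \<in> poles. Re z \<le> X}"
  let ?T = "cut_loop g X" and ?Q = "rectpath a1 a3"
  have finP: "finite ?P" by (rule finite_poles)
  have P: "Re z < X" "Im z = 0" "1 \<le> Re z" if "z \<in> ?P" for z
    using that cut_avoids_poles(1)[of z j] poles_real[of z] X(1) by force+
  have holo: "integrand holomorphic_on ?S - ?P"
  proof (rule holomorphic_on_subset[OF holomorphic_integrand])
    show "?S - ?P \<subseteq> - poles"
      using cut_avoids_poles(2)[of _ j] X(1) by force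
  qed
  have opS: "open ?S" and conS: "connected ?S"
    by (auto intro: open_halfspace_Re_lt convex_connected convex_halfspace_Re_lt)
  have halfplane: "winding_number \<gamma> z = 0"
    if "valid_path \<gamma>" "pathfinish \<gamma> = pathstart \<gamma>" "path_image \<gamma> \<subseteq> {s. Re s \<le> X}" "z \<notin> ?S" for \<gamma> z
    using that alpha
    by (intro winding_number_zero_outside[of _ "{s. Re s \<le> X}"] convex_halfspace_Re_le)
       (auto intro: valid_path_imp_path)
  have segX: "closed_segment u v \<subseteq> {s. Re s \<le> X}" if "Re u \<le> X" "Re v \<le> X" for u v
    using that by (intro closed_segment_subset convex_halfspace_Re_le) auto
  have Tsub: "path_image ?T \<subseteq> {s. Re s \<le> X}"
    unfolding cut_loop_props(1) using ends M X(2) by (intro Un_least segX) force+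
  have Tav: "z \<notin> path_image ?T" "winding_number ?T z = -1" if "z \<in> ?P" for z
    using winding_number_cut_loop[OF adm M X(2), of z] P(1)[OF that] that by auto
  have IT: "contour_integral ?T integrand = 2 * pi * \<i> * (\<Sum>z\<in>?P. winding_number ?T z * residue integrand z)"
  proof (rule Residue_theorem[OF opS conS finP holo cut_loop_props(3)[OF vp] cut_loop_props(2)])
    show "path_image ?T \<subseteq> ?S - ?P" using Tsub Tav alpha by force
    show "\<forall>z. z \<notin> ?S \<longrightarrow> winding_number ?T z = 0"
      using halfplane[OF cut_loop_props(3)[OF vp] cut_loop_props(2) Tsub] by blast
  qed
  have Qimg: "path_image ?Q = closed_segment a1 a2 \<union> closed_segment a2 a3 \<union> closed_segment a3 a4 \<union> closed_segment a4 a1"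
    by (simp add: rectpath_def Let_def path_image_join a Un_assoc)
  have Qsub: "path_image ?Q \<subseteq> {s. Re s \<le> X}"
    unfolding Qimg using X0 by (intro Un_least segX) (auto simp: a)
  have box: "z \<in> box a1 a3" if "z \<in> ?P" for z
    using P[OF that] X0 by (auto simp: in_box_complex_iff a)
  have Qav: "z \<notin> path_image ?Q" "winding_number ?Q z = 1" if "z \<in> ?P" for z
    using winding_number_rectpath[OF box[OF that]] path_image_rectpath_inter_box[of a1 a3] box[OF that] X0
    by (auto simp: a)
  have IQ: "contour_integral ?Q integrand = 2 * pi * \<i> * (\<Sum>z\<in>?P. winding_number ?Q z * residue integrand z)"
  proof (rule Residue_theorem[OF opS conS finP holo])
    show "path_image ?Q \<subseteq> ?S - ?P" using Qsub Qav alpha by force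
    show "\<forall>z. z \<notin> ?S \<longrightarrow> winding_number ?Q z = 0"
      using halfplane[of ?Q] Qsub by auto
  qed auto
  have zero: "contour_integral ?T integrand + contour_integral ?Q integrand = 0"
    unfolding IT IQ using Tav Qav by (simp add: sum_negf)
  have noX: "closed_segment u v \<inter> poles = {}" if "Re u = X" "Re v = X" for u v
  proof -
    have "Re z = X" if "z \<in> closed_segment u v" for z
      using closed_segment_box(1,2)[OF that] \<open>Re u = X\<close> \<open>Re v = X\<close> by simp
    then show ?thesis using cut_avoids_poles(1)[of _ j] X(1) by blast
  qed
  have Tnp: "path_image ?T \<inter> poles = {}"
  proof -
    have "path_image g \<inter> poles = {}" by (rule admissible_avoids_poles(3)[OF adm])
    moreover have "closed_segment ?pX ?p0 \<inter> poles = {}" "closed_segment ?q0 ?qX \<inter> poles = {}"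
      using h by (auto intro!: horizontal_segment_avoids_poles)
    ultimately show ?thesis using noX[of ?qX ?pX] unfolding cut_loop_props(1) by auto
  qed
  have gi: "integrand contour_integrable_on g"
    using contour_integrable_holomorphic_simple[OF holomorphic_integrand open_Compl[OF closed_poles] vp]
      admissible_avoids_poles(3)[OF adm] by blast
  have sT: "contour_integral ?T integrand = seg_integral ?pX ?p0 + contour_integral g integrand +
      seg_integral ?q0 ?qX + seg_integral ?qX ?pX"
    by (rule contour_integral_cut_loop[OF vp gi continuous_integrand[OF Tnp]])
  have np: "closed_segment a1 a2 \<inter> poles = {}" "closed_segment a3 a4 \<inter> poles = {}" "closed_segment a4 a1 \<inter> poles = {}"
    "closed_segment a2 a3 \<inter> poles = {}"
  proof -
    show "closed_segment a1 a2 \<inter> poles = {}" "closed_segment a3 a4 \<inter> poles = {}"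
      using X0 by (auto intro!: horizontal_segment_avoids_poles simp: a)
    show "closed_segment a4 a1 \<inter> poles = {}"
      by (intro disjoint_polesI disjI2) (auto dest!: closed_segment_box(2) simp: a)
    show "closed_segment a2 a3 \<inter> poles = {}" by (rule noX) (simp_all add: a)
  qed
  have sQ: "contour_integral ?Q integrand = seg_integral a1 a2 + seg_integral a2 a3 +
      seg_integral a3 a4 + seg_integral a4 a1"
    using np[THEN integrable_on_segment] by (simp add: rectpath_def Let_def a algebra_simps)
  have sp1: "seg_integral a2 a3 = seg_integral a2 ?pX + seg_integral ?pX a3"
    using X(3) X0 by (intro contour_integral_split_linepath continuous_integrand np vertical_segment_mem) (auto simp: a)
  have sp2: "seg_integral ?pX a3 = seg_integral ?pX ?qX + seg_integral ?qX a3"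
    using X(4) X0 h by (intro contour_integral_split_linepath continuous_integrand noX vertical_segment_mem) (auto simp: a)
  have r1: "seg_integral ?pX ?qX = - seg_integral ?qX ?pX"
    by (intro contour_integral_reverse_linepath continuous_integrand noX) simp_all
  have r2: "seg_integral a4 a1 = - seg_integral a1 a4"
    by (intro contour_integral_reverse_linepath continuous_integrand np)
  have gen: "A = V - (B + C + D + E)"
    if "A + W + (B + (C + (- W + D)) + E + - V) = 0" for A B C D E V W :: complex
    using that by (simp add: algebra_simps)
  show ?thesis
    unfolding a[symmetric]
    by (rule gen[of _ "seg_integral ?qX ?pX"])
       (use zero in \<open>simp only: sT sQ sp1 sp2 r1 r2\<close>)
qed

text \<open>The four segments that separate the truncated loop from the imaginary axis keep the distance \<open>\<phi>\<close>
  from the real axis and have length at most \<open>X\<close>. The integrand is exponentially small in \<open>X\<close> on all of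
  them.\<close>

lemma right_loop_contour_integral:
  assumes adm: "admissible Right_Loop g" and I: "has_infinite_contour_integral integrand I Right_Loop g"
  shows "I = \<i> * axis_integral"
proof -
  let ?p0 = "pathstart g" and ?q0 = "pathfinish g"
  have vp: "valid_path g" by (rule admissible_valid[OF adm])
  have h: "Im ?p0 < 0" "0 < Im ?q0" using right_loop_heights[OF adm] by auto
  obtain M where M: "\<And>z. z \<in> path_image g \<Longrightarrow> Re z \<le> M"
    by (rule path_image_Re_bounded[OF vp]) blast
  \<comment> \<open>The distance of the two rays from the real axis.\<close>
  define \<phi> where "\<phi> = min (- Im ?p0) (Im ?q0)"
  have \<phi>: "0 < \<phi>" using h by (simp add: \<phi>_def)
  obtain C c where C: "0 < C" "0 < c"
    "\<And>s. - 0 \<le> Re s \<Longrightarrow> \<phi> \<le> \<bar>Im s\<bar> \<Longrightarrow> norm (integrand s) \<le> C * exp (- c * \<bar>Im s\<bar> - Re s)"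
    by (rule integrand_decay[OF \<phi>, of 0]) blast
  have pX: "Complex X (Im ?p0) = ?p0 + of_real (X - Re ?p0) * start_dir Right_Loop"
    "Complex X (Im ?q0) = ?q0 + of_real (X - Re ?q0) * end_dir Right_Loop" for X
    by (simp_all add: complex_eq_iff)
  have cut_shift: "filterlim (\<lambda>j. cut_abscissa j - x) at_top sequentially" for x
    using filterlim_tendsto_add_at_top[OF tendsto_const[of "- x"] filterlim_cut_abscissa] by simp
  have lim: "(\<lambda>j. seg_integral (Complex (cut_abscissa j) (Im ?p0)) ?p0 + contour_integral g integrand +
      seg_integral ?q0 (Complex (cut_abscissa j) (Im ?q0))) \<longlonglongrightarrow> I"
    unfolding pX by (rule infinite_contour_integral_limit[OF adm I cut_shift cut_shift])
  define E where "E = (\<lambda>X. seg_integral (Complex 0 (- X)) (Complex X (- X)) +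
     seg_integral (Complex X (- X)) (Complex X (Im ?p0)) +
     seg_integral (Complex X (Im ?q0)) (Complex X X) +
     seg_integral (Complex X X) (Complex 0 X))"
  have large: "\<forall>\<^sub>F j in sequentially. max (max M 1) (max \<bar>Im ?p0\<bar> \<bar>Im ?q0\<bar>) + 1 \<le> cut_abscissa j"
    using filterlim_cut_abscissa by (auto simp: filterlim_at_top)
  have E0: "(\<lambda>j. E (cut_abscissa j)) \<longlonglongrightarrow> 0"
  proof (rule Lim_null_comparison)
    show "\<forall>\<^sub>F j in sequentially. norm (E (cut_abscissa j)) \<le> 2 * C * (cut_abscissa j * exp (- (c * cut_abscissa j))) + 2 * C * (cut_abscissa j * exp (- cut_abscissa j))"
      using large
    proof eventually_elim
      case (elim j)
      define X where "X = cut_abscissa j"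
      have X: "1 \<le> X" "\<bar>Im ?p0\<bar> < X" "\<bar>Im ?q0\<bar> < X" using elim by (auto simp: X_def)
      have \<phi>X: "\<phi> \<le> X" using X h by (auto simp: \<phi>_def)
      have hb: "norm (seg_integral (Complex x y) (Complex x' y)) \<le> C * exp (- (c * X)) * X"
        if "\<bar>y\<bar> = X" "{x, x'} = {0, X}" for x x' y
      proof -
        have "norm (seg_integral (Complex x y) (Complex x' y)) \<le>
            C * exp (- (c * X)) * \<bar>Re (Complex x' y) - Re (Complex x y)\<bar>"
        proof (rule horizontal_integral_bound)
          fix s assume s: "min (Re (Complex x y)) (Re (Complex x' y)) \<le> Re s" "Im s = Im (Complex x y)"
          have s0: "- 0 \<le> Re s" using s that(2) X by (auto simp: doubleton_eq_iff)
          have "norm (integrand s) \<le> C * exp (- c * X - Re s)" using C(3)[OF s0] s that \<phi>X by simp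
          also have "\<dots> \<le> C * exp (- (c * X))" using s0 C(1) by (intro mult_left_mono) auto
          finally show "norm (integrand s) \<le> C * exp (- (c * X))" .
        qed (use that X in auto)
        also have "\<bar>Re (Complex x' y) - Re (Complex x y)\<bar> = X" using that(2) X by (auto simp: doubleton_eq_iff)
        finally show ?thesis .
      qed
      have vb: "norm (seg_integral (Complex X y) (Complex X y')) \<le> C * exp (- X) * X"
        if y: "y < y'" "y' - y \<le> X" "y' \<le> - \<phi> \<or> \<phi> \<le> y" for y y'
      proof -
        have mem: "Re s = X \<and> \<phi> \<le> \<bar>Im s\<bar>" if "s \<in> closed_segment (Complex X y) (Complex X y')" for s
          using closed_segment_box[OF that] y by auto
        have "norm (seg_integral (Complex X y) (Complex X y')) \<le>
            C * exp (- X) * norm (Complex X y' - Complex X y)"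
        proof (rule contour_integral_bound_linepath)
          show "integrand contour_integrable_on linepath (Complex X y) (Complex X y')"
          proof (intro integrable_on_segment disjoint_polesI disjI1)
            fix s assume "s \<in> closed_segment (Complex X y) (Complex X y')"
            from mem[OF this] \<phi> show "Im s \<noteq> 0" by auto
          qed
          fix s assume "s \<in> closed_segment (Complex X y) (Complex X y')"
          from mem[OF this] have s: "Re s = X" "\<phi> \<le> \<bar>Im s\<bar>" by auto
          then have "norm (integrand s) \<le> C * exp (- c * \<bar>Im s\<bar> - X)" using C(3)[of s] X by simp
          also have "\<dots> \<le> C * exp (- X)" using C by (intro mult_left_mono) auto
          finally show "norm (integrand s) \<le> C * exp (- X)" .
        qed (use C(1) in simp)
        also have "norm (Complex X y' - Complex X y) = y' - y" using y(1) by (simp add: norm_complex_def)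
        also have "C * exp (- X) * (y' - y) \<le> C * exp (- X) * X" using y(2) C(1) by (intro mult_left_mono) auto
        finally show ?thesis .
      qed
      have "norm (E X) \<le> C * exp (- (c * X)) * X + C * exp (- X) * X + C * exp (- X) * X + C * exp (- (c * X)) * X"
        unfolding E_def using X h
        by (intro norm_triangle_mono hb vb) (auto simp: \<phi>_def)
      then show ?case unfolding X_def[symmetric] by (simp add: algebra_simps)
    qed
    have xe: "(\<lambda>j. cut_abscissa j * exp (- (d * cut_abscissa j))) \<longlonglongrightarrow> 0" if d: "0 < d" for d
    proof -
      have "filterlim (\<lambda>j. d * cut_abscissa j) at_top sequentially"
        using d by (intro filterlim_tendsto_pos_mult_at_top[OF tendsto_const] filterlim_cut_abscissa)
      from filterlim_compose[OF tendsto_power_div_exp_0[of 1] this]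
      have "(\<lambda>j. 1 / d * ((d * cut_abscissa j) ^ 1 / exp (d * cut_abscissa j))) \<longlonglongrightarrow> 1 / d * 0"
        by (intro tendsto_mult tendsto_const)
      moreover have "1 / d * ((d * x) ^ 1 / exp (d * x)) = x * exp (- (d * x))" for x
        using d by (simp add: exp_minus divide_inverse)
      ultimately show ?thesis by simp
    qed
    have "(\<lambda>j. 2 * C * (cut_abscissa j * exp (- (c * cut_abscissa j))) + 2 * C * (cut_abscissa j * exp (- (1 * cut_abscissa j)))) \<longlonglongrightarrow> 2 * C * 0 + 2 * C * 0"
      by (intro tendsto_intros xe) (use C in auto)
    then show "(\<lambda>j. 2 * C * (cut_abscissa j * exp (- (c * cut_abscissa j))) + 2 * C * (cut_abscissa j * exp (- cut_abscissa j))) \<longlonglongrightarrow> 0" by simp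
  qed
  have axis: "(\<lambda>j. seg_integral (\<i> * of_real (- cut_abscissa j)) (\<i> * of_real (cut_abscissa j))) \<longlonglongrightarrow> \<i> * axis_integral"
    by (intro imaginary_axis_limit filterlim_cut_abscissa filterlim_compose[OF filterlim_uminus_at_bot_at_top])
  have "(\<lambda>j. seg_integral (\<i> * of_real (- cut_abscissa j)) (\<i> * of_real (cut_abscissa j)) - E (cut_abscissa j)) \<longlonglongrightarrow> \<i> * axis_integral - 0"
    by (intro tendsto_diff axis E0)
  then have "(\<lambda>j. seg_integral (Complex (cut_abscissa j) (Im ?p0)) ?p0 + contour_integral g integrand +
      seg_integral ?q0 (Complex (cut_abscissa j) (Im ?q0))) \<longlonglongrightarrow> \<i> * axis_integral - 0"
  proof (rule Lim_transform_eventually)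
    show "\<forall>\<^sub>F j in sequentially. seg_integral (\<i> * of_real (- cut_abscissa j)) (\<i> * of_real (cut_abscissa j)) - E (cut_abscissa j) =
      seg_integral (Complex (cut_abscissa j) (Im ?p0)) ?p0 + contour_integral g integrand +
      seg_integral ?q0 (Complex (cut_abscissa j) (Im ?q0))"
      using large
    proof eventually_elim
      case (elim j)
      have "\<i> * of_real (- cut_abscissa j) = Complex 0 (- cut_abscissa j)" "\<i> * of_real (cut_abscissa j) = Complex 0 (cut_abscissa j)"
        by (simp_all add: complex_eq_iff)
      then show ?case
        unfolding E_def using right_loop_truncated[OF adm M refl, of j] elim by simp
    qed
  qed
  with lim show ?thesis using LIMSEQ_unique by fastforce
qed
end

section \<open>The Fox function and the theorem\<close>

context mellin_barnes
begin

lemma infinite_contour_integral_value: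
  assumes "admissible \<kappa> g" "has_infinite_contour_integral integrand I \<kappa> g"
  shows "I = \<i> * axis_integral"
proof (cases \<kappa>)
  case Left_Loop
  have "(\<lambda>r. integrand (pathstart g + of_real r * - 1)) integrable_on {0..}"
    using assms(2) unfolding has_infinite_contour_integral_def Left_Loop by (auto simp: integrable_on_def)
  then have "(\<lambda>r. stable_mellin \<alpha> k n (pathstart g - of_real r) * of_real t powr (- (pathstart g - of_real r))) integrable_on {0..}"
    by (simp add: integrand_def)
  then show ?thesis using stable_mellin_left_ray_not_integrable[OF alpha t] by blast
next
  case Right_Loop
  then show ?thesis using right_loop_contour_integral assms by blast
next
  case Vertical
  then show ?thesis using vertical_contour_integral assms by blast
qed

text \<open>This contour and the convergence of its integral show that the Fox function has a value at all.\<close>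

lemma imaginary_axis_admissible: "admissible Vertical (linepath (- \<i>) \<i>)"
proof -
  have re: "Re z = 0 \<and> a \<le> Im z \<and> Im z \<le> b" if "z \<in> closed_segment (Complex 0 a) (Complex 0 b)" "a \<le> b" for z a b
    using closed_segment_box[OF that(1)] that(2) by auto
  have arc: "arc (truncated_contour Vertical (linepath (- \<i>) \<i>) R)" if R: "0 < R" for R :: real
  proof -
    have e: "- \<i> + of_real R * - \<i> = Complex 0 (- 1 - R)" "\<i> + of_real R * \<i> = Complex 0 (1 + R)"
      "- \<i> = Complex 0 (- 1)" "\<i> = Complex 0 1"
      by (simp_all add: complex_eq_iff)
    have tc: "truncated_contour Vertical (linepath (- \<i>) \<i>) R = linepath (Complex 0 (- 1 - R)) (Complex 0 (- 1)) +++
        linepath (Complex 0 (- 1)) (Complex 0 1) +++ linepath (Complex 0 1) (Complex 0 (1 + R))"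
      unfolding truncated_contour_def pathstart_linepath pathfinish_linepath start_dir.simps end_dir.simps e(1,2)
      unfolding e(3) unfolding e(4) ..
    have inner: "arc (linepath (Complex 0 (- 1)) (Complex 0 1) +++ linepath (Complex 0 1) (Complex 0 (1 + R)))"
    proof (rule arc_join)
      show "path_image (linepath (Complex 0 (- 1)) (Complex 0 1)) \<inter> path_image (linepath (Complex 0 1) (Complex 0 (1 + R)))
          \<subseteq> {pathstart (linepath (Complex 0 1) (Complex 0 (1 + R)))}"
      proof
        fix z assume z: "z \<in> path_image (linepath (Complex 0 (- 1)) (Complex 0 1)) \<inter> path_image (linepath (Complex 0 1) (Complex 0 (1 + R)))"
        then have "Re z = 0" "Im z \<le> 1" "1 \<le> Im z"
          using re[of z "- 1" 1] re[of z 1 "1 + R"] R by auto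
        then show "z \<in> {pathstart (linepath (Complex 0 1) (Complex 0 (1 + R)))}" by (simp add: complex_eq_iff)
      qed
    qed (use R in \<open>auto simp: complex_eq_iff\<close>)
    show ?thesis unfolding tc
    proof (rule arc_join[OF _ inner])
      show "path_image (linepath (Complex 0 (- 1 - R)) (Complex 0 (- 1))) \<inter>
          path_image (linepath (Complex 0 (- 1)) (Complex 0 1) +++ linepath (Complex 0 1) (Complex 0 (1 + R)))
          \<subseteq> {pathstart (linepath (Complex 0 (- 1)) (Complex 0 1) +++ linepath (Complex 0 1) (Complex 0 (1 + R)))}"
      proof
        fix z assume z: "z \<in> path_image (linepath (Complex 0 (- 1 - R)) (Complex 0 (- 1))) \<inter>
          path_image (linepath (Complex 0 (- 1)) (Complex 0 1) +++ linepath (Complex 0 1) (Complex 0 (1 + R)))"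
        then have "Re z = 0" "Im z \<le> - 1" "- 1 \<le> Im z"
          using re[of z "- 1 - R" "- 1"] re[of z "- 1" 1] re[of z 1 "1 + R"] R by (auto simp: path_image_join)
        then show "z \<in> {pathstart (linepath (Complex 0 (- 1)) (Complex 0 1) +++ linepath (Complex 0 1) (Complex 0 (1 + R)))}"
          by (simp add: complex_eq_iff)
      qed
    qed (use R in \<open>auto simp: complex_eq_iff\<close>)
  qed
  have "infinite_contour Vertical (linepath (- \<i>) \<i>)"
    unfolding infinite_contour_def using arc by simp
  moreover have "right_of_contour Vertical (linepath (- \<i>) \<i>) s" if s: "s \<in> poles" for s
    unfolding right_of_contour_def
  proof (rule eventually_at_top_linorderI[of 0])
    fix R :: real assume R: "0 \<le> R"
    let ?c = "closed_contour Vertical (linepath (- \<i>) \<i>) R"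
    have seg: "closed_segment a b \<subseteq> {s. Re s \<le> 0}" if "Re a \<le> 0" "Re b \<le> 0" for a b
      using that by (intro closed_segment_subset convex_halfspace_Re_le) auto
    have sub: "path_image ?c \<subseteq> {s. Re s \<le> 0}"
      unfolding path_image_closed_contour path_image_linepath using R by (intro Un_least seg) auto
    have "s \<notin> {s. Re s \<le> 0}" using poles_real(2)[OF s] by auto
    moreover from this have "winding_number ?c s = 0"
      using sub path_image_closed_contour[where g = "linepath (- \<i>) \<i>" and R = R and \<kappa> = Vertical]
      by (intro winding_number_zero_outside[of _ "{s. Re s \<le> 0}"] convex_halfspace_Re_le)
         (auto intro: valid_path_imp_path)
    ultimately show "s \<notin> path_image ?c \<and> winding_number ?c s = (if Vertical = Right_Loop then - 1 else 0)"
      using sub by auto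
  qed
  ultimately show ?thesis by (simp add: admissible_def)
qed

lemma imaginary_axis_integral_exists: "\<exists>I. has_infinite_contour_integral integrand I Vertical (linepath (- \<i>) \<i>)"
proof -
  have ray: "(\<lambda>r. integrand (\<i> * of_real (a + c * r))) integrable_on {0..}" if "c \<noteq> 0" for a c
  proof -
    have "integrable lborel (\<lambda>r. integrand (\<i> * of_real (a + c * r)))"
      by (rule lborel_integrable_real_affine[OF integrable_imaginary_axis that])
    then have "set_integrable lborel {0..} (\<lambda>r. integrand (\<i> * of_real (a + c * r)))"
      unfolding set_integrable_def by (intro integrable_mult_indicator) auto
    then show ?thesis by (rule set_borel_integral_eq_integral(1))
  qed
  have e: "- \<i> + of_real r * - \<i> = \<i> * of_real (- 1 + (- 1) * r)" "\<i> + of_real r * \<i> = \<i> * of_real (1 + 1 * r)" for r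
    by (simp_all add: algebra_simps)
  have "closed_segment (- \<i>) \<i> \<inter> poles = {}"
    by (intro disjoint_polesI disjI2) (auto dest!: closed_segment_box(2))
  then have "integrand contour_integrable_on linepath (- \<i>) \<i>" by (rule integrable_on_segment)
  then obtain I1 where I1: "(integrand has_contour_integral I1) (linepath (- \<i>) \<i>)"
    by (auto simp: contour_integrable_on_def)
  from ray[of "- 1" "- 1"] obtain I0 where I0: "((\<lambda>r. integrand (- \<i> + of_real r * - \<i>)) has_integral I0) {0..}"
    unfolding e(1) integrable_on_def by auto
  from ray[of 1 1] obtain I2 where I2: "((\<lambda>r. integrand (\<i> + of_real r * \<i>)) has_integral I2) {0..}"
    unfolding e(2) integrable_on_def by auto
  show ?thesis
    unfolding has_infinite_contour_integral_def using I0 I1 I2 by auto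
qed

abbreviation "as_params \<equiv> [(complex_of_real (1 - 1 / \<alpha> - real k), 1 / \<alpha>)]"
abbreviation "bs_params \<equiv> [(- complex_of_nat n, 1 :: real)]"

lemma gamma_argument: "1 - complex_of_real (1 - 1 / \<alpha> - real k) - of_real (1 / \<alpha>) * s = of_nat k + (1 - s) / of_real \<alpha>"
  using alpha by (simp add: field_simps)

lemma fox_integrand_eq: "fox_integrand 0 1 as_params bs_params (of_real t) = integrand"
proof
  fix s
  have "fox_integrand 0 1 as_params bs_params (of_real t) s =
      Gamma (1 - complex_of_real (1 - 1 / \<alpha> - real k) - of_real (1 / \<alpha>) * s) / Gamma (1 - - of_nat n - of_real 1 * s) * of_real t powr (- s)"
    by (simp add: fox_integrand_def del: of_real_diff of_real_divide)
  also have "\<dots> = integrand s"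
    unfolding gamma_argument by (simp add: integrand_def stable_mellin_def rGamma_inverse_Gamma divide_inverse add.commute)
  finally show "fox_integrand 0 1 as_params bs_params (of_real t) s = integrand s" .
qed

lemma is_pole_iff: "is_pole (\<lambda>s. Gamma (of_nat k + (1 - s) / of_real \<alpha>)) s \<longleftrightarrow> s \<in> poles"
proof
  assume p: "is_pole (\<lambda>s. Gamma (of_nat k + (1 - s) / of_real \<alpha>)) s"
  show "s \<in> poles"
  proof (rule ccontr)
    assume "s \<notin> poles"
    moreover have "(Gamma \<circ> (\<lambda>s. of_nat k + (1 - s) / of_real \<alpha>)) holomorphic_on - poles"
      using alpha by (intro holomorphic_on_compose_gen[of _ _ Gamma "- \<int>\<^sub>\<le>\<^sub>0"] holomorphic_intros) (auto simp: poles_def)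
    ultimately show False
      using not_is_pole_holomorphic[OF open_Compl[OF closed_poles]] p by (auto simp: o_def)
  qed
next
  assume s: "s \<in> poles"
  then obtain m where m: "of_nat k + (1 - s) / of_real \<alpha> = - of_nat m"
    by (auto simp: poles_def elim: nonpos_Ints_cases')
  define l where "l = (\<lambda>s. of_nat k + (1 - s) / complex_of_real \<alpha>)"
  have "filterlim l (at (l s)) (at s)"
  proof (rule filterlim_atI)
    show "(l \<longlongrightarrow> l s) (at s)" unfolding l_def using alpha by (intro tendsto_intros) auto
    show "\<forall>\<^sub>F w in at s. l w \<noteq> l s"
      using alpha by (auto simp: l_def eventually_at intro!: exI[of _ 1])
  qed
  moreover have "filterlim Gamma at_infinity (at (l s))"
    using is_pole_Gamma[of m] m by (simp add: is_pole_def l_def)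
  ultimately have "filterlim (\<lambda>s. Gamma (l s)) at_infinity (at s)"
    by (rule filterlim_compose[rotated])
  then show "is_pole (\<lambda>s. Gamma (of_nat k + (1 - s) / of_real \<alpha>)) s"
    by (simp add: is_pole_def l_def)
qed

lemma fox_contour_iff: "fox_contour 0 1 as_params bs_params \<kappa> g \<longleftrightarrow> admissible \<kappa> g"
proof -
  have "fst (as_params ! 0) = complex_of_real (1 - 1 / \<alpha> - real k)" "snd (as_params ! 0) = 1 / \<alpha>" by simp_all
  then have "is_pole (\<lambda>s. Gamma (1 - fst (as_params ! 0) - of_real (snd (as_params ! 0)) * s)) s \<longleftrightarrow> s \<in> poles" for s
    by (simp only: gamma_argument is_pole_iff)
  then show ?thesis
    unfolding fox_contour_def admissible_def using alpha by (auto simp del: of_real_diff of_real_divide)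
qed

text \<open>Every admissible contour with a convergent integral gives the same value, and the imaginary axis is
  such a contour.\<close>

lemma fox_H_eq: "fox_H 0 1 as_params bs_params (of_real t) = axis_integral / (2 * of_real pi)"
  unfolding fox_H_def fox_integrand_eq fox_contour_iff
proof (rule the_equality)
  from imaginary_axis_integral_exists obtain I where I: "has_infinite_contour_integral integrand I Vertical (linepath (- \<i>) \<i>)" by blast
  have "I = \<i> * axis_integral" by (rule infinite_contour_integral_value[OF imaginary_axis_admissible I])
  then have "axis_integral / (2 * of_real pi) = 1 / (2 * of_real pi * \<i>) * I" by simp
  then show "\<exists>\<kappa> g I. admissible \<kappa> g \<and> has_infinite_contour_integral integrand I \<kappa> g \<and> axis_integral / (2 * of_real pi) = 1 / (2 * of_real pi * \<i>) * I"
    using imaginary_axis_admissible I by blast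
next
  fix h assume "\<exists>\<kappa> g I. admissible \<kappa> g \<and> has_infinite_contour_integral integrand I \<kappa> g \<and> h = 1 / (2 * of_real pi * \<i>) * I"
  then obtain \<kappa> g I where "admissible \<kappa> g" "has_infinite_contour_integral integrand I \<kappa> g" "h = 1 / (2 * of_real pi * \<i>) * I" by blast
  then show "h = axis_integral / (2 * of_real pi)"
    using infinite_contour_integral_value[of \<kappa> g I] by (simp add: field_simps)
qed

end

context stable_density
begin

lemma fox_H_stable:
  assumes "k \<le> n" "0 < t"
  shows "fox_H 0 1 [(of_real (1 - 1 / \<alpha> - real k), 1 / \<alpha>)] [(- of_nat n, 1)] (of_real t) =
    1 / (2 * of_real pi) * (LBINT y. iexp (- (y * ln t)) * stable_mellin \<alpha> k n (\<i> * of_real y))"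
proof -
  interpret mellin_barnes \<alpha> t k n by unfold_locales (use alpha assms in auto)
  show ?thesis unfolding fox_H_eq axis_integral_def integrand_imaginary by simp
qed

lemma stable_G_fox_H:
  assumes "1 \<le> k" "k \<le> n" "0 < t"
  shows "complex_of_real (stable_G \<alpha> f n k t) = of_real (\<alpha> ^ k) *
       (fox_H 0 1 [(of_real (1 - 1 / \<alpha> - real k), 1 / \<alpha>)] [(- of_nat n, 1)] (of_real t) /
        fox_H 0 1 [(of_real (1 - 1 / \<alpha>), 1 / \<alpha>)] [(0, 1)] (of_real t))"
proof -
  have nz: "Gamma (real n) \<noteq> 0" "Gamma (real k) \<noteq> 0"
    using assms by (auto intro!: less_imp_neq[OF Gamma_real_pos, symmetric])
  have den: "fox_H 0 1 [(of_real (1 - 1 / \<alpha>), 1 / \<alpha>)] [(0, 1)] (of_real t) = of_real (\<alpha> * f t)"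
  proof -
    have "of_real (f (exp (ln t))) = 1 / (2 * of_real pi * of_real \<alpha>) *
        (LBINT y. iexp (- (y * ln t)) * stable_mellin \<alpha> 0 0 (\<i> * of_real y))"
      by (rule density_eq_mellin_inversion)
    then have "of_real \<alpha> * complex_of_real (f t) = 1 / (2 * of_real pi) *
        (LBINT y. iexp (- (y * ln t)) * stable_mellin \<alpha> 0 0 (\<i> * of_real y))"
      using alpha assms(3) by simp
    then show ?thesis using fox_H_stable[of 0 0 t] assms(3) by simp
  qed
  have num: "of_real (mixture_density n k t) = of_real (Gamma (real n) / Gamma (real k)) *
      fox_H 0 1 [(of_real (1 - 1 / \<alpha> - real k), 1 / \<alpha>)] [(- of_nat n, 1)] (of_real t)"
    unfolding mixture_density_eq[OF assms] fox_H_stable[OF assms(2,3)] ..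
  have "\<alpha> ^ k = \<alpha> * \<alpha> ^ (k - 1)" using assms(1) by (simp flip: power_Suc)
  then show ?thesis
    unfolding stable_G_mixture_density[OF assms] den of_real_mult of_real_divide num using nz alpha by simp
qed

lemma quotients_same_distribution:
  assumes k: "1 \<le> k" "k \<le> n"
    and X1: "tilted_stable_rv \<alpha> (real k * \<alpha>) f \<Omega>1 X1" and B1: "beta_rv (real k * \<alpha>) (real n - real k * \<alpha>) \<Omega>1 B1"
    and i1: "prob_space.indep_var \<Omega>1 borel X1 borel B1"
    and X2: "tilted_stable_rv \<alpha> ((real k - 1) * \<alpha>) f \<Omega>2 X2"
    and B2: "beta_rv ((real k - 1) * \<alpha> + 1) (real n - 1 - (real k - 1) * \<alpha>) \<Omega>2 B2"
    and i2: "prob_space.indep_var \<Omega>2 borel X2 borel B2"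
  shows "distr \<Omega>1 borel (\<lambda>\<omega>. X1 \<omega> / B1 \<omega>) = distr \<Omega>2 borel (\<lambda>\<omega>. X2 \<omega> / B2 \<omega>)"
  unfolding has_pdf_on_distr[OF quotient_density[OF k X1 B1 i1]]
    has_pdf_on_distr[OF quotient_density_shifted[OF k X2 B2 i2]] ..

lemma stable_rv_imp_tilted: "stable_rv \<alpha> f \<Omega> X \<Longrightarrow> tilted_stable_rv \<alpha> 0 f \<Omega> X"
  unfolding stable_rv_def tilted_stable_rv_def
  by (elim conjE, subst has_pdf_on_cong[where g' = f]) auto

end

theorem theorem2p1:
  fixes \<alpha> :: real and n k :: nat and f :: "real \<Rightarrow> real"
    and \<Omega> :: "'a measure" and S :: "'a \<Rightarrow> real"
  assumes "0 < \<alpha>" and "\<alpha> < 1" and "1 \<le> k" and "k \<le> n"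
    and "stable_rv \<alpha> f \<Omega> S"
  shows
    "(\<forall>t>0. stable_G \<alpha> f n k t =
       \<alpha> ^ k * t powr (- (real k * \<alpha>)) / (Gamma (real n - real k * \<alpha>) * f t) *
       integral {0..1} (\<lambda>u. f (t * u) * (1 - u) powr (real n - real k * \<alpha> - 1))) \<and>
     (\<forall>(\<Omega>1 :: 'b measure) X1 B1 (\<Omega>2 :: 'c measure) X2 B2.
       tilted_stable_rv \<alpha> (real k * \<alpha>) f \<Omega>1 X1 \<and>
       beta_rv (real k * \<alpha>) (real n - real k * \<alpha>) \<Omega>1 B1 \<and>
       prob_space.indep_var \<Omega>1 borel X1 borel B1 \<and>
       tilted_stable_rv \<alpha> ((real k - 1) * \<alpha>) f \<Omega>2 X2 \<and>
       beta_rv ((real k - 1) * \<alpha> + 1) (real n - 1 - (real k - 1) * \<alpha>) \<Omega>2 B2 \<and>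
       prob_space.indep_var \<Omega>2 borel X2 borel B2 \<longrightarrow>
       distr \<Omega>1 borel (\<lambda>\<omega>. X1 \<omega> / B1 \<omega>) = distr \<Omega>2 borel (\<lambda>\<omega>. X2 \<omega> / B2 \<omega>) \<and>
       (\<exists>ft. continuous_on {0<..} ft \<and>
          has_pdf_on \<Omega>1 (\<lambda>\<omega>. X1 \<omega> / B1 \<omega>) {0<..} ft \<and>
          has_pdf_on \<Omega>2 (\<lambda>\<omega>. X2 \<omega> / B2 \<omega>) {0<..} ft \<and>
          (\<forall>t>0. stable_G \<alpha> f n k t =
             \<alpha> ^ (k - 1) * Gamma (real k) / Gamma (real n) * (ft t / f t)))) \<and>
     (\<forall>(\<Omega>1 :: 'b measure) X1 B1 (\<Omega>2 :: 'c measure) X2 B2.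
       stable_rv \<alpha> f \<Omega>1 X1 \<and> beta_rv 1 (real n - 1) \<Omega>1 B1 \<and>
       prob_space.indep_var \<Omega>1 borel X1 borel B1 \<and>
       tilted_stable_rv \<alpha> \<alpha> f \<Omega>2 X2 \<and> beta_rv \<alpha> (real n - \<alpha>) \<Omega>2 B2 \<and>
       prob_space.indep_var \<Omega>2 borel X2 borel B2 \<longrightarrow>
       distr \<Omega>1 borel (\<lambda>\<omega>. X1 \<omega> / B1 \<omega>) = distr \<Omega>2 borel (\<lambda>\<omega>. X2 \<omega> / B2 \<omega>)) \<and>
     (\<forall>t>0. complex_of_real (stable_G \<alpha> f n k t) =
       of_real (\<alpha> ^ k) *
       (fox_H 0 1 [(of_real (1 - 1 / \<alpha> - real k), 1 / \<alpha>)] [(- of_nat n, 1)] (of_real t) /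
        fox_H 0 1 [(of_real (1 - 1 / \<alpha>), 1 / \<alpha>)] [(0, 1)] (of_real t)))"
proof -
  interpret stable_density \<alpha> f by (rule stable_rv_imp_stable_density[OF assms(1,2,5)])
  note k = assms(3,4)
  have n: "1 \<le> n" using k by linarith
  show ?thesis
  proof (intro conjI allI impI)
    show "stable_G \<alpha> f n k t =
       \<alpha> ^ k * t powr (- (real k * \<alpha>)) / (Gamma (real n - real k * \<alpha>) * f t) *
       integral {0..1} (\<lambda>u. f (t * u) * (1 - u) powr (real n - real k * \<alpha> - 1))" if "0 < t" for t
      by (rule stable_G_eq(1)[OF k that])
    show "complex_of_real (stable_G \<alpha> f n k t) = of_real (\<alpha> ^ k) *
       (fox_H 0 1 [(of_real (1 - 1 / \<alpha> - real k), 1 / \<alpha>)] [(- of_nat n, 1)] (of_real t) /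
        fox_H 0 1 [(of_real (1 - 1 / \<alpha>), 1 / \<alpha>)] [(0, 1)] (of_real t))" if "0 < t" for t
      by (rule stable_G_fox_H[OF k that])
  next
    fix \<Omega>1 :: "'b measure" and X1 B1 and \<Omega>2 :: "'c measure" and X2 B2
    assume a: "tilted_stable_rv \<alpha> (real k * \<alpha>) f \<Omega>1 X1 \<and>
       beta_rv (real k * \<alpha>) (real n - real k * \<alpha>) \<Omega>1 B1 \<and>
       prob_space.indep_var \<Omega>1 borel X1 borel B1 \<and>
       tilted_stable_rv \<alpha> ((real k - 1) * \<alpha>) f \<Omega>2 X2 \<and>
       beta_rv ((real k - 1) * \<alpha> + 1) (real n - 1 - (real k - 1) * \<alpha>) \<Omega>2 B2 \<and>
       prob_space.indep_var \<Omega>2 borel X2 borel B2"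
    then show "distr \<Omega>1 borel (\<lambda>\<omega>. X1 \<omega> / B1 \<omega>) = distr \<Omega>2 borel (\<lambda>\<omega>. X2 \<omega> / B2 \<omega>)"
      by (elim conjE) (rule quotients_same_distribution[OF k])
    from a have "has_pdf_on \<Omega>1 (\<lambda>\<omega>. X1 \<omega> / B1 \<omega>) {0<..} (mixture_density n k)"
      by (elim conjE) (rule quotient_density[OF k])
    moreover from a have "has_pdf_on \<Omega>2 (\<lambda>\<omega>. X2 \<omega> / B2 \<omega>) {0<..} (mixture_density n k)"
      by (elim conjE) (rule quotient_density_shifted[OF k])
    ultimately show "\<exists>ft. continuous_on {0<..} ft \<and>
          has_pdf_on \<Omega>1 (\<lambda>\<omega>. X1 \<omega> / B1 \<omega>) {0<..} ft \<and>
          has_pdf_on \<Omega>2 (\<lambda>\<omega>. X2 \<omega> / B2 \<omega>) {0<..} ft \<and>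
          (\<forall>t>0. stable_G \<alpha> f n k t =
             \<alpha> ^ (k - 1) * Gamma (real k) / Gamma (real n) * (ft t / f t))"
      using continuous_mixture_density[OF k] stable_G_mixture_density[OF k] by blast
  next
    fix \<Omega>1 :: "'b measure" and X1 B1 and \<Omega>2 :: "'c measure" and X2 B2
    assume a: "stable_rv \<alpha> f \<Omega>1 X1 \<and> beta_rv 1 (real n - 1) \<Omega>1 B1 \<and>
       prob_space.indep_var \<Omega>1 borel X1 borel B1 \<and>
       tilted_stable_rv \<alpha> \<alpha> f \<Omega>2 X2 \<and> beta_rv \<alpha> (real n - \<alpha>) \<Omega>2 B2 \<and>
       prob_space.indep_var \<Omega>2 borel X2 borel B2"
    then have "distr \<Omega>2 borel (\<lambda>\<omega>. X2 \<omega> / B2 \<omega>) = distr \<Omega>1 borel (\<lambda>\<omega>. X1 \<omega> / B1 \<omega>)"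
      using n stable_rv_imp_tilted by (intro quotients_same_distribution[of 1 n]) auto
    then show "distr \<Omega>1 borel (\<lambda>\<omega>. X1 \<omega> / B1 \<omega>) = distr \<Omega>2 borel (\<lambda>\<omega>. X2 \<omega> / B2 \<omega>)" ..
  qed
qed

end
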